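(* Let $\lambda\ge 0$, $\eta$ and $\alpha_1,\dots,\alpha_\lambda$ be integers with $0<\alpha_1<\cdots<\alpha_\lambda<\eta$ and $\alpha_i=\eta-\alpha_{\lambda+1-i}$ for $1\le i\le\lambda$, and let $k,r$ be integers with $k\ge r\ge\lambda\ge 0$ and $k>\lambda$. Then, as formal power series in $q$, \[ \sum_{n\ge0}\overline{B}_1(\alpha_1,\ldots,\alpha_\lambda;\eta,k,r;n)q^n=(-q^\eta;q^\eta)_\infty\sum_{n\ge0}B_0(\alpha_1,\ldots,\alpha_\lambda;\eta,k,r;n)q^n . \]
   Context: Notation: $(a;q)_\infty=\prod_{i\ge0}(1-aq^i)$. Overpartitions: an overpartition of $n$ is a partition of $n$ in which the first occurrence of a part size may be overlined (so overlined parts have distinct sizes). Parts are totally ordered by $1<\bar1<2<\bar2<3<\cdots$; an overpartition is written $\pi=(\pi_1,\dots,\pi_s)$ with $\pi_1\ge\cdots\ge\pi_s$ in this order, and all inequalities between parts (and expressions $x\pm\eta$) are taken in this order, where for a part $x$, $x\pm\eta$ denotes the part of size $|x|\pm\eta$ which is overlined iff $x$ is. For a part $x$, $[x/\eta]$ denotes $\lfloor |x|/\eta\rfloor$. $\overline{V}_\pi(N)$ is the number of overlined parts of $\pi$ that are $\le N$ (in this order). $\overline{B}_j(\alpha_1,\ldots,\alpha_\lambda;\eta,k,r;n)$ (for $j\in\{0,1\}$, $k\ge r\ge\lambda\ge0$, $k-1+j>\lambda$) is the number of overpartitions $\pi=(\pi_1,\dots,\pi_s)$ of $n$ such that: (1)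 every part has size $\equiv 0,\alpha_1,\ldots,\alpha_\lambda\pmod\eta$; (2) only parts whose size is a multiple of $\eta$ may be non-overlined; (3) $\pi_i\ge\pi_{i+k-1}+\eta$ whenever $i+k-1\le s$, with strict inequality if $\pi_i$ is non-overlined; (4) at most $r-1$ of the parts satisfy $\pi_i\le\eta$; (5) whenever $i+k-2\le s$ and $\pi_i\le\pi_{i+k-2}+\eta$ with strict inequality if $\pi_i$ is overlined, then $[\pi_i/\eta]+\cdots+[\pi_{i+k-2}/\eta]\equiv r-1+\overline{V}_\pi(\pi_i)\pmod{2-j}$. $B_j(\alpha_1,\ldots,\alpha_\lambda;\eta,k,r;n)$ (Bressoud) is the number of ordinary partitions $(\pi_1,\dots,\pi_s)$ of $n$ with $\pi_1\ge\cdots\ge\pi_s$ such that: (1) $\pi_i\equiv0,\alpha_1,\ldots,\alpha_\lambda\pmod\eta$; (2) only multiples of $\eta$ may be repeated; (3) $\pi_i\ge\pi_{i+k-1}+\eta$, with strict inequality if $\eta\mid\pi_i$; (4) at most $r-1$ of the $\pi_i$ are $\le\eta$; (5) if $\pi_i\le\pi_{i+k-2}+\eta$, with strict inequality if $\eta\nmid\pi_i$, then $\lfloor\pi_i/\eta\rfloor+\cdots+\lfloor\pi_{i+k-2}/\eta\rfloor\equiv r-1+V_\pi(\pi_i)\pmod{2-j}$, where $V_\pi(N)$ is the number of parts not exceeding $N$ that are not divisible by $\eta$.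
   Formalization: The case k = r = 1 (so λ = 0) is excluded: there condition (3) reads π_i ≥ π_i + η, so only the empty (over)partition is counted, and the identity would read 1 = (−q^η;q^η)_∞, which is false. *)

theory Defs
  imports
    "HOL-Analysis.Analysis"
    "HOL-Computational_Algebra.Formal_Power_Series"
    "HOL-Number_Theory.Cong"
begin

text \<open>
  The infinite product is taken in the usual (\<open>q\<close>-adic) topology of formal power series.
\<close>

definition qpoch_inf :: "int fps \<Rightarrow> int fps \<Rightarrow> int fps" where
  "qpoch_inf a q = (\<Prod>i. 1 - a * q ^ i)"

datatype opart = Part (magn: nat) (overlined: bool)

text \<open>The order on parts is \<open>1 < 1' < 2 < 2' < 3 < \<dots>\<close>, where the prime stands for an overline.\<close>

instantiation opart :: linorder
begin

definition less_eq_opart :: "opart \<Rightarrow> opart \<Rightarrow> bool" where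
  "x \<le> y \<longleftrightarrow> magn x < magn y \<or> magn x = magn y \<and> (overlined x \<longrightarrow> overlined y)"

definition less_opart :: "opart \<Rightarrow> opart \<Rightarrow> bool" where
  "x < y \<longleftrightarrow> magn x < magn y \<or> magn x = magn y \<and> \<not> overlined x \<and> overlined y"

instance
  by standard (auto simp: less_eq_opart_def less_opart_def intro: opart.expand)

end

definition shift :: "opart \<Rightarrow> nat \<Rightarrow> opart" where
  "shift x \<eta> = Part (magn x + \<eta>) (overlined x)"

text \<open>
  In a weakly decreasing list the overlined copy of a part size comes before the non-overlined
  ones, so the only remaining restriction on overlines is that overlined parts are distinct.
\<close>

definition overpartition :: "nat \<Rightarrow> opart list \<Rightarrow> bool" where
  "overpartition n \<pi> \<longleftrightarrow>
     sorted_wrt (\<ge>) \<pi> \<and> (\<forall>x\<in>set \<pi>. 0 < magn x) \<and>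
     distinct (filter overlined \<pi>) \<and> sum_list (map magn \<pi>) = n"

definition overV :: "opart list \<Rightarrow> opart \<Rightarrow> nat" where
  "overV \<pi> N = card {i. i < length \<pi> \<and> overlined (\<pi> ! i) \<and> \<pi> ! i \<le> N}"

text \<open>
  List positions are counted from 0, so the requirement that the index \<open>i + k - 1\<close> is at most the
  number of parts becomes \<open>i + k - 1 < length \<pi>\<close>. The residues \<open>\<alpha>\<close> are indexed by \<open>1, \<dots>, \<lambda>\<close>.
  Condition (4) is stated over the integers because \<open>r = 0\<close> is allowed.
\<close>

definition overB_set ::
  "nat \<Rightarrow> nat \<Rightarrow> (nat \<Rightarrow> nat) \<Rightarrow> nat \<Rightarrow> nat \<Rightarrow> nat \<Rightarrow> nat \<Rightarrow> opart list set" where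
  "overB_set j l \<alpha> \<eta> k r n = {\<pi>. overpartition n \<pi> \<and>
     (\<forall>x\<in>set \<pi>. [magn x = 0] (mod \<eta>) \<or> (\<exists>t\<in>{1..l}. [magn x = \<alpha> t] (mod \<eta>))) \<and>
     (\<forall>x\<in>set \<pi>. \<not> overlined x \<longrightarrow> \<eta> dvd magn x) \<and>
     (\<forall>i. i + k - 1 < length \<pi> \<longrightarrow>
        (if overlined (\<pi> ! i) then \<pi> ! i \<ge> shift (\<pi> ! (i + k - 1)) \<eta>
         else \<pi> ! i > shift (\<pi> ! (i + k - 1)) \<eta>)) \<and>
     int (card {i. i < length \<pi> \<and> \<pi> ! i \<le> Part \<eta> False}) \<le> int r - 1 \<and>
     (\<forall>i. i + k - 2 < length \<pi> \<longrightarrow>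
        (if overlined (\<pi> ! i) then \<pi> ! i < shift (\<pi> ! (i + k - 2)) \<eta>
         else \<pi> ! i \<le> shift (\<pi> ! (i + k - 2)) \<eta>) \<longrightarrow>
        [(\<Sum>t\<in>{i..<i + k - 1}. int (magn (\<pi> ! t) div \<eta>)) = int r - 1 + int (overV \<pi> (\<pi> ! i))]
          (mod 2 - int j))}"

definition overB :: "nat \<Rightarrow> nat \<Rightarrow> (nat \<Rightarrow> nat) \<Rightarrow> nat \<Rightarrow> nat \<Rightarrow> nat \<Rightarrow> nat \<Rightarrow> nat" where
  "overB j l \<alpha> \<eta> k r n = card (overB_set j l \<alpha> \<eta> k r n)"

definition is_partition :: "nat \<Rightarrow> nat list \<Rightarrow> bool" where
  "is_partition n \<pi> \<longleftrightarrow> sorted_wrt (\<ge>) \<pi> \<and> (\<forall>x\<in>set \<pi>. 0 < x) \<and> sum_list \<pi> = n"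

definition bressoudV :: "nat \<Rightarrow> nat list \<Rightarrow> nat \<Rightarrow> nat" where
  "bressoudV \<eta> \<pi> N = card {i. i < length \<pi> \<and> \<not> \<eta> dvd \<pi> ! i \<and> \<pi> ! i \<le> N}"

definition bressoudB_set ::
  "nat \<Rightarrow> nat \<Rightarrow> (nat \<Rightarrow> nat) \<Rightarrow> nat \<Rightarrow> nat \<Rightarrow> nat \<Rightarrow> nat \<Rightarrow> nat list set" where
  "bressoudB_set j l \<alpha> \<eta> k r n = {\<pi>. is_partition n \<pi> \<and>
     (\<forall>x\<in>set \<pi>. [x = 0] (mod \<eta>) \<or> (\<exists>t\<in>{1..l}. [x = \<alpha> t] (mod \<eta>))) \<and>
     (\<forall>x\<in>set \<pi>. count_list \<pi> x > 1 \<longrightarrow> \<eta> dvd x) \<and>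
     (\<forall>i. i + k - 1 < length \<pi> \<longrightarrow>
        (if \<eta> dvd \<pi> ! i then \<pi> ! i > \<pi> ! (i + k - 1) + \<eta>
         else \<pi> ! i \<ge> \<pi> ! (i + k - 1) + \<eta>)) \<and>
     int (card {i. i < length \<pi> \<and> \<pi> ! i \<le> \<eta>}) \<le> int r - 1 \<and>
     (\<forall>i. i + k - 2 < length \<pi> \<longrightarrow>
        (if \<eta> dvd \<pi> ! i then \<pi> ! i \<le> \<pi> ! (i + k - 2) + \<eta>
         else \<pi> ! i < \<pi> ! (i + k - 2) + \<eta>) \<longrightarrow>
        [(\<Sum>t\<in>{i..<i + k - 1}. int (\<pi> ! t div \<eta>)) = int r - 1 + int (bressoudV \<eta> \<pi> (\<pi> ! i))]
          (mod 2 - int j))}"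

definition bressoudB :: "nat \<Rightarrow> nat \<Rightarrow> (nat \<Rightarrow> nat) \<Rightarrow> nat \<Rightarrow> nat \<Rightarrow> nat \<Rightarrow> nat \<Rightarrow> nat" where
  "bressoudB j l \<alpha> \<eta> k r n = card (bressoudB_set j l \<alpha> \<eta> k r n)"

end

theory Submission
  imports Defs
begin

text \<open>
  Put \<open>K = k - 1\<close>. The parts of an overpartition other than the overlined multiples of \<open>\<eta>\<close> form an
  increasing sequence \<open>y\<close>; the overlined multiples \<open>m * \<eta>\<close> are regarded as marks \<open>m\<close>. A band consists
  of \<open>K\<close> consecutive terms of \<open>y\<close> to which condition (5) applies. Choosing disjoint bands greedily, from
  the top or from the bottom, gives the same number of pairwise overlapping bands, called clusters.
  Rotating a cluster replaces its least element \<open>x\<close> by \<open>x + \<eta>\<close> and changes its parity in (5);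
  as \<open>l \<le> K\<close>, overlapping bands have the same parity, so clusters of different parity never block each
  other. Rotating the top \<open>f\<close> clusters therefore realises a distinct part \<open>f * \<eta>\<close> for small \<open>f\<close>.
  A mark \<open>m\<close> with \<open>p\<close> clusters above it can be removed by rotating these clusters back, which accounts
  for a distinct part \<open>(m + p) * \<eta>\<close>, and \<open>m + p\<close> exceeds the number of real clusters.
  Allowing only the distinct parts \<open>i * \<eta>\<close> with \<open>i < f\<close> gives a family of sets which for \<open>f = 1\<close> is
  counted by \<open>B\<^sub>0\<close>, for large \<open>f\<close> by the overpartition function, and whose generating function gets
  multiplied by \<open>1 + q ^ (f * \<eta>)\<close> when \<open>f\<close> increases to \<open>f + 1\<close>.
\<close>

section \<open>Greedy selections of disjoint windows\<close>

text \<open>A distinct part cannot simply be put among the others, since it may complete a run of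
  too many close parts. A rotation instead costs one unit of \<open>P\<close> and raises the
  \<open>level\<close> of its band by one, which leaves a trace in the parity from which it can be
  undone. The bound on \<open>l\<close> gives a pigeonhole argument: a parity change between
  overlapping bands would need \<open>K + 1\<close> parts, not multiples of \<open>P\<close>, with
  different residues, and at most \<open>K\<close> residues are available. The two kinds of moves
  never compete. Below the parts sit \<open>K\<close> virtual ones which form a band, so the last of
  the \<open>M\<close> clusters always exists and has the parity required by (5). Disjoint clusters
  start at least \<open>P\<close> apart, so for \<open>j < M\<close> cluster \<open>j\<close> from
  the top has ceiling at least \<open>M - j\<close>, and every mark has rank at least
  \<open>M\<close>. Hence sizes \<open>f < M\<close> are realised by rotations only and sizes
  \<open>f \<ge> M\<close> by marks. Whether \<open>f\<close> was used is visible in the result: it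
  is then admissible for \<open>f + 1\<close> but not for \<open>f\<close>. Each step of the
  recursion is therefore a bijection onto the difference of two nested families.\<close>

text \<open>
  Selections are enumerated from the largest start to the smallest, starting with index 1.
\<close>

definition separated :: "nat \<Rightarrow> nat \<Rightarrow> (nat \<Rightarrow> nat) \<Rightarrow> bool" where
  "separated K M t \<longleftrightarrow> (\<forall>j. 1 \<le> j \<and> j < M \<longrightarrow> t (Suc j) + K \<le> t j)"

text \<open>The last clause characterises the greedy choice without an algorithm: a window is passed
  over only because a chosen one starts inside it. In \<open>is_bot\<close> it is passed over
  because it starts inside a chosen one.\<close>

definition is_top :: "nat \<Rightarrow> (nat \<Rightarrow> bool) \<Rightarrow> nat \<Rightarrow> (nat \<Rightarrow> nat) \<Rightarrow> bool" where
  "is_top K D M t \<longleftrightarrow> separated K M t \<and> (\<forall>j\<in>{1..M}. D (t j)) \<and>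
     (\<forall>i. D i \<longrightarrow> (\<exists>j\<in>{1..M}. i \<le> t j \<and> t j < i + K))"

definition is_bot :: "nat \<Rightarrow> (nat \<Rightarrow> bool) \<Rightarrow> nat \<Rightarrow> (nat \<Rightarrow> nat) \<Rightarrow> bool" where
  "is_bot K D M b \<longleftrightarrow> separated K M b \<and> (\<forall>j\<in>{1..M}. D (b j)) \<and>
     (\<forall>i. D i \<longrightarrow> (\<exists>j\<in>{1..M}. b j \<le> i \<and> i < b j + K))"

lemma separatedD:
  assumes "separated K M t" "1 \<le> i" "i < j" "j \<le> M"
  shows "t j + K \<le> t i"
  using assms(3,4)
proof (induction j rule: less_induct)
  case (less j)
  obtain j' where j': "j = Suc j'" using less.prems assms(2) by (cases j) auto
  have st: "t (Suc j') + K \<le> t j'"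
    using assms(1,2) less.prems j' unfolding separated_def by auto
  show ?case
  proof (cases "i = j'")
    case True then show ?thesis using st j' by simp
  next
    case False
    then have "t j' + K \<le> t i" using less.IH[of j'] less.prems j' by auto
    then show ?thesis using st j' by simp
  qed
qed

lemma separated_mono:
  assumes "separated K M t" "1 \<le> i" "i \<le> j" "j \<le> M"
  shows "t j \<le> t i"
  using separatedD[OF assms(1,2), of j] assms(3,4) by (cases "i = j") auto

lemma is_topD:
  assumes "is_top K D M t"
  shows "separated K M t" "\<And>j. 1 \<le> j \<Longrightarrow> j \<le> M \<Longrightarrow> D (t j)"
    "\<And>i. D i \<Longrightarrow> \<exists>j\<ge>1. j \<le> M \<and> i \<le> t j \<and> t j < i + K"
  using assms unfolding is_top_def by fastforce+

lemma is_botD: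
  assumes "is_bot K D M b"
  shows "separated K M b" "\<And>j. 1 \<le> j \<Longrightarrow> j \<le> M \<Longrightarrow> D (b j)"
    "\<And>i. D i \<Longrightarrow> \<exists>j\<ge>1. j \<le> M \<and> b j \<le> i \<and> i < b j + K"
  using assms unfolding is_bot_def by fastforce+

lemma is_top_exists:
  assumes "finite {i. D i}" "0 < K"
  shows "\<exists>M t. is_top K D M t"
  using assms(1)
proof (induction "card {i. D i}" arbitrary: D rule: less_induct)
  case less
  show ?case
  proof (cases "{i. D i} = {}")
    case True
    then have "is_top K D 0 (\<lambda>_. 0)" unfolding is_top_def separated_def by auto
    then show ?thesis by blast
  next
    case False
    \<comment> \<open>The largest start is always chosen; the remaining choices come from the starts
      whose windows do not overlap it.\<close>
    define m where "m = Max {i. D i}"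
    have m: "D m" "\<And>i. D i \<Longrightarrow> i \<le> m"
      using Max_in[OF less.prems False] Max_ge[OF less.prems] unfolding m_def by auto
    define D' where "D' i \<longleftrightarrow> D i \<and> i + K \<le> m" for i
    have "m \<notin> {i. D' i}" using assms(2) unfolding D'_def by auto
    moreover have "{i. D' i} \<subseteq> {i. D i}" unfolding D'_def by auto
    ultimately have sub: "{i. D' i} \<subset> {i. D i}" using m(1) by (metis mem_Collect_eq psubsetI)
    obtain M t where t: "is_top K D' M t"
      using less.hyps[of D'] psubset_card_mono[OF less.prems sub]
        finite_subset[OF psubset_imp_subset[OF sub] less.prems] by auto
    define t' where "t' j = (if j = 1 then m else t (j - 1))" for j
    have "separated K (Suc M) t'"
      unfolding separated_def
    proof (intro allI impI)
      fix j assume j: "1 \<le> j \<and> j < Suc M"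
      show "t' (Suc j) + K \<le> t' j"
      proof (cases "j = 1")
        case True
        then show ?thesis using is_topD(2)[OF t, of 1] j unfolding t'_def D'_def by auto
      next
        case False
        then obtain i where "j = Suc i" "1 \<le> i" using j by (cases j) auto
        then show ?thesis using is_topD(1)[OF t] j unfolding t'_def separated_def by auto
      qed
    qed
    moreover have "\<forall>j\<in>{1..Suc M}. D (t' j)"
      using is_topD(2)[OF t] m(1) unfolding t'_def D'_def by auto
    moreover have "\<exists>j\<in>{1..Suc M}. i \<le> t' j \<and> t' j < i + K" if "D i" for i
    proof (cases "i + K \<le> m")
      case True
      then have "D' i" using that unfolding D'_def by simp
      from is_topD(3)[OF t this] obtain j where "j \<ge> 1" "j \<le> M" "i \<le> t j" "t j < i + K"
        by blast
      then show ?thesis by (intro bexI[of _ "Suc j"]) (auto simp: t'_def)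
    next
      case False
      then show ?thesis using m(2)[OF that] by (intro bexI[of _ 1]) (auto simp: t'_def)
    qed
    ultimately show ?thesis unfolding is_top_def by blast
  qed
qed

lemma is_bot_exists:
  assumes "finite {i. D i}" "0 < K"
  shows "\<exists>M b. is_bot K D M b"
  using assms(1)
proof (induction "card {i. D i}" arbitrary: D rule: less_induct)
  case less
  show ?case
  proof (cases "{i. D i} = {}")
    case True
    then have "is_bot K D 0 (\<lambda>_. 0)" unfolding is_bot_def separated_def by auto
    then show ?thesis by blast
  next
    case False
    define m where "m = Min {i. D i}"
    have m: "D m" "\<And>i. D i \<Longrightarrow> m \<le> i"
      using Min_in[OF less.prems False] Min_le[OF less.prems] unfolding m_def by auto
    define D' where "D' i \<longleftrightarrow> D i \<and> m + K \<le> i" for i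
    have "m \<notin> {i. D' i}" using assms(2) unfolding D'_def by auto
    moreover have "{i. D' i} \<subseteq> {i. D i}" unfolding D'_def by auto
    ultimately have sub: "{i. D' i} \<subset> {i. D i}" using m(1) by (metis mem_Collect_eq psubsetI)
    obtain M b where b: "is_bot K D' M b"
      using less.hyps[of D'] psubset_card_mono[OF less.prems sub]
        finite_subset[OF psubset_imp_subset[OF sub] less.prems] by auto
    define b' where "b' j = (if j = Suc M then m else b j)" for j
    have "separated K (Suc M) b'"
      unfolding separated_def
    proof (intro allI impI)
      fix j assume j: "1 \<le> j \<and> j < Suc M"
      show "b' (Suc j) + K \<le> b' j"
      proof (cases "j = M")
        case True
        then show ?thesis using is_botD(2)[OF b, of M] j unfolding b'_def D'_def by auto
      next
        case False
        then show ?thesis using is_botD(1)[OF b] j unfolding b'_def separated_def by auto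
      qed
    qed
    moreover have "\<forall>j\<in>{1..Suc M}. D (b' j)"
      using is_botD(2)[OF b] m(1) unfolding b'_def D'_def by auto
    moreover have "\<exists>j\<in>{1..Suc M}. b' j \<le> i \<and> i < b' j + K" if "D i" for i
    proof (cases "m + K \<le> i")
      case True
      then have "D' i" using that unfolding D'_def by simp
      from is_botD(3)[OF b this] obtain j where "j \<ge> 1" "j \<le> M" "b j \<le> i" "i < b j + K"
        by blast
      then show ?thesis by (intro bexI[of _ j]) (auto simp: b'_def)
    next
      case False
      then show ?thesis using m(2)[OF that] by (intro bexI[of _ "Suc M"]) (auto simp: b'_def)
    qed
    ultimately show ?thesis unfolding is_bot_def by blast
  qed
qed

lemma strict_mono_bounded_id:
  fixes \<sigma> :: "nat \<Rightarrow> nat"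
  assumes "\<And>i j. 1 \<le> i \<Longrightarrow> i < j \<Longrightarrow> j \<le> M \<Longrightarrow> \<sigma> i < \<sigma> j"
    and "\<And>i. 1 \<le> i \<Longrightarrow> i \<le> M \<Longrightarrow> 1 \<le> \<sigma> i \<and> \<sigma> i \<le> M"
    and "1 \<le> i" "i \<le> M"
  shows "\<sigma> i = i"
proof (rule antisym)
  show "i \<le> \<sigma> i" using assms(3,4)
  proof (induction i)
    case (Suc i)
    then show ?case using assms(1)[of i "Suc i"] assms(2)[of "Suc i"] by (cases "i = 0") auto
  qed simp
  have "d < M \<Longrightarrow> \<sigma> (M - d) \<le> M - d" for d
  proof (induction d)
    case 0
    then show ?case using assms(2)[of M] by auto
  next
    case (Suc d)
    then show ?case using assms(1)[of "M - Suc d" "M - d"] by simp linarith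
  qed
  from this[of "M - i"] show "\<sigma> i \<le> i" using assms(3,4) by auto
qed

text \<open>Every top start lies in some bottom window, and two top starts, being \<open>K\<close>
  apart, cannot share one; the same holds with the roles exchanged. Both assignments are injective,
  so the counts agree, and a strictly monotone self-map of the index set is the identity.\<close>

lemma top_bot_match:
  assumes t: "is_top K D M t" and b: "is_bot K D M' b" and K: "0 < K"
  shows "M' = M" and "\<And>j. 1 \<le> j \<Longrightarrow> j \<le> M \<Longrightarrow> b j \<le> t j \<and> t j < b j + K"
proof -
  define \<sigma> where "\<sigma> j = (SOME i. 1 \<le> i \<and> i \<le> M' \<and> b i \<le> t j \<and> t j < b i + K)" for j
  have \<sigma>: "1 \<le> \<sigma> j \<and> \<sigma> j \<le> M' \<and> b (\<sigma> j) \<le> t j \<and> t j < b (\<sigma> j) + K" if "1 \<le> j" "j \<le> M" for j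
    unfolding \<sigma>_def
    by (rule someI_ex) (use is_botD(3)[OF b is_topD(2)[OF t that]] in blast)
  define \<tau> where "\<tau> j = (SOME i. 1 \<le> i \<and> i \<le> M \<and> b j \<le> t i \<and> t i < b j + K)" for j
  have \<tau>: "1 \<le> \<tau> j \<and> \<tau> j \<le> M \<and> b j \<le> t (\<tau> j) \<and> t (\<tau> j) < b j + K" if "1 \<le> j" "j \<le> M'" for j
    unfolding \<tau>_def
    by (rule someI_ex) (use is_topD(3)[OF t is_botD(2)[OF b that]] in blast)
  have \<sigma>mono: "\<sigma> i < \<sigma> j" if ij: "1 \<le> i" "i < j" "j \<le> M" for i j
  proof (rule ccontr)
    assume "\<not> \<sigma> i < \<sigma> j"
    then have "b (\<sigma> i) \<le> b (\<sigma> j)"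
      using separated_mono[OF is_botD(1)[OF b], of "\<sigma> j" "\<sigma> i"] \<sigma>[of i] \<sigma>[of j] ij by auto
    moreover have "t j + K \<le> t i" using separatedD[OF is_topD(1)[OF t]] ij by auto
    ultimately show False using \<sigma>[of i] \<sigma>[of j] ij by auto
  qed
  have \<tau>mono: "\<tau> i < \<tau> j" if ij: "1 \<le> i" "i < j" "j \<le> M'" for i j
  proof (rule ccontr)
    assume "\<not> \<tau> i < \<tau> j"
    then have "t (\<tau> i) \<le> t (\<tau> j)"
      using separated_mono[OF is_topD(1)[OF t], of "\<tau> j" "\<tau> i"] \<tau>[of i] \<tau>[of j] ij by auto
    moreover have "b j + K \<le> b i" using separatedD[OF is_botD(1)[OF b]] ij by auto
    ultimately show False using \<tau>[of i] \<tau>[of j] ij by auto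
  qed
  have inj\<sigma>: "inj_on \<sigma> {1..M}"
    by (rule linorder_inj_onI) (use \<sigma>mono in fastforce)+
  have inj\<tau>: "inj_on \<tau> {1..M'}"
    by (rule linorder_inj_onI) (use \<tau>mono in fastforce)+
  have "M \<le> M'" using card_inj_on_le[OF inj\<sigma>, of "{1..M'}"] \<sigma> by fastforce
  moreover have "M' \<le> M" using card_inj_on_le[OF inj\<tau>, of "{1..M}"] \<tau> by fastforce
  ultimately show MM: "M' = M" by simp
  show "b j \<le> t j \<and> t j < b j + K" if j: "1 \<le> j" "j \<le> M" for j
  proof -
    have "\<sigma> j = j" by (rule strict_mono_bounded_id[of M]) (use \<sigma>mono \<sigma> j MM in auto)
    then show ?thesis using \<sigma>[OF j] by simp
  qed
qed

text \<open>The window at \<open>t j\<close> must be blocked by some \<open>t' i\<close>, and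
  agreement on the earlier indices excludes \<open>i < j\<close>. By symmetry this yields uniqueness
  of the greedy choice, index by index.\<close>

lemma is_top_le:
  assumes t: "is_top K D M t" and t': "is_top K D M t'" and K: "0 < K"
    and j: "1 \<le> j" "j \<le> M" and above: "\<And>i. 1 \<le> i \<Longrightarrow> i < j \<Longrightarrow> t' i = t i"
  shows "t j \<le> t' j"
proof -
  obtain i where i: "1 \<le> i" "i \<le> M" "t j \<le> t' i" "t' i < t j + K"
    using is_topD(3)[OF t' is_topD(2)[OF t j]] by blast
  have "\<not> i < j"
  proof
    assume "i < j"
    then have "t j + K \<le> t' i" using separatedD[OF is_topD(1)[OF t], of i j] i j above by auto
    then show False using i by simp
  qed
  then have "t' i \<le> t' j" using separated_mono[OF is_topD(1)[OF t'], of j i] i j by auto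
  then show ?thesis using i by simp
qed

lemma is_top_unique:
  assumes t: "is_top K D M t" and t': "is_top K D M t'" and K: "0 < K"
    and j: "1 \<le> j" "j \<le> M"
  shows "t' j = t j"
  using j
proof (induction j rule: less_induct)
  case (less j)
  then have "\<And>i. 1 \<le> i \<Longrightarrow> i < j \<Longrightarrow> t' i = t i" by auto
  then show ?case using is_top_le[OF t t' K] is_top_le[OF t' t K] less.prems by (metis antisym)
qed

lemma is_bot_le:
  assumes b: "is_bot K D M b" and b': "is_bot K D M b'" and K: "0 < K"
    and j: "1 \<le> j" "j \<le> M" and below: "\<And>i. j < i \<Longrightarrow> i \<le> M \<Longrightarrow> b' i = b i"
  shows "b' j \<le> b j"
proof -
  obtain i where i: "1 \<le> i" "i \<le> M" "b' i \<le> b j" "b j < b' i + K"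
    using is_botD(3)[OF b' is_botD(2)[OF b j]] by blast
  have "\<not> j < i"
  proof
    assume "j < i"
    then have "b' i + K \<le> b j" using separatedD[OF is_botD(1)[OF b], of j i] i j below by auto
    then show False using i by simp
  qed
  then have "b' j \<le> b' i" using separated_mono[OF is_botD(1)[OF b'], of i j] i j by auto
  then show ?thesis using i by simp
qed

lemma is_bot_unique:
  assumes b: "is_bot K D M b" and b': "is_bot K D M b'" and K: "0 < K"
    and j: "1 \<le> j" "j \<le> M"
  shows "b' j = b j"
  using j
proof (induction "M - j" arbitrary: j rule: less_induct)
  case less
  then have "\<And>i. j < i \<Longrightarrow> i \<le> M \<Longrightarrow> b' i = b i" by auto
  then show ?case using is_bot_le[OF b b' K] is_bot_le[OF b' b K] less.prems by (metis antisym)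
qed

section \<open>Bands and rotations\<close>

locale band_system =
  fixes K :: nat and P :: int
  assumes K_pos: "0 < K" and P_pos: "0 < P"
begin

text \<open>
  If \<open>z = x + P\<close> then \<open>P\<close> divides \<open>x\<close> iff it divides \<open>z\<close>, so the strictness condition may be
  read off either argument.
\<close>

definition far :: "int \<Rightarrow> int \<Rightarrow> bool" where
  "far x z \<longleftrightarrow> (if P dvd x then x + P < z else x + P \<le> z)"

definition spread :: "(nat \<Rightarrow> int) \<Rightarrow> nat \<Rightarrow> bool" where
  "spread y L \<longleftrightarrow>
     (\<forall>i. Suc i < L \<longrightarrow> y i \<le> y (Suc i) \<and> (\<not> P dvd y i \<longrightarrow> y i < y (Suc i))) \<and>
     (\<forall>i. i + K < L \<longrightarrow> far (y i) (y (i + K)))"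

definition band :: "(nat \<Rightarrow> int) \<Rightarrow> nat \<Rightarrow> nat \<Rightarrow> bool" where
  "band y L i \<longleftrightarrow> i + K \<le> L \<and> \<not> far (y i) (y (i + K - 1))"

text \<open>A cyclic shift of each window \<open>{s..<s + K}\<close> with \<open>s\<close> in
  \<open>S\<close>: the entries move down by one index, and the last place receives the old first
  entry raised by \<open>P\<close>. The result is sorted again because a band spans at most
  \<open>P\<close>.\<close>

definition rot_up :: "nat set \<Rightarrow> (nat \<Rightarrow> int) \<Rightarrow> nat \<Rightarrow> int" where
  "rot_up S y i =
     (if K \<le> Suc i \<and> Suc i - K \<in> S then y (Suc i - K) + P
      else if \<exists>s\<in>S. s \<le> i \<and> Suc i < s + K then y (Suc i) else y i)"

definition rot_down :: "nat set \<Rightarrow> (nat \<Rightarrow> int) \<Rightarrow> nat \<Rightarrow> int" where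
  "rot_down S y i =
     (if i \<in> S then y (i + K - 1) - P
      else if \<exists>s\<in>S. s < i \<and> i < s + K then y (i - 1) else y i)"

definition apart :: "nat set \<Rightarrow> bool" where
  "apart S \<longleftrightarrow> (\<forall>s\<in>S. \<forall>s'\<in>S. s < s' \<longrightarrow> s + K \<le> s')"

lemma apart_eq: "apart S \<Longrightarrow> s \<in> S \<Longrightarrow> s' \<in> S \<Longrightarrow> s \<le> i \<Longrightarrow> i < s + K \<Longrightarrow> s' \<le> i \<Longrightarrow> i < s' + K \<Longrightarrow> s = s'"
  unfolding apart_def by (meson le_trans linorder_neqE_nat not_le)

lemma apartD: "apart S \<Longrightarrow> s \<in> S \<Longrightarrow> s' \<in> S \<Longrightarrow> s < s' \<Longrightarrow> s + K \<le> s'"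
  unfolding apart_def by blast

lemma far_mono: "far x z \<Longrightarrow> z \<le> w \<Longrightarrow> far x w"
  unfolding far_def by (auto split: if_splits)

lemma far_mono_left: "far x z \<Longrightarrow> x' \<le> x \<Longrightarrow> far x' z"
  unfolding far_def by (auto split: if_splits) (smt (verit))+

text \<open>Both steps can be equalities only if \<open>x\<close> is not a multiple of
  \<open>P\<close>, and then \<open>far\<close> admits equality.\<close>

lemma far_trans: "far x z \<Longrightarrow> far z w \<Longrightarrow> far (x + P) w"
  unfolding far_def by (auto split: if_splits)

lemma far_shift [simp]: "far (x + P) (z + P) \<longleftrightarrow> far x z"
  unfolding far_def by auto

lemma far_shift_diff2: "far x (z - P) \<longleftrightarrow> far (x + P) z"
  using far_shift[of x "z - P"] by simp

lemma not_far_dvd: "\<not> far x z \<Longrightarrow> z \<le> x + P"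
  unfolding far_def by (auto split: if_splits)

lemma not_far_strict: "\<not> far x z \<Longrightarrow> \<not> P dvd z \<Longrightarrow> z < x + P"
  unfolding far_def by (cases "z = x + P") (auto split: if_splits)

lemma farI: "x + P < z \<Longrightarrow> far x z"
  unfolding far_def by auto

lemma far_le: "far x z \<Longrightarrow> x + P \<le> z"
  unfolding far_def by (auto split: if_splits)

lemma not_far_refl: "\<not> far x x"
  using P_pos unfolding far_def by auto

context
  fixes y :: "nat \<Rightarrow> int" and L :: nat
  assumes sp: "spread y L"
begin

lemma spread_far: "i + K < L \<Longrightarrow> far (y i) (y (i + K))"
  using sp unfolding spread_def by blast

lemma spread_mono: "i \<le> j \<Longrightarrow> j < L \<Longrightarrow> y i \<le> y j"
proof (induction j)
  case (Suc j)
  then show ?case using sp unfolding spread_def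
    by (metis Suc_lessD le_Suc_eq order_refl order_trans)
qed simp

lemma spread_strict: "i < j \<Longrightarrow> j < L \<Longrightarrow> \<not> P dvd y i \<Longrightarrow> y i < y j"
  using sp spread_mono[of "Suc i" j] unfolding spread_def
  by (metis Suc_leI le_less_trans less_le_trans)

lemma spread_strict': "i < j \<Longrightarrow> j < L \<Longrightarrow> \<not> P dvd y j \<Longrightarrow> y i < y j"
  using spread_strict spread_mono by (metis less_or_eq_imp_le order_le_less)

lemma finite_band: "finite {i. band y L i}"
  by (rule finite_subset[of _ "{..L}"]) (auto simp: band_def)

lemma band_next_lt: "band y L i \<Longrightarrow> i + K < L \<Longrightarrow> y (i + K - 1) < y (i + K)"
  using spread_far[of i] far_mono unfolding band_def by (metis not_le)

lemma band_prev_lt: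
  assumes "band y L (Suc i)" shows "y i < y (Suc i)"
proof -
  have "far (y i) (y (i + K))" using spread_far[of i] assms K_pos unfolding band_def by auto
  then show ?thesis using far_mono_left assms unfolding band_def by (metis add_Suc diff_Suc_1 not_le)
qed

end

section \<open>Rotations entry by entry, and the upward rotation of clusters\<close>

lemma rot_up_last: "s \<in> S \<Longrightarrow> rot_up S y (s + K - 1) = y s + P"
  using K_pos unfolding rot_up_def by auto

lemma rot_up_inner:
  assumes "apart S" "s \<in> S" "s \<le> i" "Suc i < s + K"
  shows "rot_up S y i = y (Suc i)"
proof -
  have "\<not> (K \<le> Suc i \<and> Suc i - K \<in> S)"
    using apart_eq[OF assms(1,2), of "Suc i - K" i] assms K_pos by force
  then show ?thesis using assms unfolding rot_up_def by auto
qed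

lemma rot_up_outside:
  assumes "\<And>s. s \<in> S \<Longrightarrow> s \<le> i \<Longrightarrow> i < s + K \<Longrightarrow> False"
  shows "rot_up S y i = y i"
  using assms assms[of "Suc i - K"] K_pos unfolding rot_up_def by fastforce

lemma rot_up_cases [case_names outside inner last]:
  obtains "\<And>s. s \<in> S \<Longrightarrow> s \<le> i \<Longrightarrow> i < s + K \<Longrightarrow> False"
  | s where "s \<in> S" "s \<le> i" "Suc i < s + K"
  | s where "s \<in> S" "i = s + K - 1"
proof (cases "\<exists>s\<in>S. s \<le> i \<and> i < s + K")
  case True
  then obtain s where s: "s \<in> S" "s \<le> i" "i < s + K" by blast
  then show ?thesis using that(2)[of s] that(3)[of s] by (cases "Suc i < s + K") auto
next
  case False
  then show ?thesis using that(1) by blast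
qed

lemma rot_down_first: "s \<in> S \<Longrightarrow> rot_down S y s = y (s + K - 1) - P"
  unfolding rot_down_def by auto

lemma rot_down_inner:
  assumes "apart S" "s \<in> S" "s < i" "i < s + K"
  shows "rot_down S y i = y (i - 1)"
  using apart_eq[OF assms(1,2), of i i] assms K_pos unfolding rot_down_def by auto

lemma rot_down_outside:
  assumes "\<And>s. s \<in> S \<Longrightarrow> s \<le> i \<Longrightarrow> i < s + K \<Longrightarrow> False"
  shows "rot_down S y i = y i"
  using assms assms[of i] K_pos unfolding rot_down_def by fastforce

lemma rot_down_cases [case_names outside inner first]:
  obtains "\<And>s. s \<in> S \<Longrightarrow> s \<le> i \<Longrightarrow> i < s + K \<Longrightarrow> False"
  | s where "s \<in> S" "s < i" "i < s + K"
  | "i \<in> S"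
proof (cases "\<exists>s\<in>S. s \<le> i \<and> i < s + K")
  case True
  then obtain s where s: "s \<in> S" "s \<le> i" "i < s + K" by blast
  then show ?thesis using that(2)[of s] that(3) by (cases "s = i") auto
next
  case False
  then show ?thesis using that(1) by blast
qed

lemma rot_down_up:
  assumes "apart S" shows "rot_down S (rot_up S y) = y"
proof
  fix i
  show "rot_down S (rot_up S y) i = y i"
  proof (cases S i rule: rot_down_cases)
    case outside
    have "rot_down S (rot_up S y) i = rot_up S y i" using outside by (rule rot_down_outside)
    also have "\<dots> = y i" using outside by (rule rot_up_outside)
    finally show ?thesis .
  next
    case (inner s)
    then show ?thesis using rot_down_inner[OF assms inner] rot_up_inner[OF assms inner(1), of "i - 1"] by auto
  next
    case first
    then show ?thesis using rot_down_first[OF first] rot_up_last[OF first] by auto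
  qed
qed

lemma rot_up_down:
  assumes "apart S" shows "rot_up S (rot_down S y) = y"
proof
  fix i
  show "rot_up S (rot_down S y) i = y i"
  proof (cases S i rule: rot_up_cases)
    case outside
    have "rot_up S (rot_down S y) i = rot_down S y i" using outside by (rule rot_up_outside)
    also have "\<dots> = y i" using outside by (rule rot_down_outside)
    finally show ?thesis .
  next
    case (inner s)
    then show ?thesis using rot_up_inner[OF assms inner] rot_down_inner[OF assms inner(1), of "Suc i"] by auto
  next
    case (last s)
    then show ?thesis using rot_down_first[of s S] rot_up_last[of s S] by auto
  qed
qed

lemma rot_up_empty [simp]: "rot_up {} y = y"
  unfolding rot_up_def by auto

lemma rot_down_empty [simp]: "rot_down {} y = y"
  unfolding rot_down_def by auto

text \<open>
  The last assumption holds when \<open>S\<close> consists of the topmost clusters. It is what keeps a rotated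
  element away from its upper neighbours.
\<close>

lemma spread_rot_up:
  assumes sp: "spread y L" and S: "apart S" "\<And>s. s \<in> S \<Longrightarrow> band y L s"
    and cl: "\<And>i s. s \<in> S \<Longrightarrow> band y L i \<Longrightarrow> s \<le> i \<Longrightarrow> \<exists>s'\<in>S. i \<le> s' \<and> s' < i + K"
  shows "spread (rot_up S y) L"
proof -
  let ?y = "rot_up S y"
  have bL: "s + K \<le> L" if "s \<in> S" for s using S(2)[OF that] unfolding band_def by simp
  \<comment> \<open>Contrapositive of the closure assumption: a window at or above some
    \<open>s\<close> in \<open>S\<close> that is not blocked by \<open>S\<close> is no band.\<close>
  have nb: "far (y i) (y (i + K - 1))"
    if "s \<in> S" "s \<le> i" "i + K \<le> L" "\<And>s'. s' \<in> S \<Longrightarrow> i \<le> s' \<Longrightarrow> s' < i + K \<Longrightarrow> False" for i s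
    using cl[OF that(1) _ that(2)] that(3,4) unfolding band_def by blast
  have step: "?y i \<le> ?y (Suc i) \<and> (\<not> P dvd ?y i \<longrightarrow> ?y i < ?y (Suc i))" if i: "Suc i < L" for i
  proof (cases S i rule: rot_up_cases)
    case outside
    have yi: "?y i = y i" using outside by (rule rot_up_outside)
    have le: "y i \<le> y (Suc i)" "\<not> P dvd y i \<Longrightarrow> y i < y (Suc i)"
      using spread_mono[OF sp, of i "Suc i"] spread_strict[OF sp, of i "Suc i"] i by auto
    show ?thesis
    proof (cases S "Suc i" rule: rot_up_cases)
      case outside
      then have "?y (Suc i) = y (Suc i)" by (rule rot_up_outside)
      then show ?thesis using yi le by simp
    next
      case (inner s)
      then have "?y (Suc i) = y (Suc (Suc i))" using rot_up_inner[OF S(1)] by auto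
      moreover have "y (Suc i) \<le> y (Suc (Suc i))"
        using spread_mono[OF sp, of "Suc i" "Suc (Suc i)"] bL[OF inner(1)] inner by auto
      ultimately show ?thesis using yi le by auto
    next
      case (last s)
      have "i < s + K" using last(2) by linarith
      then have "i < s" using outside[OF last(1)] by (meson not_le)
      then have "s = Suc i" using last(2) K_pos by linarith
      then have "?y (Suc i) = y (Suc i) + P" using rot_up_last[OF last(1), of y] last K_pos by auto
      then show ?thesis using yi le P_pos by auto
    qed
  next
    case (inner s)
    have yi: "?y i = y (Suc i)" using rot_up_inner[OF S(1) inner] .
    show ?thesis
    proof (cases "Suc (Suc i) < s + K")
      case True
      then have "?y (Suc i) = y (Suc (Suc i))" using rot_up_inner[OF S(1) inner(1)] inner by auto
      then show ?thesis
        using yi spread_mono[OF sp, of "Suc i" "Suc (Suc i)"] spread_strict[OF sp, of "Suc i" "Suc (Suc i)"]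
          bL[OF inner(1)] True by auto
    next
      case False
      then have e: "Suc i = s + K - 1" using inner by auto
      then have "?y (Suc i) = y s + P" using rot_up_last[OF inner(1)] by simp
      moreover have "\<not> far (y s) (y (Suc i))" using S(2)[OF inner(1)] e unfolding band_def by simp
      ultimately show ?thesis using yi not_far_dvd not_far_strict by metis
    qed
  next
    case (last s)
    have yi: "?y i = y s + P" using rot_up_last[OF last(1)] last(2) by simp
    have si: "Suc i = s + K" using last(2) K_pos by simp
    have f: "far (y s) (y (s + K))" using spread_far[OF sp, of s] i si by simp
    show ?thesis
    proof (cases S "Suc i" rule: rot_up_cases)
      case outside
      then have y1: "?y (Suc i) = y (s + K)" using si rot_up_outside by metis
      have "y s + P < y (s + K)" if nd: "\<not> P dvd y s"
      proof -
        \<comment> \<open>The strict inequality for a non-multiple \<open>y s\<close> comes from the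
          window one place higher: it is no band, and its first entry already exceeds
          \<open>y s\<close>.\<close>
        have "far (y (Suc s)) (y (Suc s + K - 1))"
        proof (rule nb[OF last(1)])
          show "Suc s + K \<le> L" using i si by simp
          fix s' assume s': "s' \<in> S" "Suc s \<le> s'" "s' < Suc s + K"
          then have "s' = s + K" using apartD[OF S(1) last(1), of s'] by auto
          then show False using outside[OF s'(1)] si K_pos by auto
        qed simp
        moreover have "y s < y (Suc s)" using spread_strict[OF sp, of s "Suc s"] nd i si K_pos by auto
        ultimately show ?thesis using far_le[of "y (Suc s)" "y (s + K)"] by auto
      qed
      then show ?thesis using yi y1 far_le[OF f] by auto
    next
      case (inner s')
      then have "s' \<le> s + K" "s < s'" using si by auto
      then have "s' = s + K" using apartD[OF S(1) last(1) inner(1)] by simp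
      then have y1: "?y (Suc i) = y (Suc (s + K))" using rot_up_inner[OF S(1) inner] si by simp
      have "y (s + K) \<le> y (Suc (s + K))" "\<not> P dvd y (s + K) \<Longrightarrow> y (s + K) < y (Suc (s + K))"
        using spread_mono[OF sp, of "s + K" "Suc (s + K)"] spread_strict[OF sp, of "s + K" "Suc (s + K)"]
          bL[OF inner(1)] inner si by auto
      then show ?thesis using yi y1 far_le[OF f] by (cases "y s + P = y (s + K)") auto
    next
      case (last s')
      then have y1: "?y (Suc i) = y s' + P" using rot_up_last[OF last(1)] by simp
      have "s < s'" "s' < L" using last si bL[OF last(1)] K_pos by auto
      then have "y s \<le> y s'" "\<not> P dvd y s \<Longrightarrow> y s < y s'"
        using spread_mono[OF sp, of s s'] spread_strict[OF sp, of s s'] by auto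
      then show ?thesis using yi y1 by auto
    qed
  qed
  have farst: "far (?y i) (?y (i + K))" if i: "i + K < L" for i
  proof (cases S i rule: rot_up_cases)
    case outside
    have yi: "?y i = y i" using outside by (rule rot_up_outside)
    have f: "far (y i) (y (i + K))" using spread_far[OF sp i] .
    show ?thesis
    proof (cases S "i + K" rule: rot_up_cases)
      case o2: outside
      then have "?y (i + K) = y (i + K)" by (rule rot_up_outside)
      then show ?thesis using yi f by simp
    next
      case (inner s)
      then have "?y (i + K) = y (Suc (i + K))" using rot_up_inner[OF S(1)] by auto
      moreover have "y (i + K) \<le> y (Suc (i + K))"
        using spread_mono[OF sp, of "i + K" "Suc (i + K)"] bL[OF inner(1)] inner by auto
      ultimately show ?thesis using yi f far_mono by metis
    next
      case (last s)
      then have s: "s = Suc i" using K_pos by linarith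
      have "?y (i + K) = y s + P" using rot_up_last[OF last(1), of y] last(2) by simp
      moreover have "y i < y s" using band_prev_lt[OF sp] S(2)[OF last(1)] s by simp
      ultimately show ?thesis using yi farI by auto
    qed
  next
    case (inner s)
    have yi: "?y i = y (Suc i)" using rot_up_inner[OF S(1) inner] .
    show ?thesis
    proof (cases S "i + K" rule: rot_up_cases)
      case outside
      then have y1: "?y (i + K) = y (i + K)" by (rule rot_up_outside)
      have "far (y (Suc i)) (y (Suc i + K - 1))"
      proof (rule nb[OF inner(1)])
        show "Suc i + K \<le> L" using i by simp
        show "s \<le> Suc i" using inner by simp
        fix s' assume s': "s' \<in> S" "Suc i \<le> s'" "s' < Suc i + K"
        have "s + K \<le> s'" using apartD[OF S(1) inner(1) s'(1)] s' inner by auto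
        then show False using outside[OF s'(1)] s' inner by auto
      qed
      then show ?thesis using yi y1 by simp
    next
      case i2: (inner s')
      then have "?y (i + K) = y (Suc i + K)" using rot_up_inner[OF S(1) i2] by simp
      then show ?thesis using yi spread_far[OF sp, of "Suc i"] bL[OF i2(1)] i2 by auto
    next
      case (last s')
      then have "s' = Suc i" using K_pos by linarith
      then show ?thesis using apartD[OF S(1) inner(1) last(1)] inner by auto
    qed
  next
    case (last s)
    have yi: "?y i = y s + P" using rot_up_last[OF last(1)] last(2) by simp
    have si: "Suc i = s + K" using last(2) K_pos by simp
    have sK: "s + K < L" using si i K_pos by simp
    have f: "far (y s) (y (s + K))" using spread_far[OF sp sK] .
    show ?thesis
    proof (cases S "i + K" rule: rot_up_cases)
      case outside
      then have y1: "?y (i + K) = y (s + K + K - 1)" using si rot_up_outside[of S "i + K" y] K_pos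
        by (metis add.commute add_diff_cancel_left' add_Suc plus_1_eq_Suc)
      have "far (y (s + K)) (y (s + K + K - 1))"
      proof (rule nb[OF last(1)])
        show "s + K + K \<le> L" using i si by simp
        fix s' assume s': "s' \<in> S" "s + K \<le> s'" "s' < s + K + K"
        then show False using outside[OF s'(1)] si by auto
      qed simp
      then show ?thesis using yi y1 far_trans[OF f] by simp
    next
      case (inner s')
      have s': "Suc (i + K) = s + K + K" using si by simp
      have "?y (i + K) = y (s + K + K)" using rot_up_inner[OF S(1) inner] s' by simp
      then show ?thesis using yi far_trans[OF f, of "y (s + K + K)"] spread_far[OF sp, of "s + K"]
          bL[OF inner(1)] inner s' by auto
    next
      case l2: (last s')
      then have "s' = s + K" using si K_pos by linarith
      then show ?thesis using rot_up_last[OF l2(1), of y] l2 yi f by simp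
    qed
  qed
  show ?thesis unfolding spread_def using step farst by blast
qed

lemma apart_image:
  assumes "separated K M t" "p \<le> M" shows "apart (t ` {1..p})"
  unfolding apart_def
proof (intro ballI impI)
  fix s s' assume "s \<in> t ` {1..p}" "s' \<in> t ` {1..p}" "s < s'"
  then obtain i j where ij: "i \<in> {1..p}" "j \<in> {1..p}" "s = t i" "s' = t j" by auto
  have "\<not> i \<le> j" using separated_mono[OF assms(1), of i j] ij assms(2) \<open>s < s'\<close> by auto
  then show "s + K \<le> s'" using separatedD[OF assms(1), of j i] ij assms(2) by auto
qed

text \<open>The band is blocked by some cluster from above. That cluster does not lie below
  \<open>s\<close>, so its index is at most \<open>p\<close> and it is among those rotated.\<close>

lemma top_closed:
  assumes t: "is_top K D M t" and "s \<in> t ` {1..p}" "p \<le> M" "D i" "s \<le> i"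
  shows "\<exists>s'\<in>t ` {1..p}. i \<le> s' \<and> s' < i + K"
proof -
  obtain j where j: "j \<ge> 1" "j \<le> M" "i \<le> t j" "t j < i + K" using is_topD(3)[OF t assms(4)] by blast
  obtain j0 where j0: "s = t j0" "1 \<le> j0" "j0 \<le> p" using assms(2) by auto
  show ?thesis
  proof (cases "j \<le> p")
    case True then show ?thesis using j by auto
  next
    case False
    then have "t j + K \<le> t j0" using separatedD[OF is_topD(1)[OF t], of j0 j] j j0 by auto
    then show ?thesis using j j0 assms(5) K_pos by linarith
  qed
qed

text \<open>
  The clusters rotated upwards, chosen greedily from the top, are afterwards the clusters found
  greedily from the bottom; this makes the rotation invertible.
\<close>

lemma is_bot_rot_up:
  assumes sp: "spread y L" and t: "is_top K (band y L) M t" and b: "is_bot K (band y L) M b"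
    and p: "p \<le> M"
  shows "is_bot K (band (rot_up (t ` {1..p}) y) L) M (\<lambda>j. if j \<le> p then t j else b j)"
proof (cases "p = 0")
  case True
  then show ?thesis using b unfolding is_bot_def separated_def by auto
next
  case p0: False
  define S where "S = t ` {1..p}"
  let ?y = "rot_up S y"
  have S: "apart S" unfolding S_def using apart_image[OF is_topD(1)[OF t] p] .
  have tS: "t j \<in> S" if "1 \<le> j" "j \<le> p" for j using that unfolding S_def by auto
  have tmin: "t p \<le> s" if "s \<in> S" for s
    using that separated_mono[OF is_topD(1)[OF t]] p unfolding S_def by auto
  have match: "b j \<le> t j" "t j < b j + K" if "1 \<le> j" "j \<le> M" for j
    using top_bot_match(2)[OF t b K_pos] that by auto
  have out: "?y i = y i" if "i < t p" for i
    by (rule rot_up_outside) (use tmin that in force)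
  have bandt: "band y L (t j)" if "1 \<le> j" "j \<le> M" for j using is_topD(2)[OF t that] .
  have f: "i + K < L \<Longrightarrow> far (y i) (y (i + K))" for i using spread_far[OF sp] .
  have "separated K M (\<lambda>j. if j \<le> p then t j else b j)"
    unfolding separated_def
  proof (intro allI impI)
    fix j assume j: "1 \<le> j \<and> j < M"
    have "t (Suc j) + K \<le> t j" "b (Suc j) + K \<le> b j"
      using is_topD(1)[OF t] is_botD(1)[OF b] j unfolding separated_def by auto
    then show "(if Suc j \<le> p then t (Suc j) else b (Suc j)) + K \<le> (if j \<le> p then t j else b j)"
      using match[of "Suc j"] j by auto
  qed
  moreover have "band ?y L (if j \<le> p then t j else b j)" if j: "j \<in> {1..M}" for j
  proof (cases "j \<le> p")
    case True
    have B: "band y L (t j)" using bandt j by auto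
    have l: "?y (t j + K - 1) = y (t j) + P" using rot_up_last[OF tS] True j by simp
    have "\<not> far (?y (t j)) (y (t j) + P)"
    proof (cases "K = 1")
      case True
      then show ?thesis using l not_far_refl by simp
    next
      case False
      then have "Suc 0 < K" using K_pos by simp
      then have "?y (t j) = y (Suc (t j))" using rot_up_inner[OF S tS[of j], of "t j"] True j by simp
      moreover have "y (t j) \<le> y (Suc (t j))" "\<not> P dvd y (Suc (t j)) \<Longrightarrow> y (t j) < y (Suc (t j))"
        using spread_mono[OF sp, of "t j" "Suc (t j)"] spread_strict'[OF sp, of "t j" "Suc (t j)"]
          B False K_pos unfolding band_def by auto
      ultimately show ?thesis unfolding far_def by auto
    qed
    then show ?thesis using True B l unfolding band_def by simp
  next
    case False
    have B: "band y L (b j)" using is_botD(2)[OF b] j by auto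
    have "b j \<le> t j" using match j by auto
    moreover have "t j + K \<le> t p" using separatedD[OF is_topD(1)[OF t], of p j] False p0 j by auto
    ultimately have "?y (b j) = y (b j)" "?y (b j + K - 1) = y (b j + K - 1)"
      using out[of "b j"] out[of "b j + K - 1"] K_pos by auto
    then show ?thesis using B False unfolding band_def by simp
  qed
  moreover have "\<exists>j\<in>{1..M}. (if j \<le> p then t j else b j) \<le> i \<and> i < (if j \<le> p then t j else b j) + K"
    if Bi: "band ?y L i" for i
  proof (cases "t p \<le> i")
    case True
    \<comment> \<open>The highest rotated cluster starting at or below \<open>i\<close>. If its
      window ended before \<open>i\<close>, the entry at \<open>i\<close> would be unchanged, and
      every possible origin of the entry at \<open>i + K - 1\<close> leads to a
      contradiction.\<close>
    define j where "j = (LEAST j. 1 \<le> j \<and> t j \<le> i)"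
    have j: "1 \<le> j" "t j \<le> i" and jp: "j \<le> p"
      using LeastI[of "\<lambda>j. 1 \<le> j \<and> t j \<le> i" p] Least_le[of "\<lambda>j. 1 \<le> j \<and> t j \<le> i" p] True p0
      unfolding j_def by auto
    have jmin: "i < t j'" if "1 \<le> j'" "j' < j" for j'
      using not_less_Least[of j' "\<lambda>j. 1 \<le> j \<and> t j \<le> i"] that unfolding j_def by auto
    have "i < t j + K"
    proof (rule ccontr)
      assume n: "\<not> i < t j + K"
      have tj: "t j' \<le> t j" if "j \<le> j'" "j' \<le> M" for j'
        using separated_mono[OF is_topD(1)[OF t] j(1) that] .
      have yi: "?y i = y i"
      proof (rule rot_up_outside)
        fix s assume s: "s \<in> S" "s \<le> i" "i < s + K"
        then obtain j' where j': "s = t j'" "1 \<le> j'" "j' \<le> p" unfolding S_def by auto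
        show False using jmin[of j'] tj[of j'] s j' n p by (cases "j' < j") auto
      qed
      show False
      proof (cases S "i + K - 1" rule: rot_up_cases)
        case outside
        then have "?y (i + K - 1) = y (i + K - 1)" by (rule rot_up_outside)
        then have "band y L i" using Bi yi unfolding band_def by simp
        then obtain j' where j': "1 \<le> j'" "j' \<le> M" "i \<le> t j'" "t j' < i + K"
          using is_topD(3)[OF t] by blast
        have "j' < j" using tj[of j'] j' n K_pos by (metis add_lessD1 leI le_less_trans linorder_not_less less_add_same_cancel1)
        moreover have "t j' \<le> i + K - 1" "i + K - 1 < t j' + K" using j' K_pos by linarith+
        ultimately show False using outside[OF tS[of j']] j' jp by simp
      next
        case (inner s)
        then have "?y (i + K - 1) = y (i + K)" using rot_up_inner[OF S inner] K_pos by auto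
        moreover have "i + K < L" using inner(3) bandt inner(1) p unfolding S_def band_def by fastforce
        ultimately show False using Bi yi f[of i] unfolding band_def by simp
      next
        case (last s)
        then have "i = s" using K_pos by linarith
        then obtain j' where j': "i = t j'" "1 \<le> j'" "j' \<le> p" using last(1) unfolding S_def by auto
        then show False using jmin[of j'] tj[of j'] n p K_pos by (cases "j' < j") auto
      qed
    qed
    then show ?thesis using j jp p by (intro bexI[of _ j]) auto
  next
    case False
    then have yi: "?y i = y i" using out by simp
    have "i + K \<le> t p"
    proof (rule ccontr)
      assume n: "\<not> i + K \<le> t p"
      have "?y (i + K - 1) = y (i + K)"
        using rot_up_inner[OF S tS[of p], of "i + K - 1"] n p0 False K_pos by auto
      moreover have "i + K < L" using bandt[of p] p p0 False unfolding band_def by auto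
      ultimately show False using Bi yi f[of i] unfolding band_def by simp
    qed
    then have "?y (i + K - 1) = y (i + K - 1)" using out K_pos by simp
    then have B: "band y L i" using Bi yi unfolding band_def by simp
    obtain j where j: "1 \<le> j" "j \<le> M" "b j \<le> i" "i < b j + K" using is_botD(3)[OF b B] by blast
    obtain j' where j': "1 \<le> j'" "j' \<le> M" "i \<le> t j'" "t j' < i + K" using is_topD(3)[OF t B] by blast
    \<comment> \<open>The band at \<open>i\<close> is an old one below all rotated clusters. The
      matching of top and bottom clusters carries the bound on the index \<open>j'\<close> over to
      \<open>j\<close>.\<close>
    have "p < j'" using separated_mono[OF is_topD(1)[OF t] j'(1), of p] j' \<open>i + K \<le> t p\<close> p
      by (meson le_trans linorder_not_le not_less)
    moreover have "\<not> j < j'"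
    proof
      assume "j < j'"
      then have "b j' + K \<le> b j" using separatedD[OF is_botD(1)[OF b], of j j'] j j' by auto
      then show False using match[of j'] j j' by auto
    qed
    ultimately have "p < j" by simp
    then show ?thesis using j by (intro bexI[of _ j]) auto
  qed
  ultimately show ?thesis unfolding is_bot_def S_def[symmetric] by blast
qed

section \<open>The downward rotation of clusters\<close>

lemma dvd_diff_P [simp]: "P dvd x - P \<longleftrightarrow> P dvd x"
  using dvd_add_triv_right_iff[of P "x - P"] by simp

text \<open>Two obstructions come from below. \<open>u1\<close>: a band reaching into a rotated
  window must be covered by another rotated one. \<open>u2\<close>: the lowered entry
  \<open>y (i + 2 * K - 1) - P\<close> lands exactly \<open>K\<close> places above
  \<open>y i\<close>, so if \<open>i\<close> itself is not rotated these two have to be far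
  apart.\<close>

lemma spread_rot_down:
  assumes sp: "spread y L" and S: "apart S" "\<And>s. s \<in> S \<Longrightarrow> band y L s"
    and u1: "\<And>i s. s \<in> S \<Longrightarrow> band y L i \<Longrightarrow> s < i + K \<Longrightarrow> i < s \<Longrightarrow> \<exists>s'\<in>S. s' \<le> i \<and> i < s' + K"
    and u2: "\<And>i. i + K \<in> S \<Longrightarrow> (\<And>s'. s' \<in> S \<Longrightarrow> s' \<le> i \<Longrightarrow> i < s' + K \<Longrightarrow> False) \<Longrightarrow>
       far (y i) (y (i + 2 * K - 1) - P)"
  shows "spread (rot_down S y) L"
proof -
  let ?y = "rot_down S y"
  have bL: "s + K \<le> L" if "s \<in> S" for s using S(2)[OF that] unfolding band_def by simp
  have nf: "\<not> far (y s) (y (s + K - 1))" if "s \<in> S" for s using S(2)[OF that] unfolding band_def by simp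
  have nb: "far (y i) (y (i + K - 1))"
    if "s \<in> S" "s < i + K" "i < s" "i + K \<le> L" "\<And>s'. s' \<in> S \<Longrightarrow> s' \<le> i \<Longrightarrow> i < s' + K \<Longrightarrow> False" for i s
    using u1[OF that(1) _ that(2,3)] that(4,5) unfolding band_def by blast
  have step: "?y i \<le> ?y (Suc i) \<and> (\<not> P dvd ?y i \<longrightarrow> ?y i < ?y (Suc i))" if i: "Suc i < L" for i
  proof -
    have le: "y i \<le> y (Suc i)" "\<not> P dvd y i \<Longrightarrow> y i < y (Suc i)"
      using spread_mono[OF sp, of i "Suc i"] spread_strict[OF sp, of i "Suc i"] i by auto
    show ?thesis
    proof (cases S i rule: rot_down_cases)
      case outside
      have yi: "?y i = y i" using outside by (rule rot_down_outside)
      show ?thesis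
      proof (cases S "Suc i" rule: rot_down_cases)
        case outside
        then have "?y (Suc i) = y (Suc i)" by (rule rot_down_outside)
        then show ?thesis using yi le by simp
      next
        case (inner s)
        then show ?thesis using outside[of s] by auto
      next
        case first
        have y1: "?y (Suc i) = y (i + K) - P" using rot_down_first[OF first] by simp
        have iK: "i + K < L" using bL[OF first] by simp
        have f: "far (y i) (y (i + K))" using spread_far[OF sp iK] .
        have "y i < y (i + K) - P" if nd: "\<not> P dvd y i"
        proof (cases "K = 1")
          case True
          then have "far (y i) (y (Suc i) - P)" using u2[of i] first outside by auto
          then show ?thesis using far_le True P_pos by fastforce
        next
          case False
          then have K2: "Suc 0 < K" using K_pos by simp
          have "far (y i) (y (i + K - 1))"
            by (rule nb[OF first]) (use K2 iK outside in auto)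
          then have 1: "y i + P \<le> y (i + K - 1)" by (rule far_le)
          have 2: "y (i + K - 1) \<le> y (i + K)" "\<not> P dvd y (i + K) \<Longrightarrow> y (i + K - 1) < y (i + K)"
            using spread_mono[OF sp, of "i + K - 1" "i + K"] spread_strict'[OF sp, of "i + K - 1" "i + K"] iK K_pos by auto
          show ?thesis using 1 2 nd by (cases "y (i + K) = y i + P") auto
        qed
        then show ?thesis using yi y1 far_le[OF f] by auto
      qed
    next
      case (inner s)
      have yi: "?y i = y (i - 1)" using rot_down_inner[OF S(1) inner] .
      have le': "y (i - 1) \<le> y i" "\<not> P dvd y (i - 1) \<Longrightarrow> y (i - 1) < y i"
        using spread_mono[OF sp, of "i - 1" "i"] spread_strict[OF sp, of "i - 1" "i"] i inner by auto
      show ?thesis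
      proof (cases S "Suc i" rule: rot_down_cases)
        case outside
        then have "?y (Suc i) = y (Suc i)" by (rule rot_down_outside)
        then show ?thesis using yi le le' by auto
      next
        case i2: (inner s')
        then have "?y (Suc i) = y i" using rot_down_inner[OF S(1) i2] by simp
        then show ?thesis using yi le' by auto
      next
        case first
        have y1: "?y (Suc i) = y (i + K) - P" using rot_down_first[OF first] by simp
        have iK: "i + K < L" using bL[OF first] by simp
        have f: "far (y i) (y (i + K))" using spread_far[OF sp iK] .
        then show ?thesis using yi y1 le' far_le[OF f] by auto
      qed
    next
      case first
      have yi: "?y i = y (i + K - 1) - P" using rot_down_first[OF first] .
      have nfi: "\<not> far (y i) (y (i + K - 1))" using nf[OF first] .
      have ub: "y (i + K - 1) \<le> y i + P" "\<not> P dvd y (i + K - 1) \<Longrightarrow> y (i + K - 1) < y i + P"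
        using not_far_dvd[OF nfi] not_far_strict[OF nfi] by auto
      show ?thesis
      proof (cases S "Suc i" rule: rot_down_cases)
        case outside
        then have "?y (Suc i) = y (Suc i)" by (rule rot_down_outside)
        moreover have "K = 1" using outside[OF first] K_pos by (cases "K = 1") auto
        ultimately show ?thesis using yi le P_pos by auto
      next
        case (inner s')
        then have "?y (Suc i) = y i" using rot_down_inner[OF S(1) inner] by simp
        then show ?thesis using yi ub by auto
      next
        case f2: first
        then have "K = 1" using apartD[OF S(1) first f2] K_pos by simp
        then show ?thesis using yi rot_down_first[OF f2, of y] le by auto
      qed
    qed
  qed
  have farst: "far (?y i) (?y (i + K))" if i: "i + K < L" for i
  proof -
    have f: "far (y i) (y (i + K))" using spread_far[OF sp i] .
    show ?thesis
    proof (cases S i rule: rot_down_cases)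
      case outside
      have yi: "?y i = y i" using outside by (rule rot_down_outside)
      show ?thesis
      proof (cases S "i + K" rule: rot_down_cases)
        case o2: outside
        then have "?y (i + K) = y (i + K)" by (rule rot_down_outside)
        then show ?thesis using yi f by simp
      next
        case (inner s)
        then have "?y (i + K) = y (i + K - 1)" using rot_down_inner[OF S(1)] by auto
        moreover have "i < s" using outside[OF inner(1)] inner by (meson add_less_cancel_right not_le)
        then have "far (y i) (y (i + K - 1))" by (intro nb[OF inner(1)]) (use inner outside i in auto)
        ultimately show ?thesis using yi by metis
      next
        case first
        then have "?y (i + K) = y (i + 2 * K - 1) - P" using rot_down_first[OF first, of y]
          by (simp add: mult_2 add.assoc)
        then show ?thesis using yi u2[OF first] outside by auto
      qed
    next
      case (inner s)
      have yi: "?y i = y (i - 1)" using rot_down_inner[OF S(1) inner] .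
      have f0: "far (y (i - 1)) (y (i + K - 1))" using spread_far[OF sp, of "i - 1"] i inner by auto
      show ?thesis
      proof (cases S "i + K" rule: rot_down_cases)
        case outside
        then have "?y (i + K) = y (i + K)" by (rule rot_down_outside)
        moreover have "far (y (i - 1)) (y (i + K))"
          using far_mono[OF f0] spread_mono[OF sp, of "i + K - 1" "i + K"] i by auto
        ultimately show ?thesis using yi by simp
      next
        case i2: (inner s')
        then have "?y (i + K) = y (i + K - 1)" using rot_down_inner[OF S(1) i2] by simp
        then show ?thesis using yi f0 by simp
      next
        case first
        then have y1: "?y (i + K) = y (i + K - 1 + K) - P" using rot_down_first[OF first, of y] K_pos
          by (simp add: add.commute)
        have "far (y (i + K - 1)) (y (i + K - 1 + K))"
          using spread_far[OF sp, of "i + K - 1"] bL[OF first] K_pos by auto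
        then show ?thesis using yi y1 far_trans[OF f0] by (simp add: far_shift_diff2)
      qed
    next
      case first
      have yi: "?y i = y (i + K - 1) - P" using rot_down_first[OF first] .
      show ?thesis
      proof (cases S "i + K" rule: rot_down_cases)
        case outside
        then have y1: "?y (i + K) = y (i + K)" by (rule rot_down_outside)
        have "y (i + K - 1) < y (i + K)" using band_next_lt[OF sp S(2)[OF first] i] .
        then show ?thesis using yi y1 by (auto intro: farI)
      next
        case (inner s')
        then show ?thesis using apartD[OF S(1) first inner(1)] apartD[OF S(1) inner(1) first] 
          by (metis add_less_cancel_right linorder_neqE_nat not_le not_add_less1)
      next
        case f2: first
        then have "?y (i + K) = y (i + K - 1 + K) - P" using rot_down_first[OF f2, of y] K_pos
          by (simp add: add.commute)
        moreover have "far (y (i + K - 1)) (y (i + K - 1 + K))"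
          using spread_far[OF sp, of "i + K - 1"] bL[OF f2] K_pos by auto
        ultimately show ?thesis using yi far_shift[of "y (i + K - 1) - P" "y (i + K - 1 + K) - P"] by simp
      qed
    qed
  qed
  show ?thesis unfolding spread_def using step farst by blast
qed

text \<open>Dual to the upward case: the rotated bottom clusters become the top choices.
  \<open>u1\<close> ensures that the top clusters that stay, although chosen from the other end, do
  not reach into the window at \<open>b p\<close>.\<close>

lemma is_top_rot_down:
  assumes sp: "spread y L" and t: "is_top K (band y L) M t" and b: "is_bot K (band y L) M b"
    and p: "p \<le> M"
    and u1: "\<And>i. 1 \<le> p \<Longrightarrow> band y L i \<Longrightarrow> i < b p \<Longrightarrow> b p < i + K \<Longrightarrow> False"
  shows "is_top K (band (rot_down (b ` {1..p}) y) L) M (\<lambda>j. if j \<le> p then b j else t j)"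
proof (cases "p = 0")
  case True
  then show ?thesis using t unfolding is_top_def separated_def by auto
next
  case p0: False
  define S where "S = b ` {1..p}"
  let ?y = "rot_down S y"
  have S: "apart S" unfolding S_def using apart_image[OF is_botD(1)[OF b] p] .
  have bS: "b j \<in> S" if "1 \<le> j" "j \<le> p" for j using that unfolding S_def by auto
  have bmin: "b p \<le> s" if "s \<in> S" for s
    using that separated_mono[OF is_botD(1)[OF b]] p unfolding S_def by auto
  have match: "b j \<le> t j" "t j < b j + K" if "1 \<le> j" "j \<le> M" for j
    using top_bot_match(2)[OF t b K_pos] that by auto
  have out: "?y i = y i" if "i < b p" for i
    by (rule rot_down_outside) (use bmin that in force)
  have bandb: "band y L (b j)" if "1 \<le> j" "j \<le> M" for j using is_botD(2)[OF b that] .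
  have f: "i + K < L \<Longrightarrow> far (y i) (y (i + K))" for i using spread_far[OF sp] .
  have low: "t j + K \<le> b p" if "p < j" "j \<le> M" for j
  proof -
    have "b j + K \<le> b p" using separatedD[OF is_botD(1)[OF b], of p j] that p0 by auto
    then have "t j < b p" using match[of j] that p0 by auto
    then show ?thesis using u1[OF _ is_topD(2)[OF t, of j]] that p0 by force
  qed
  have "separated K M (\<lambda>j. if j \<le> p then b j else t j)"
    unfolding separated_def
  proof (intro allI impI)
    fix j assume j: "1 \<le> j \<and> j < M"
    have "t (Suc j) + K \<le> t j" "b (Suc j) + K \<le> b j"
      using is_topD(1)[OF t] is_botD(1)[OF b] j unfolding separated_def by auto
    then show "(if Suc j \<le> p then b (Suc j) else t (Suc j)) + K \<le> (if j \<le> p then b j else t j)"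
      using low[of "Suc j"] j by (cases "j = p") auto
  qed
  moreover have "band ?y L (if j \<le> p then b j else t j)" if j: "j \<in> {1..M}" for j
  proof (cases "j \<le> p")
    case True
    have B: "band y L (b j)" using bandb j by auto
    have l: "?y (b j) = y (b j + K - 1) - P" using rot_down_first[OF bS] True j by simp
    have "\<not> far (y (b j + K - 1) - P) (?y (b j + K - 1))"
    proof (cases "K = 1")
      case True
      then show ?thesis using l not_far_refl by simp
    next
      case False
      then have K1: "Suc 0 < K" using K_pos by simp
      then have "?y (b j + K - 1) = y (b j + K - 1 - 1)" using rot_down_inner[OF S bS[of j], of "b j + K - 1"] True j by simp
      moreover have "y (b j + K - 1 - 1) \<le> y (b j + K - 1)" "\<not> P dvd y (b j + K - 1) \<Longrightarrow> y (b j + K - 1 - 1) < y (b j + K - 1)"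
        using spread_mono[OF sp, of "b j + K - 1 - 1" "b j + K - 1"] spread_strict'[OF sp, of "b j + K - 1 - 1" "b j + K - 1"]
          B K1 unfolding band_def by auto
      ultimately show ?thesis unfolding far_def by (auto split: if_splits)
    qed
    then show ?thesis using True B l unfolding band_def by simp
  next
    case False
    have B: "band y L (t j)" using is_topD(2)[OF t] j by auto
    have "t j + K \<le> b p" using low[of j] False j by auto
    then have "?y (t j) = y (t j)" "?y (t j + K - 1) = y (t j + K - 1)"
      using out[of "t j"] out[of "t j + K - 1"] K_pos by auto
    then show ?thesis using B False unfolding band_def by simp
  qed
  moreover have "\<exists>j\<in>{1..M}. i \<le> (if j \<le> p then b j else t j) \<and> (if j \<le> p then b j else t j) < i + K"
    if Bi: "band ?y L i" for i
  proof (cases "\<exists>s\<in>S. i \<le> s \<and> s < i + K")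
    case True
    then show ?thesis using p unfolding S_def by force
  next
    case False
    then have none: "\<And>s. s \<in> S \<Longrightarrow> i \<le> s \<Longrightarrow> s < i + K \<Longrightarrow> False" by blast
    have yl: "?y (i + K - 1) = y (i + K - 1)" if io: "\<And>s. s \<in> S \<Longrightarrow> s < i \<Longrightarrow> i < s + K \<Longrightarrow> i + K - 1 < s + K \<Longrightarrow> False"
    proof (rule rot_down_outside)
      fix s assume s: "s \<in> S" "s \<le> i + K - 1" "i + K - 1 < s + K"
      have "s < i + K" using s(2) K_pos by linarith
      then have "s < i" using none[OF s(1)] by (meson not_le)
      then show False using io[OF s(1)] s K_pos by auto
    qed
    have io: "s \<in> S \<Longrightarrow> s < i \<Longrightarrow> i < s + K \<Longrightarrow> False" for s
    proof -
      assume s: "s \<in> S" "s < i" "i < s + K"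
      have "?y i = y (i - 1)" using rot_down_inner[OF S s] .
      moreover have "?y (i + K - 1) = y (i + K - 1)" by (rule yl) (use apart_eq[OF S] s in auto)
      moreover have "far (y (i - 1)) (y (i - 1 + K))" using f[of "i - 1"] Bi s unfolding band_def by auto
      ultimately show False using Bi s unfolding band_def by auto
    qed
    have yi: "?y i = y i" 
    proof (rule rot_down_outside)
      fix s assume "s \<in> S" "s \<le> i" "i < s + K"
      then show False using io[of s] none[of s] K_pos by (cases "s = i") auto
    qed
    have "?y (i + K - 1) = y (i + K - 1)" using yl io by blast
    then have B: "band y L i" using Bi yi unfolding band_def by simp
    obtain j where j: "1 \<le> j" "j \<le> M" "b j \<le> i" "i < b j + K" using is_botD(3)[OF b B] by blast
    obtain j' where j': "1 \<le> j'" "j' \<le> M" "i \<le> t j'" "t j' < i + K" using is_topD(3)[OF t B] by blast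
    have "p < j"
    proof (rule ccontr)
      assume "\<not> p < j"
      then show False using io[OF bS[of j]] none[OF bS[of j]] j K_pos by (cases "b j = i") auto
    qed
    then have ip: "i < b p" using separatedD[OF is_botD(1)[OF b], of p j] j p0 by auto
    have "p < j'"
    proof (rule ccontr)
      assume "\<not> p < j'"
      then have "b p \<le> t j'" using match[of j'] j' separated_mono[OF is_botD(1)[OF b], of j' p] p by auto
      then show False using none[OF bS[of p]] ip j' p0 by auto
    qed
    then show ?thesis using j' by (intro bexI[of _ j']) auto
  qed
  ultimately show ?thesis unfolding is_top_def S_def[symmetric] by blast
qed

section \<open>Ceilings, levels and the common parity of overlapping bands\<close>

definition cl :: "int \<Rightarrow> int" where "cl x = - ((- x) div P)"

lemma le_div_P: "m \<le> x div P \<longleftrightarrow> m * P \<le> x"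
proof
  assume "m \<le> x div P"
  then have "m * P \<le> x div P * P" using P_pos by simp
  then show "m * P \<le> x" using pos_mod_sign[OF P_pos, of x] div_mult_mod_eq[of x P] by linarith
next
  assume "m * P \<le> x"
  then show "m \<le> x div P" using zdiv_mono1[OF _ P_pos, of "m * P" x] P_pos by simp
qed

lemma div_P_less: "x div P < m \<longleftrightarrow> x < m * P"
  using le_div_P by (metis not_le)

lemma cl_le: "cl x \<le> m \<longleftrightarrow> x \<le> m * P"
  using le_div_P[of "- m" "- x"] unfolding cl_def by auto

lemma less_cl: "m < cl x \<longleftrightarrow> m * P < x"
  using cl_le by (metis not_le)

lemma cl_mono: "x \<le> z \<Longrightarrow> cl x \<le> cl z"
  using cl_le[of x "cl z"] cl_le[of z "cl z"] by auto

lemma cl_add_P [simp]: "cl (x + P) = cl x + 1"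
  using P_pos div_add_self2[of P "- x - P"] unfolding cl_def by simp

lemma div_add_P [simp]: "(x + P) div P = x div P + 1"
  using P_pos by simp

lemma cl_diff_P [simp]: "cl (x - P) = cl x - 1"
  using cl_add_P[of "x - P"] by simp

text \<open>Ceiling minus floor detects the non-multiples of \<open>P\<close>; summed over the parts
  it becomes the count \<open>V\<close> of condition (5).\<close>

lemma cl_eq: "cl x = x div P + (if P dvd x then 0 else 1)"
proof (cases "P dvd x")
  case True
  then show ?thesis unfolding cl_def using P_pos by (auto simp: dvd_neg_div)
next
  case False
  then have "x div P * P < x" using le_div_P[of "x div P" x] by (metis dvd_triv_right order_le_less order_refl)
  then have "x div P < cl x" using less_cl by simp
  moreover have "cl x \<le> x div P + 1" using cl_le div_P_less by (metis less_add_one order_less_imp_le)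
  ultimately show ?thesis using False by simp
qed

text \<open>
  Up to a multiple of 2 and a constant, the difference of the two sides of condition (5) for the
  band at \<open>i\<close>.
\<close>

definition level :: "(nat \<Rightarrow> int) \<Rightarrow> nat \<Rightarrow> int" where
  "level y i = (\<Sum>t<i + K. cl (y t)) - (\<Sum>t<i. y t div P)"

definition residues_in :: "int set \<Rightarrow> (nat \<Rightarrow> int) \<Rightarrow> nat \<Rightarrow> bool" where
  "residues_in A y L \<longleftrightarrow> (\<forall>i<L. P dvd y i \<or> y i mod P \<in> A)"

lemma level_Suc: "level y (Suc i) = level y i + cl (y (i + K)) - y i div P"
  unfolding level_def by simp

text \<open>
  If two bands overlapped with a jump of \<open>level\<close> other than 2 per step, their elements would
  contain \<open>K + 1\<close> non-multiples of \<open>P\<close> with pairwise different residues.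
\<close>

lemma level_near_step:
  assumes sp: "spread y L" and A: "finite A" "card A \<le> K" "residues_in A y L"
    and i: "band y L i" and j: "band y L (i + d)" and d: "d \<le> K"
    and near: "\<not> far (y i) (y (i + d + K - 1) - P)" and u: "u < d"
  shows "cl (y (i + u + K)) = y (i + u) div P + 2"
proof -
  \<comment> \<open>\<open>f\<close> is the floor of the entry leaving the window. Spacing puts the
    entering entry above \<open>(f + 1) * P\<close>, and a jump of more than 2 would put it above
    \<open>(f + 2) * P\<close>.\<close>
  define f where "f = y (i + u) div P"
  have L: "i + d + K \<le> L" using j unfolding band_def by simp
  have fb: "f * P \<le> y (i + u)" "y (i + u) < f * P + P"
    using le_div_P[of f "y (i + u)"] div_P_less[of "y (i + u)" "f + 1"] unfolding f_def
    by (auto simp: algebra_simps)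
  have mono: "a \<le> b \<Longrightarrow> b < i + d + K \<Longrightarrow> y a \<le> y b" for a b
    using spread_mono[OF sp] L by auto
  have strict: "a < b \<Longrightarrow> b < i + d + K \<Longrightarrow> \<not> P dvd y a \<Longrightarrow> y a < y b" for a b
    using spread_strict[OF sp] L by auto
  have "far (y (i + u)) (y (i + u + K))" using spread_far[OF sp] L u by auto
  then have "f * P + P < y (i + u + K)"
    using fb unfolding far_def by (cases "y (i + u) = f * P") (auto split: if_splits)
  then have "(f + 1) * P < y (i + u + K)" by (simp add: algebra_simps)
  then have "f + 2 \<le> cl (y (i + u + K))" using less_cl[of "f + 1" "y (i + u + K)"] by linarith
  moreover have "cl (y (i + u + K)) \<le> f + 2"
  proof (rule ccontr)
    assume "\<not> ?thesis"
    then have big: "f * P + 2 * P < y (i + u + K)"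
      using less_cl[of "f + 2" "y (i + u + K)"] by (simp add: algebra_simps)
    define Z where "Z = y (i + d + K - 1)"
    have bZ: "y (i + u + K) \<le> Z" unfolding Z_def using mono u K_pos by auto
    have Zle: "Z \<le> y i + 2 * P" using not_far_dvd[OF near] unfolding Z_def by simp
    have ndvd: "\<not> P dvd x" if "e * P < x" "x < e * P + P" for e x
    proof
      assume "P dvd x"
      then obtain q where "x = q * P" by (metis dvd_def mult.commute)
      then have "e * P < q * P" "q * P < (e + 1) * P" using that by (auto simp: algebra_simps)
      then have "e < q" "q < e + 1" using mult_less_cancel_right_pos[OF P_pos] by blast+
      then show False by simp
    qed
    have y_i: "f * P < y i" "y i \<le> y (i + u)" using big bZ Zle mono[of i "i + u"] u K_pos by auto
    have nd_i: "\<not> P dvd y i" using ndvd[of f "y i"] y_i fb by auto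
    then have Zlt: "Z < y i + 2 * P" using near unfolding Z_def[symmetric] far_def by auto
    have top_i: "y (i + K - 1) < y i + P" using i nd_i unfolding band_def far_def by auto
    have bot_j: "Z \<le> y (i + d) + P" using j not_far_dvd unfolding band_def Z_def by auto
    \<comment> \<open>Three blocks whose values lie strictly inside the three intervals of length
      \<open>P\<close> above \<open>f * P\<close>. They have \<open>u + 1\<close>,
      \<open>K - d\<close> and \<open>d - u\<close> members, hence \<open>K + 1\<close> in all. The
      bands at \<open>i\<close> and \<open>i + d\<close> and the assumption \<open>near\<close> keep
      residues from different blocks apart.\<close>
    define I1 where "I1 = {i..i + u}"
    define I2 where "I2 = {i + d..<i + K}"
    define I3 where "I3 = {i + K + u..<i + d + K}"
    define r where "r x = y x mod P" for x
    have r1: "r x = y x - f * P \<and> r x \<noteq> 0 \<and> y i \<le> y x" if "x \<in> I1" for x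
    proof -
      have "y i \<le> y x" "y x \<le> y (i + u)" using that mono u K_pos unfolding I1_def by auto
      then have "f * P < y x" "y x < f * P + P" using y_i fb by auto
      then have "(y x - f * P) mod P = y x - f * P" by (intro mod_pos_pos_trivial) auto
      then show ?thesis using \<open>f * P < y x\<close> \<open>y i \<le> y x\<close> unfolding r_def by (simp add: mod_diff_right_eq[symmetric])
    qed
    have r2: "r x = y x - f * P - P \<and> r x \<noteq> 0 \<and> y (i + d) \<le> y x \<and> y x \<le> y (i + K - 1)" if "x \<in> I2" for x
    proof -
      have m: "y (i + d) \<le> y x" "y x \<le> y (i + K - 1)" using that mono u K_pos unfolding I2_def by auto
      then have b: "f * P + P < y x" "y x < f * P + P + P" using y_i fb top_i bot_j big bZ by auto
      then have "(y x - f * P - P) mod P = y x - f * P - P" by (intro mod_pos_pos_trivial) auto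
      moreover have "(y x - f * P - P) mod P = y x mod P"
        using mod_mult_self1[of "y x" "- f - 1" P] by (simp add: algebra_simps)
      ultimately show ?thesis using b m unfolding r_def by auto
    qed
    have r3: "r x = y x - f * P - 2 * P \<and> r x \<noteq> 0 \<and> y x \<le> Z" if "x \<in> I3" for x
    proof -
      have m: "y (i + u + K) \<le> y x" "y x \<le> Z" using that mono u K_pos unfolding I3_def Z_def by (auto simp: algebra_simps)
      then have b: "f * P + 2 * P < y x" "y x < f * P + 2 * P + P" using y_i fb Zlt big by auto
      then have "(y x - f * P - 2 * P) mod P = y x - f * P - 2 * P" by (intro mod_pos_pos_trivial) auto
      moreover have "(y x - f * P - 2 * P) mod P = y x mod P"
        using mod_mult_self1[of "y x" "- f - 2" P] by (simp add: algebra_simps)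
      ultimately show ?thesis using b m unfolding r_def by auto
    qed
    have I: "x < i + d + K" if "x \<in> I1 \<union> I2 \<union> I3" for x
      using that u d K_pos unfolding I1_def I2_def I3_def by auto
    have rne: "r x \<noteq> 0" if "x \<in> I1 \<union> I2 \<union> I3" for x using that r1 r2 r3 by blast
    have nd: "\<not> P dvd y x" if "x \<in> I1 \<union> I2 \<union> I3" for x
      using rne[OF that] unfolding r_def by (simp add: dvd_eq_mod_eq_0)
    have inj: "inj_on r (I1 \<union> I2 \<union> I3)"
    proof (rule linorder_inj_onI)
      fix x x' assume xx: "x < x'" "x \<in> I1 \<union> I2 \<union> I3" "x' \<in> I1 \<union> I2 \<union> I3"
      have lt: "y x < y x'" using strict[OF xx(1) I[OF xx(3)] nd[OF xx(2)]] .
      have "\<not> (x \<in> I2 \<and> x' \<in> I1)" "\<not> (x \<in> I3 \<and> x' \<in> I1)" "\<not> (x \<in> I3 \<and> x' \<in> I2)"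
        using xx(1) u K_pos unfolding I1_def I2_def I3_def by auto
      then have IIcases: "x \<in> I1 \<and> x' \<in> I1 \<or> x \<in> I2 \<and> x' \<in> I2 \<or> x \<in> I3 \<and> x' \<in> I3 \<or>
          x \<in> I1 \<and> x' \<in> I2 \<or> x \<in> I1 \<and> x' \<in> I3 \<or> x \<in> I2 \<and> x' \<in> I3"
        using xx(2,3) by blast
      have e23: "Z < y (i + d) + P" if "x \<in> I2"
      proof -
        have "\<not> P dvd y (i + d)" using nd[of "i + d"] that unfolding I2_def by auto
        then show ?thesis using j unfolding band_def far_def Z_def by auto
      qed
      show "r x \<noteq> r x'"
        using IIcases
      proof (elim disjE conjE)
        assume "x \<in> I1" "x' \<in> I1" then show ?thesis using r1[of x] r1[of x'] lt by linarith
      next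
        assume "x \<in> I2" "x' \<in> I2" then show ?thesis using r2[of x] r2[of x'] lt by linarith
      next
        assume "x \<in> I3" "x' \<in> I3" then show ?thesis using r3[of x] r3[of x'] lt by linarith
      next
        assume "x \<in> I1" "x' \<in> I2" then show ?thesis using r1[of x] r2[of x'] top_i by linarith
      next
        assume "x \<in> I1" "x' \<in> I3" then show ?thesis using r1[of x] r3[of x'] Zlt by linarith
      next
        assume "x \<in> I2" "x' \<in> I3" then show ?thesis using r2[of x] r3[of x'] e23 by linarith
      qed
    qed auto
    have "r ` (I1 \<union> I2 \<union> I3) \<subseteq> A"
    proof
      fix z assume "z \<in> r ` (I1 \<union> I2 \<union> I3)"
      then obtain x where x: "x \<in> I1 \<union> I2 \<union> I3" "z = r x" by blast
      have "x < L" using I[OF x(1)] L by simp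
      then show "z \<in> A" using A(3) nd[OF x(1)] x(2) unfolding residues_in_def r_def by blast
    qed
    then have "card (I1 \<union> I2 \<union> I3) \<le> card A" using card_inj_on_le[OF inj _ A(1)] by blast
    moreover have "card (I1 \<union> I2 \<union> I3) = card I1 + card I2 + card I3"
    proof -
      have "(I1 \<union> I2) \<inter> I3 = {}" "I1 \<inter> I2 = {}" using u K_pos unfolding I1_def I2_def I3_def by auto
      then show ?thesis by (subst card_Un_disjoint | simp add: I1_def I2_def I3_def)+
    qed
    moreover have "card I1 + card I2 + card I3 = K + 1" using u d unfolding I1_def I2_def I3_def by simp
    ultimately show False using A(2) by simp
  qed
  ultimately show ?thesis unfolding f_def by simp
qed

text \<open>Each step adds an entering ceiling minus a leaving floor, which is 2. The case
  \<open>d = K\<close>, two adjacent disjoint bands, is needed for undoing a rotation.\<close>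

lemma level_near:
  assumes sp: "spread y L" and A: "finite A" "card A \<le> K" "residues_in A y L"
    and i: "band y L i" and j: "band y L (i + d)" and d: "d \<le> K"
    and near: "\<not> far (y i) (y (i + d + K - 1) - P)"
  shows "level y (i + d) = level y i + 2 * int d"
proof -
  have "u \<le> d \<Longrightarrow> level y (i + u) = level y i + 2 * int u" for u
  proof (induction u)
    case (Suc u)
    then show ?case using level_near_step[OF assms, of u] level_Suc[of y "i + u"] by simp
  qed simp
  then show ?thesis by simp
qed

text \<open>Because of the overlap, \<open>y j\<close> is at most \<open>y i + P\<close>, and the
  last entry of the upper band is not far from \<open>y j\<close>; so both bands together are short
  enough for \<open>level_near\<close>. Parity thereby belongs to a cluster rather than to the band
  chosen to represent it.\<close>

lemma level_overlap:
  assumes sp: "spread y L" and A: "finite A" "card A \<le> K" "residues_in A y L"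
    and i: "band y L i" and j: "band y L j" and ij: "i \<le> j" "j < i + K"
  shows "even (level y j - level y i)"
proof -
  obtain d where d: "j = i + d" using ij le_Suc_ex by blast
  have "y j \<le> y (i + K - 1)" using spread_mono[OF sp, of j "i + K - 1"] ij i K_pos unfolding band_def by auto
  also have "\<dots> \<le> y i + P" using i not_far_dvd unfolding band_def by auto
  finally have "\<not> far (y i) (y (i + d + K - 1) - P)"
    using j far_mono_left[of "y i + P" _ "y j"] unfolding band_def d by (auto simp: far_shift_diff2)
  then show ?thesis using level_near[OF sp A i j[unfolded d]] ij d by auto
qed

text \<open>A cut outside the interior of all windows has below it complete windows only, in each of
  which one entry has grown by \<open>P\<close>. Used with the ceiling, the floor and the identity
  for \<open>g\<close>.\<close>

lemma sum_rot_up: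
  fixes g :: "int \<Rightarrow> int"
  assumes g: "\<And>x. g (x + P) = g x + c" and S: "apart S" "finite S"
    and x: "\<And>s. s \<in> S \<Longrightarrow> s < x \<Longrightarrow> x < s + K \<Longrightarrow> False"
  shows "(\<Sum>t<x. g (rot_up S y t)) = (\<Sum>t<x. g (y t)) + c * int (card {s\<in>S. s + K \<le> x})"
  using x
proof (induction x rule: less_induct)
  case (less x)
  consider "x = 0" | s where "s \<in> S" "x = s + K" | x' where "x = Suc x'" "\<And>s. s \<in> S \<Longrightarrow> x \<noteq> s + K"
    by (cases x) auto
  then show ?case
  proof cases
    case 1
    then have "{s \<in> S. s + K \<le> x} = {}" using K_pos by auto
    then show ?thesis using 1 by simp
  next
    case (2 s)
    have IH: "(\<Sum>t<s. g (rot_up S y t)) = (\<Sum>t<s. g (y t)) + c * int (card {s'\<in>S. s' + K \<le> s})"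
      by (rule less.IH) (use 2 K_pos apartD[OF S(1)] in \<open>auto dest: leD\<close>)
    have set: "{s'\<in>S. s' + K \<le> x} = insert s {s'\<in>S. s' + K \<le> s}"
      using 2 apartD[OF S(1) _ 2(1)] by (auto simp: order_le_less)
    have card: "card {s'\<in>S. s' + K \<le> x} = Suc (card {s'\<in>S. s' + K \<le> s})"
      unfolding set using S(2) K_pos by (subst card_insert_disjoint) auto
    obtain K' where K': "K = Suc K'" using K_pos by (cases K) auto
    have split: "(\<Sum>t<x. h t) = (\<Sum>t<s. h t) + (\<Sum>t\<in>{s..<s + K}. h t)" for h :: "nat \<Rightarrow> int"
      using sum.atLeastLessThan_concat[of 0 s "s + K" h] 2 by (simp add: lessThan_atLeast0)
    have "(\<Sum>t\<in>{s..<s + K}. g (rot_up S y t)) = (\<Sum>t\<in>{s..<s + K'}. g (rot_up S y t)) + g (rot_up S y (s + K'))"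
      unfolding K' by simp
    also have "(\<Sum>t\<in>{s..<s + K'}. g (rot_up S y t)) = (\<Sum>t\<in>{s..<s + K'}. g (y (Suc t)))"
      by (rule sum.cong) (use rot_up_inner[OF S(1) 2(1)] K' in auto)
    also have "\<dots> = (\<Sum>t\<in>{Suc s..<s + K}. g (y t))"
      using sum.shift_bounds_Suc_ivl[of "\<lambda>t. g (y t)" s "s + K'"] K' by simp
    also have "g (rot_up S y (s + K')) = g (y s) + c" using rot_up_last[OF 2(1), of y] K' g by simp
    finally have "(\<Sum>t\<in>{s..<s + K}. g (rot_up S y t)) = (\<Sum>t\<in>{s..<s + K}. g (y t)) + c"
      using sum.atLeast_Suc_lessThan[of s "s + K" "\<lambda>t. g (y t)"] K_pos by simp
    then show ?thesis unfolding split card using IH by (simp add: algebra_simps)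
  next
    case (3 x')
    have no: "s \<in> S \<Longrightarrow> s \<le> x' \<Longrightarrow> x' < s + K \<Longrightarrow> False" for s
      using less.prems[of s] 3(1) 3(2)[of s] by auto
    have "(\<Sum>t<x'. g (rot_up S y t)) = (\<Sum>t<x'. g (y t)) + c * int (card {s\<in>S. s + K \<le> x'})"
    proof (rule less.IH)
      show "x' < x" using 3(1) by simp
      show "s \<in> S \<Longrightarrow> s < x' \<Longrightarrow> x' < s + K \<Longrightarrow> False" for s using no[of s] by simp
    qed
    moreover have "rot_up S y x' = y x'" by (rule rot_up_outside) (rule no)
    moreover have "{s\<in>S. s + K \<le> x'} = {s\<in>S. s + K \<le> x}" using 3 by (intro Collect_cong) (metis le_Suc_eq)
    ultimately show ?thesis using 3(1) by simp
  qed
qed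

text \<open>The ceilings are summed up to \<open>s + K\<close> but the floors only up to
  \<open>s\<close>, so the first sum sees one more rotated window, the one at \<open>s\<close>
  itself.\<close>

lemma level_rot_up:
  assumes S: "apart S" "finite S" and s: "s \<in> S"
  shows "level (rot_up S y) s = level y s + 1"
proof -
  have no: "s' \<in> S \<Longrightarrow> s' < s \<Longrightarrow> s < s' + K \<Longrightarrow> False"
    "s' \<in> S \<Longrightarrow> s' < s + K \<Longrightarrow> s + K < s' + K \<Longrightarrow> False" for s'
    using apartD[OF S(1) _ s] apartD[OF S(1) s] by (auto dest: leD)
  have set: "{s'\<in>S. s' + K \<le> s + K} = insert s {s'\<in>S. s' + K \<le> s}"
    using s apartD[OF S(1) _ s] by (auto simp: order_le_less)
  have card: "card {s'\<in>S. s' + K \<le> s + K} = Suc (card {s'\<in>S. s' + K \<le> s})"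
    unfolding set using S(2) K_pos by (subst card_insert_disjoint) auto
  have "(\<Sum>t<s + K. cl (rot_up S y t)) = (\<Sum>t<s + K. cl (y t)) + 1 * int (card {s'\<in>S. s' + K \<le> s + K})"
    by (rule sum_rot_up[OF _ S no(2)]) auto
  moreover have "(\<Sum>t<s. rot_up S y t div P) = (\<Sum>t<s. y t div P) + 1 * int (card {s'\<in>S. s' + K \<le> s})"
    by (rule sum_rot_up[OF _ S no(1)]) auto
  ultimately show ?thesis unfolding level_def using card by simp
qed

lemma level_rot_up_below:
  assumes "\<And>s. s \<in> S \<Longrightarrow> i + K \<le> s"
  shows "level (rot_up S y) i = level y i"
proof -
  have "rot_up S y t = y t" if "t < i + K" for t
    by (rule rot_up_outside) (use assms that in force)
  then show ?thesis unfolding level_def by simp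
qed

end

lemma (in band_system) bot_exists:
  assumes "spread y L" "is_top K (band y L) M t"
  obtains b where "is_bot K (band y L) M b"
  using is_bot_exists[OF finite_band[OF assms(1)] K_pos] top_bot_match(1)[OF assms(2) _ K_pos] by blast

lemma (in band_system) top_exists:
  assumes "spread y L" "is_bot K (band y L) M b"
  obtains t where "is_top K (band y L) M t"
  using is_top_exists[OF finite_band[OF assms(1)] K_pos] top_bot_match(1)[OF _ assms(2) K_pos] by metis

lemma (in band_system) is_top_count_unique:
  assumes "spread y L" "is_top K (band y L) M t" "is_top K (band y L) M' t'"
  shows "M' = M"
  by (metis assms bot_exists top_bot_match(1) K_pos)

section \<open>Configurations with marks\<close>

locale overpartition_system = band_system +
  fixes A :: "int set" and c :: nat
  assumes A: "finite A" "card A \<le> K" and c: "c \<le> K"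
begin

text \<open>
  Virtual parts below the actual ones, with \<open>c = r - 1\<close>: being far from them is condition (4),
  and the level of the band they form is \<open>- (r - 1)\<close>, the parity prescribed by (5).
\<close>

definition base :: "nat \<Rightarrow> int" where
  "base i = (if i < c then - P else 0)"

text \<open>Values from \<open>L\<close> on are fixed as 0, so that equality of configurations is
  equality of functions.\<close>

definition config :: "(nat \<Rightarrow> int) \<Rightarrow> nat \<Rightarrow> bool" where
  "config y L \<longleftrightarrow> K \<le> L \<and> spread y L \<and> residues_in A y L \<and> (\<forall>i<K. y i = base i) \<and> (\<forall>i\<ge>L. y i = 0)"

text \<open>
  The overlined part \<open>m * P\<close> can be added to \<open>y\<close> without violating condition (3).
\<close>

definition compat :: "(nat \<Rightarrow> int) \<Rightarrow> nat \<Rightarrow> nat \<Rightarrow> bool" where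
  "compat y L m \<longleftrightarrow> (\<forall>i. band y L i \<longrightarrow> int m + 1 < cl (y (i + K - 1)) \<or> cl (y i) < int m)"

text \<open>
  A mark \<open>m\<close> below exactly \<open>p\<close> clusters has rank \<open>m + p\<close>, the size (in units of \<open>P\<close>) of the
  distinct part it stands for; clusters with index at least \<open>f\<close> still satisfy (5).
\<close>

definition good :: "nat \<Rightarrow> nat \<Rightarrow> (nat \<Rightarrow> nat) \<Rightarrow> (nat \<Rightarrow> int) \<Rightarrow> nat set \<Rightarrow> bool" where
  "good f M t y E \<longleftrightarrow>
     (\<forall>j. 1 \<le> j \<and> j \<le> M \<and> f \<le> j \<longrightarrow> even (level y (t j) - level y 0)) \<and>
     (\<forall>m\<in>E. m < f \<and> (\<forall>j. 1 \<le> j \<and> j \<le> M \<and> int m < cl (y (t j)) \<longrightarrow> m + j < f))"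

lemma configD:
  assumes "config y L"
  shows "K \<le> L" "spread y L" "residues_in A y L" "\<And>i. i < K \<Longrightarrow> y i = base i" "\<And>i. L \<le> i \<Longrightarrow> y i = 0"
  using assms unfolding config_def by auto

text \<open>The virtual parts take only the values \<open>- P\<close> and 0, which are not far from
  each other. So every configuration has at least one cluster.\<close>

lemma config_band_0: "config y L \<Longrightarrow> band y L 0"
  using K_pos P_pos unfolding config_def band_def far_def base_def by auto

lemma config_pos:
  assumes y: "config y L" and i: "K \<le> i" "i < L" shows "0 < y i"
proof -
  have "far (y 0) (y K)" using spread_far[OF configD(2)[OF y], of 0] i by auto
  then have "0 < y K" using configD(4)[OF y, of 0] K_pos P_pos unfolding far_def base_def by (auto split: if_splits)
  then show ?thesis using spread_mono[OF configD(2)[OF y] i] by simp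
qed

lemma cl_pos: "0 < x \<Longrightarrow> 1 \<le> cl x"
  using less_cl[of 0 x] by simp

lemma cl_base: "cl (base i) \<le> 0"
  using cl_le[of "base i" 0] P_pos unfolding base_def by simp

lemma band_cl_le: "band y L i \<Longrightarrow> cl (y (i + K - 1)) \<le> cl (y i) + 1"
  using not_far_dvd[of "y i" "y (i + K - 1)"] cl_mono[of "y (i + K - 1)" "y i + P"] unfolding band_def by auto

lemma compat_above:
  assumes "compat y L m" "band y L i" "int m < cl (y i)" shows "int m + 1 < cl (y (i + K - 1))"
  using assms unfolding compat_def by force

text \<open>Ceilings in a band differ by at most one, so the first alternative of
  \<open>compat\<close> would give \<open>int m < cl (y i)\<close>. This test alone therefore
  decides on which side of the band a mark lies.\<close>

lemma compat_below:
  assumes "compat y L m" "band y L i" "\<not> int m < cl (y i)" shows "cl (y i) < int m"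
  using assms band_cl_le[OF assms(2)] unfolding compat_def by force

text \<open>A mark between two overlapping bands would lie within the span of the lower one. Hence
  the number of clusters above a mark does not depend on the bands representing them.\<close>

lemma compat_side:
  assumes sp: "spread y L" and m: "compat y L m" and i: "band y L i" and j: "band y L j"
    and ij: "i \<le> j" "j < i + K"
  shows "int m < cl (y i) \<longleftrightarrow> int m < cl (y j)"
proof
  have jL: "i + K \<le> L" "j < L" using i j K_pos unfolding band_def by auto
  show "int m < cl (y j)" if "int m < cl (y i)"
    using cl_mono[OF spread_mono[OF sp ij(1) jL(2)]] that by simp
  show "int m < cl (y i)" if a: "int m < cl (y j)"
  proof (rule ccontr)
    assume "\<not> int m < cl (y i)"
    then have "cl (y i) < int m" using compat_below[OF m i] by simp
    moreover have "cl (y j) \<le> cl (y (i + K - 1))" 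
      by (rule cl_mono, rule spread_mono[OF sp]) (use ij jL K_pos in auto)
    ultimately show False using band_cl_le[OF i] a by simp
  qed
qed

text \<open>Windows reaching index \<open>x\<close> end above \<open>m\<close> and so clear the
  smaller mark \<open>m'\<close>; windows ending before \<open>x\<close> are unchanged.\<close>

lemma compat_transfer:
  assumes agree: "\<And>i. i < x \<Longrightarrow> y' i = y i"
    and high: "\<And>i. x \<le> i \<Longrightarrow> i < L \<Longrightarrow> int m < cl (y' i)"
    and m': "compat y L m'" "m' < m"
  shows "compat y' L m'"
  unfolding compat_def
proof (intro allI impI)
  fix i assume i: "band y' L i"
  show "int m' + 1 < cl (y' (i + K - 1)) \<or> cl (y' i) < int m'"
  proof (cases "x \<le> i + K - 1")
    case True
    then show ?thesis using high[of "i + K - 1"] i m'(2) K_pos unfolding band_def by force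
  next
    case False
    then have "i < x" "i + K - 1 < x" using K_pos by linarith+
    then have "y' i = y i" "y' (i + K - 1) = y (i + K - 1)" using agree by auto
    then show ?thesis using m'(1) i unfolding compat_def band_def by auto
  qed
qed

section \<open>Clusters of a configuration, their ceilings and their rotation\<close>

context
  fixes y :: "nat \<Rightarrow> int" and L M :: nat and t :: "nat \<Rightarrow> nat"
  assumes y: "config y L" and t: "is_top K (band y L) M t"
begin

lemma sep: "separated K M t" using is_topD(1)[OF t] .

text \<open>The virtual band at 0 must be blocked, so the last cluster starts among the virtual
  parts; all earlier clusters consist of actual parts.\<close>

lemma top_last: "1 \<le> M" "t M < K"
proof -
  obtain j where j: "j \<ge> 1" "j \<le> M" "t j < K"
    using is_topD(3)[OF t config_band_0[OF y]] by auto
  then show "1 \<le> M" by simp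
  show "t M < K" using separated_mono[OF sep, of j M] j by auto
qed

lemma top_ge: "1 \<le> j \<Longrightarrow> j < M \<Longrightarrow> K \<le> t j"
  using separatedD[OF sep, of j M] by simp

lemma top_band: "1 \<le> j \<Longrightarrow> j \<le> M \<Longrightarrow> band y L (t j)"
  using is_topD(2)[OF t] .

text \<open>Starts of disjoint clusters differ by at least \<open>P\<close>. Thus
  \<open>cl (y (t j)) + int j\<close> is weakly decreasing in \<open>j\<close>, which is why a mark
  of given rank has only one possible place.\<close>

lemma cl_top_gap: "1 \<le> i \<Longrightarrow> i \<le> j \<Longrightarrow> j \<le> M \<Longrightarrow> cl (y (t j)) + int j \<le> cl (y (t i)) + int i"
proof (induction j)
  case (Suc j)
  show ?case
  proof (cases "i = Suc j")
    case False
    have s: "t (Suc j) + K \<le> t j" using sep Suc.prems False unfolding separated_def by auto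
    have L: "t j < L" using top_band[of j] Suc.prems False K_pos unfolding band_def by auto
    have "y (t (Suc j)) + P \<le> y (t (Suc j) + K)"
      using far_le[OF spread_far[OF configD(2)[OF y]]] s L by auto
    also have "\<dots> \<le> y (t j)" using spread_mono[OF configD(2)[OF y] s L] .
    finally have "cl (y (t (Suc j))) + 1 \<le> cl (y (t j))" using cl_mono by fastforce
    then show ?thesis using Suc False by simp
  qed simp
qed simp

lemma cl_top_last: "cl (y (t M)) \<le> 0"
  using configD(4)[OF y top_last(2)] cl_base by simp

text \<open>Cluster \<open>M - 1\<close> starts at an actual part, so its ceiling is at least 1, and
  each cluster further up adds at least 1.\<close>

lemma cl_top_ge: "1 \<le> j \<Longrightarrow> j < M \<Longrightarrow> int M \<le> cl (y (t j)) + int j"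
proof -
  assume j: "1 \<le> j" "j < M"
  have M1: "1 \<le> M - 1" "M - 1 < M" "j \<le> M - 1" using j by linarith+
  have "t (M - 1) < L" using top_band[of "M - 1"] M1 K_pos unfolding band_def by linarith
  then have "1 \<le> cl (y (t (M - 1)))"
    using cl_pos[OF config_pos[OF y top_ge[OF M1(1,2)]]] by simp
  then show "int M \<le> cl (y (t j)) + int j" using cl_top_gap[OF j(1) M1(3)] M1 by linarith
qed

text \<open>A mark \<open>m < M\<close> lies below cluster \<open>M - m\<close>, whose ceiling is at
  least \<open>m\<close>. Its rank is then at least \<open>M\<close>, too large for
  \<open>f\<close>. So there are no marks as long as the moves are rotations.\<close>

lemma good_imp_empty:
  assumes g: "good f M t y E" and E: "\<And>m. m \<in> E \<Longrightarrow> 1 \<le> m \<and> compat y L m" and f: "f \<le> M"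
  shows "E = {}"
proof (rule ccontr)
  assume "E \<noteq> {}"
  then obtain m where m: "m \<in> E" by blast
  then have m1: "1 \<le> m" "compat y L m" "m < f" using E g unfolding good_def by auto
  define j where "j = M - m"
  have j: "1 \<le> j" "j < M" "m + j = M" using m1 f unfolding j_def by auto
  have "int m \<le> cl (y (t j))" using cl_top_ge[OF j(1,2)] j by simp
  then have "int m < cl (y (t j))" using compat_below[OF m1(2) top_band[of j]] j by force
  then show False using g m j f unfolding good_def by (metis less_imp_le linorder_not_le)
qed

text \<open>Because of \<open>p < M\<close> every rotated window starts at index \<open>K\<close> or
  later, and the virtual parts stay in place.\<close>

lemma config_rot_up:
  assumes p: "p < M" shows "config (rot_up (t ` {1..p}) y) L"
proof -
  define S where "S = t ` {1..p}"
  have ap: "apart S" unfolding S_def by (rule apart_image[OF sep]) (use p in simp)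
  have B: "band y L s" if "s \<in> S" for s using that top_band p unfolding S_def by auto
  have sK: "K \<le> s" if "s \<in> S" for s using that top_ge p unfolding S_def by auto
  have "spread (rot_up S y) L"
    by (rule spread_rot_up[OF configD(2)[OF y] ap B]) (use top_closed[OF t] p in \<open>auto simp: S_def\<close>)
  moreover have "residues_in A (rot_up S y) L"
    unfolding residues_in_def
  proof (intro allI impI)
    fix i assume i: "i < L"
    have r: "k < L \<Longrightarrow> P dvd y k \<or> y k mod P \<in> A" for k using configD(3)[OF y] unfolding residues_in_def by blast
    show "P dvd rot_up S y i \<or> rot_up S y i mod P \<in> A"
    proof (cases S i rule: rot_up_cases)
      case outside
      then show ?thesis using r[OF i] rot_up_outside[of S i y] by metis
    next
      case (inner s)
      then show ?thesis using r[of "Suc i"] rot_up_inner[OF ap inner, of y] B[OF inner(1)] unfolding band_def by auto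
    next
      case (last s)
      then show ?thesis using r[of s] rot_up_last[OF last(1), of y] B[OF last(1)] K_pos unfolding band_def by auto
    qed
  qed
  moreover have "rot_up S y i = y i" if "i < K \<or> L \<le> i" for i
  proof (rule rot_up_outside)
    fix s assume "s \<in> S" "s \<le> i" "i < s + K"
    then show False using sK[of s] B[of s] that unfolding band_def by auto
  qed
  ultimately show ?thesis using y unfolding config_def S_def[symmetric] by auto
qed

context
  fixes b :: "nat \<Rightarrow> nat"
  assumes b: "is_bot K (band y L) M b"
begin

lemma match: "1 \<le> j \<Longrightarrow> j \<le> M \<Longrightarrow> b j \<le> t j" "1 \<le> j \<Longrightarrow> j \<le> M \<Longrightarrow> t j < b j + K"
  using top_bot_match(2)[OF t b K_pos] by auto

lemma bot_band: "1 \<le> j \<Longrightarrow> j \<le> M \<Longrightarrow> band y L (b j)"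
  using is_botD(2)[OF b] .

lemma bot_ge: "1 \<le> j \<Longrightarrow> j < M \<Longrightarrow> K \<le> b j"
  using separatedD[OF is_botD(1)[OF b], of j M] by simp

lemma even_level_match: "1 \<le> j \<Longrightarrow> j \<le> M \<Longrightarrow> even (level y (t j) - level y (b j))"
  by (rule level_overlap[OF configD(2)[OF y] A configD(3)[OF y] bot_band top_band]) (use match in auto)

text \<open>Two far steps in a row, from \<open>i\<close> to \<open>i + K - 1\<close> and on to
  \<open>i + 2 * K - 1\<close>. This is the second condition for rotating down, in the case that the
  lower window is no band.\<close>

lemma far_two:
  assumes "\<not> band y L i" "i + 2 * K \<le> L"
  shows "far (y i) (y (i + 2 * K - 1) - P)"
proof -
  have "far (y i) (y (i + K - 1))" using assms unfolding band_def by auto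
  moreover have "far (y (i + K - 1)) (y (i + K - 1 + K))"
    using spread_far[OF configD(2)[OF y], of "i + K - 1"] assms K_pos by auto
  moreover have "i + K - 1 + K = i + 2 * K - 1" using K_pos by simp
  ultimately show ?thesis using far_trans by (simp add: far_shift_diff2)
qed

text \<open>Hypotheses are needed for the lowest rotated cluster only: a band just below a higher
  one is covered by a cluster of the greedy choice that is rotated as well.\<close>

lemma config_rot_down:
  assumes p: "p < M"
    and u1: "\<And>i. 1 \<le> p \<Longrightarrow> band y L i \<Longrightarrow> i < b p \<Longrightarrow> b p < i + K \<Longrightarrow> False"
    and u2: "1 \<le> p \<Longrightarrow> band y L (b p - K) \<Longrightarrow> far (y (b p - K)) (y (b p + K - 1) - P)"
  shows "config (rot_down (b ` {1..p}) y) L"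
proof -
  define S where "S = b ` {1..p}"
  have sepb: "separated K M b" using is_botD(1)[OF b] .
  have ap: "apart S" unfolding S_def by (rule apart_image[OF sepb]) (use p in simp)
  have B: "band y L s" if "s \<in> S" for s using that bot_band p unfolding S_def by auto
  have sK: "K \<le> s" if "s \<in> S" for s using that bot_ge p unfolding S_def by auto
  have cover: "\<exists>s'\<in>S. s' \<le> i \<and> i < s' + K"
    if bi: "band y L i" and j: "1 \<le> j" "j < p" "i < b j" "b j \<le> i + K" for i j
  proof -
    obtain j' where j': "1 \<le> j'" "j' \<le> M" "b j' \<le> i" "i < b j' + K"
      using is_botD(3)[OF b bi] by blast
    have "b (Suc j) + K \<le> b j" using sepb j p unfolding separated_def by auto
    then have "\<not> Suc j < j'" using separatedD[OF sepb, of "Suc j" j'] j j' by auto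
    then have "j' \<in> {1..p}" using j j' by auto
    then show ?thesis using j' unfolding S_def by blast
  qed
  have sp: "spread (rot_down S y) L"
  proof (rule spread_rot_down[OF configD(2)[OF y] ap B])
    fix i s assume a: "s \<in> S" "band y L i" "s < i + K" "i < s"
    then obtain j where j: "1 \<le> j" "j \<le> p" "s = b j" unfolding S_def by auto
    show "\<exists>s'\<in>S. s' \<le> i \<and> i < s' + K"
    proof (cases "j = p")
      case True then show ?thesis using u1[of i] a j by auto
    next
      case False then show ?thesis using cover[OF a(2), of j] a j by auto
    qed
  next
    fix i assume a: "i + K \<in> S" "\<And>s'. s' \<in> S \<Longrightarrow> s' \<le> i \<Longrightarrow> i < s' + K \<Longrightarrow> False"
    then obtain j where j: "1 \<le> j" "j \<le> p" "i + K = b j" unfolding S_def by auto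
    have L: "i + 2 * K \<le> L" using B[OF a(1)] unfolding band_def by simp
    show "far (y i) (y (i + 2 * K - 1) - P)"
    proof (cases "band y L i")
      case True
      have "j = p"
      proof (rule ccontr)
        assume "j \<noteq> p"
        then show False using cover[OF True, of j] a(2) j K_pos by force
      qed
      then have e: "b p - K = i" "b p + K - 1 = i + 2 * K - 1" using j by auto
      show ?thesis using u2[unfolded e] True j by simp
    next
      case False
      then show ?thesis using far_two L by blast
    qed
  qed
  moreover have "residues_in A (rot_down S y) L"
    unfolding residues_in_def
  proof (intro allI impI)
    fix i assume i: "i < L"
    have r: "k < L \<Longrightarrow> P dvd y k \<or> y k mod P \<in> A" for k using configD(3)[OF y] unfolding residues_in_def by blast
    show "P dvd rot_down S y i \<or> rot_down S y i mod P \<in> A"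
    proof (cases S i rule: rot_down_cases)
      case outside
      then show ?thesis using r[OF i] rot_down_outside[of S i y] by metis
    next
      case (inner s)
      then show ?thesis using r[of "i - 1"] rot_down_inner[OF ap inner, of y] i by auto
    next
      case first
      then have "i + K - 1 < L" using B K_pos unfolding band_def by fastforce
      moreover have "(y (i + K - 1) - P) mod P = y (i + K - 1) mod P" by simp
      ultimately show ?thesis using r[of "i + K - 1"] rot_down_first[OF first, of y] by auto
    qed
  qed
  moreover have "rot_down S y i = y i" if "i < K \<or> L \<le> i" for i
  proof (rule rot_down_outside)
    fix s assume "s \<in> S" "s \<le> i" "i < s + K"
    then show False using sK[of s] B[of s] that unfolding band_def by auto
  qed
  ultimately show ?thesis using y unfolding config_def S_def[symmetric] by auto
qed

end
end

section \<open>Inserting a distinct part of size \<open>f\<close>, in units of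
  \<open>P\<close>\<close>

definition admissible :: "nat \<Rightarrow> nat \<Rightarrow> (nat \<Rightarrow> int) \<Rightarrow> nat set \<Rightarrow> bool" where
  "admissible f L y E \<longleftrightarrow> config y L \<and> finite E \<and> (\<forall>m\<in>E. 1 \<le> m \<and> compat y L m) \<and>
     (\<exists>M t. is_top K (band y L) M t \<and> good f M t y E)"

text \<open>
  Adding a distinct part \<open>f\<close>: if \<open>f < M\<close> it rotates the top \<open>f\<close> clusters, otherwise it rotates
  the top \<open>p\<close> clusters and leaves a mark at \<open>f - p\<close>, where \<open>p\<close> is the only choice for which the
  mark then fits between the clusters \<open>p\<close> and \<open>p + 1\<close>.
\<close>

definition moves_by :: "nat \<Rightarrow> nat \<Rightarrow> (nat \<Rightarrow> nat) \<Rightarrow> nat \<Rightarrow> (nat \<Rightarrow> int) \<Rightarrow> nat set \<Rightarrow> nat set \<Rightarrow> bool" where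
  "moves_by f M t p y E E' \<longleftrightarrow>
     (if f < M then p = f \<and> E' = E
      else (\<forall>j. 1 \<le> j \<and> j \<le> M \<longrightarrow> (j \<le> p \<longleftrightarrow> int f < cl (y (t j)) + int j)) \<and>
        (\<forall>m\<in>E. m < f - p) \<and> E' = insert (f - p) E)"

definition move :: "nat \<Rightarrow> nat \<Rightarrow> (nat \<Rightarrow> int) \<Rightarrow> nat set \<Rightarrow> (nat \<Rightarrow> int) \<Rightarrow> nat set \<Rightarrow> bool" where
  "move f L y E y' E' \<longleftrightarrow> (\<exists>M t p. is_top K (band y L) M t \<and> p < M \<and>
     y' = rot_up (t ` {1..p}) y \<and> moves_by f M t p y E E')"

lemma admissible_good:
  assumes a: "admissible f L y E" and t: "is_top K (band y L) M t"
  shows "good f M t y E"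
proof -
  obtain M' t' where t': "is_top K (band y L) M' t'" "good f M' t' y E" using a unfolding admissible_def by blast
  have M: "M' = M" using is_top_count_unique[OF _ t t'(1)] a unfolding admissible_def config_def by blast
  have "t' j = t j" if "1 \<le> j" "j \<le> M" for j using is_top_unique[OF t t'(1)[unfolded M] K_pos that] .
  then show ?thesis using t'(2) M unfolding good_def by auto
qed

lemma rot_up_ge:
  assumes sp: "spread y L" and S: "apart S" "\<And>s. s \<in> S \<Longrightarrow> band y L s"
  shows "y i \<le> rot_up S y i"
proof (cases S i rule: rot_up_cases)
  case outside
  have "rot_up S y i = y i" by (rule rot_up_outside) (rule outside)
  then show ?thesis by simp
next
  case (inner s)
  then show ?thesis using rot_up_inner[OF S(1) inner, of y] spread_mono[OF sp, of i "Suc i"] S(2)[OF inner(1)]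
    unfolding band_def by auto
next
  case (last s)
  then show ?thesis using rot_up_last[OF last(1), of y] not_far_dvd[of "y s"] S(2)[OF last(1)]
    unfolding band_def by auto
qed

text \<open>The last cluster overlaps the virtual band, so (5) holds for it automatically.\<close>

lemma even_level_last:
  assumes "config y L" "is_top K (band y L) M t"
  shows "even (level y (t M) - level y 0)"
  by (rule level_overlap[OF configD(2)[OF assms(1)] A configD(3)[OF assms(1)] config_band_0[OF assms(1)]])
    (use top_band[OF assms, of M] top_last[OF assms] in auto)

text \<open>Induction from the top: a mark below the first \<open>j\<close> clusters but above the
  next one would give \<open>f < cl (y (t (Suc j))) + int (Suc j) \<le> m + j \<le> f\<close>.
  Consequently all other marks are smaller than the one being inserted or removed.\<close>

lemma mark_above:
  assumes y: "config y L" and t: "is_top K (band y L) M t" and m: "compat y L m" "m \<le> f"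
    and le: "\<And>j. 1 \<le> j \<Longrightarrow> j \<le> M \<Longrightarrow> int m < cl (y (t j)) \<Longrightarrow> m + j \<le> f"
    and Q: "\<And>j. 1 \<le> j \<Longrightarrow> j \<le> p \<Longrightarrow> int f < cl (y (t j)) + int j" and p: "p \<le> M"
    and j: "1 \<le> j" "j \<le> p"
  shows "int m < cl (y (t j))"
  using j
proof (induction j)
  case (Suc j)
  show ?case
  proof (rule ccontr)
    assume "\<not> ?thesis"
    then have lt: "cl (y (t (Suc j))) < int m"
      using compat_below[OF m(1) top_band[OF y t, of "Suc j"]] Suc.prems p by auto
    have "int f < cl (y (t (Suc j))) + int (Suc j)" using Q Suc.prems by blast
    moreover have "m + j \<le> f"
      using le[of j] Suc p m(2) by (cases "j = 0") auto
    ultimately show False using lt by simp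
  qed
qed simp

lemma after_rot_up:
  assumes y: "config y L" and t: "is_top K (band y L) M t" and b: "is_bot K (band y L) M b" and p: "p < M"
  defines "y' \<equiv> rot_up (t ` {1..p}) y"
  shows "config y' L" "is_bot K (band y' L) M (\<lambda>j. if j \<le> p then t j else b j)"
    "\<And>i. (1 \<le> p \<Longrightarrow> i < t p) \<Longrightarrow> y' i = y i" "\<And>i. y i \<le> y' i" "\<And>j. p < j \<Longrightarrow> j \<le> M \<Longrightarrow> y' (b j) = y (b j)"
proof -
  show "config y' L" unfolding y'_def by (rule config_rot_up[OF y t p])
  show "is_bot K (band y' L) M (\<lambda>j. if j \<le> p then t j else b j)"
    unfolding y'_def by (rule is_bot_rot_up[OF configD(2)[OF y] t b]) (use p in simp)
  have ap: "apart (t ` {1..p})" by (rule apart_image[OF is_topD(1)[OF t]]) (use p in simp)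
  show "y i \<le> y' i" for i
    unfolding y'_def by (rule rot_up_ge[OF configD(2)[OF y] ap]) (use top_band[OF y t] p in auto)
  show out: "y' i = y i" if "1 \<le> p \<Longrightarrow> i < t p" for i
    unfolding y'_def
  proof (rule rot_up_outside)
    fix s assume "s \<in> t ` {1..p}" "s \<le> i" "i < s + K"
    then obtain j where "1 \<le> j" "j \<le> p" "t j \<le> i" by auto
    then show False using separated_mono[OF is_topD(1)[OF t], of j p] p that by auto
  qed
  show "y' (b j) = y (b j)" if j: "p < j" "j \<le> M" for j
  proof (rule out)
    assume "1 \<le> p"
    then show "b j < t p" using match[OF y t b, of j] separatedD[OF is_topD(1)[OF t], of p j] j K_pos by auto
  qed
qed

text \<open>Levels below the rotated clusters do not change, while cluster \<open>f\<close> gains 1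
  and becomes odd. This violates \<open>good f\<close>, but \<open>good (Suc f)\<close> no longer
  looks at cluster \<open>f\<close>.\<close>

lemma admissible_rotate_clusters:
  assumes a: "admissible f L y E" and t: "is_top K (band y L) M t" and f: "1 \<le> f" "f < M"
  shows "admissible (Suc f) L (rot_up (t ` {1..f}) y) E" "\<not> admissible f L (rot_up (t ` {1..f}) y) E"
proof -
  let ?y = "rot_up (t ` {1..f}) y"
  have y: "config y L" and E: "\<And>m. m \<in> E \<Longrightarrow> 1 \<le> m \<and> compat y L m" using a unfolding admissible_def by auto
  have g: "good f M t y E" using admissible_good[OF a t] .
  have E0: "E = {}" using good_imp_empty[OF y t g E] f by auto
  obtain b where b: "is_bot K (band y L) M b" using bot_exists[OF configD(2)[OF y] t] .
  note up = after_rot_up[OF y t b f(2)]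
  let ?b = "\<lambda>j. if j \<le> f then t j else b j"
  obtain t' where t': "is_top K (band ?y L) M t'" using top_exists[OF configD(2)[OF up(1)] up(2)] .
  have ap: "apart (t ` {1..f})" by (rule apart_image[OF is_topD(1)[OF t]]) (use f in simp)
  have below: "level ?y i = level y i" if "i + K \<le> t f" for i
  proof (rule level_rot_up_below)
    fix s assume "s \<in> t ` {1..f}"
    then have "t f \<le> s" using separated_mono[OF is_topD(1)[OF t], of _ f] f by auto
    then show "i + K \<le> s" using that by simp
  qed
  have l0: "level ?y 0 = level y 0" using below top_ge[OF y t f] by simp
  \<comment> \<open>The new top clusters are not known explicitly; each overlaps a known bottom
    cluster and so shares its parity.\<close>
  have hyb: "even (level ?y (t' j) - level ?y (?b j))" if "1 \<le> j" "j \<le> M" for j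
    using even_level_match[OF up(1) t' up(2) that] .
  have gt: "even (level ?y (t' j) - level ?y 0)" if j: "f < j" "j \<le> M" for j
  proof -
    have "b j + K \<le> t f" using match[OF y t b, of j] separatedD[OF is_topD(1)[OF t] f(1) j] j by auto
    then have "level ?y (b j) = level y (b j)" by (rule below)
    moreover have "even (level y (t j) - level y (b j))" using even_level_match[OF y t b] j by auto
    moreover have "even (level y (t j) - level y 0)" using g j unfolding good_def by auto
    moreover have "even (level ?y (t' j) - level ?y (b j))" using hyb[of j] j by auto
    ultimately show ?thesis using l0 by simp
  qed
  have "level ?y (t f) = level y (t f) + 1" by (rule level_rot_up[OF ap]) (use f in auto)
  moreover have "even (level y (t f) - level y 0)" using g f unfolding good_def by auto
  moreover have "even (level ?y (t' f) - level ?y (t f))" using hyb[of f] f by auto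
  ultimately have eq: "odd (level ?y (t' f) - level ?y 0)" using l0 by simp
  have "good (Suc f) M t' ?y {}" unfolding good_def using gt by auto
  then show "admissible (Suc f) L ?y E" unfolding admissible_def E0 using up(1) t' by blast
  show "\<not> admissible f L ?y E"
  proof
    assume "admissible f L ?y E"
    then show False using admissible_good[OF _ t'] eq f unfolding good_def by auto
  qed
qed

lemma admissible_insert_mark:
  assumes a: "admissible f L y E" and t: "is_top K (band y L) M t" and f: "M \<le> f"
  shows "\<exists>y' E'. move f L y E y' E' \<and> admissible (Suc f) L y' E' \<and> \<not> admissible f L y' E'"
proof -
  have y: "config y L" and E: "\<And>m. m \<in> E \<Longrightarrow> 1 \<le> m \<and> compat y L m" and fin: "finite E"
    using a unfolding admissible_def by auto
  have g: "good f M t y E" using admissible_good[OF a t] .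
  \<comment> \<open>The first cluster too low to be rotated. With \<open>p = j0 - 1\<close> the mark
    \<open>f - p\<close> lies strictly above the ceiling of cluster \<open>p + 1\<close> and, if
    \<open>p\<close> is positive, strictly below that of cluster \<open>p\<close>.\<close>
  define j0 where "j0 = (LEAST j. 1 \<le> j \<and> \<not> int f < cl (y (t j)) + int j)"
  have QM: "1 \<le> M \<and> \<not> int f < cl (y (t M)) + int M" using cl_top_last[OF y t] top_last[OF y t] f by auto
  then have j0: "1 \<le> j0" "\<not> int f < cl (y (t j0)) + int j0" "j0 \<le> M"
    using LeastI[of "\<lambda>j. 1 \<le> j \<and> \<not> int f < cl (y (t j)) + int j" M]
      Least_le[of "\<lambda>j. 1 \<le> j \<and> \<not> int f < cl (y (t j)) + int j" M] unfolding j0_def by auto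
  have j0min: "int f < cl (y (t j)) + int j" if "1 \<le> j" "j < j0" for j
    using not_less_Least[of j "\<lambda>j. 1 \<le> j \<and> \<not> int f < cl (y (t j)) + int j"] that unfolding j0_def by auto
  define p where "p = j0 - 1"
  have p: "p < M" "p < f" "j0 = Suc p" using j0 f unfolding p_def by auto
  have Q: "j \<le> p \<longleftrightarrow> int f < cl (y (t j)) + int j" if "1 \<le> j" "j \<le> M" for j
    using j0min[of j] cl_top_gap[OF y t, of j0 j] j0 that p by (cases "j < j0") auto
  define m where "m = f - p"
  have m: "1 \<le> m" "m + p = f" using p unfolding m_def by auto
  have bp: "int m < cl (y (t p))" if "1 \<le> p" using Q[of p] that p m by auto
  have bp1: "cl (y (t j)) < int m" if "p < j" "j \<le> M" for j
    using cl_top_gap[OF y t, of "Suc p" j] that j0 p m by auto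
  have Em: "m' < m" if "m' \<in> E" for m'
  proof (cases "p = 0")
    case True
    then show ?thesis using g that m unfolding good_def by auto
  next
    case False
    have gm: "m' < f" "\<And>j. 1 \<le> j \<Longrightarrow> j \<le> M \<Longrightarrow> int m' < cl (y (t j)) \<Longrightarrow> m' + j < f"
      using g that unfolding good_def by auto
    have "int m' < cl (y (t p))"
    proof (rule mark_above[OF y t, of m' f p])
      show "compat y L m'" using E[OF that] by simp
      show "m' \<le> f" using gm(1) by simp
      show "m' + j \<le> f" if "1 \<le> j" "j \<le> M" "int m' < cl (y (t j))" for j
        using gm(2)[OF that] by simp
      show "int f < cl (y (t j)) + int j" if "1 \<le> j" "j \<le> p" for j using Q[of j] that p by simp
    qed (use p False in auto)
    then show ?thesis using gm(2)[of p] False p m by auto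
  qed
  obtain b where b: "is_bot K (band y L) M b" using bot_exists[OF configD(2)[OF y] t] .
  let ?y = "rot_up (t ` {1..p}) y"
  note up = after_rot_up[OF y t b p(1)]
  let ?b = "\<lambda>j. if j \<le> p then t j else b j"
  obtain t' where t': "is_top K (band ?y L) M t'" using top_exists[OF configD(2)[OF up(1)] up(2)] .
  have ap: "apart (t ` {1..p})" by (rule apart_image[OF is_topD(1)[OF t]]) (use p in simp)
  have sp': "spread ?y L" using configD(2)[OF up(1)] .
  have high: "int m < cl (?y i)" if "1 \<le> p" "t p \<le> i" "i < L" for i
  proof -
    have "y (t p) \<le> ?y i" using spread_mono[OF configD(2)[OF y] that(2,3)] up(4)[of i] by simp
    then show ?thesis using bp[OF that(1)] cl_mono by force
  qed
  have cm: "compat ?y L m"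
    unfolding compat_def
  proof (intro allI impI)
    fix i assume i: "band ?y L i"
    show "int m + 1 < cl (?y (i + K - 1)) \<or> cl (?y i) < int m"
    proof (cases "1 \<le> p \<and> t p \<le> i")
      case True
      \<comment> \<open>A window starting at \<open>t p\<close> or later ends no lower than the
        raised entry \<open>y (t p) + P\<close>, so it clears the mark.\<close>
      have "?y (t p + K - 1) = y (t p) + P" by (rule rot_up_last) (use True in auto)
      moreover have "?y (t p + K - 1) \<le> ?y (i + K - 1)"
        by (rule spread_mono[OF sp']) (use True i K_pos in \<open>auto simp: band_def\<close>)
      ultimately have "cl (y (t p)) + 1 \<le> cl (?y (i + K - 1))" using cl_mono by fastforce
      then show ?thesis using bp True by auto
    next
      case False
      then have yi: "?y i = y i" using up(3)[of i] by auto
      have iK: "i + K \<le> t p" if p1: "1 \<le> p"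
      proof (rule ccontr)
        assume n: "\<not> i + K \<le> t p"
        have tp: "band y L (t p)" using top_band[OF y t p1] p by simp
        have "?y (i + K - 1) = y (Suc (i + K - 1))"
          by (rule rot_up_inner[OF ap, of "t p"]) (use n False p1 K_pos in auto)
        moreover have "far (y i) (y (i + K))"
          using spread_far[OF configD(2)[OF y]] tp False p1 unfolding band_def by auto
        ultimately show False using i yi K_pos unfolding band_def by auto
      qed
      have "?y (i + K - 1) = y (i + K - 1)" by (rule up(3)) (use iK K_pos in auto)
      then have B: "band y L i" using i yi unfolding band_def by simp
      obtain j where j: "1 \<le> j" "j \<le> M" "i \<le> t j" "t j < i + K" using is_topD(3)[OF t B] by blast
      have "p < j"
      proof (rule ccontr)
        assume "\<not> p < j"
        then have "t p \<le> t j" "1 \<le> p" using separated_mono[OF is_topD(1)[OF t] j(1), of p] j p by auto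
        then show False using iK j by auto
      qed
      then have "cl (y (t j)) < int m" using bp1 j by simp
      moreover have "t j < L" using top_band[OF y t j(1,2)] K_pos unfolding band_def by auto
      then have "cl (y i) \<le> cl (y (t j))" using cl_mono[OF spread_mono[OF configD(2)[OF y] j(3)]] by simp
      ultimately show ?thesis using yi by simp
    qed
  qed
  have cE: "compat ?y L m'" if "m' \<in> E" for m'
  proof (cases "p = 0")
    case True
    then show ?thesis using E[OF that] by simp
  next
    case False
    show ?thesis
      by (rule compat_transfer[of "t p", OF _ _ _ Em[OF that]]) (use up(3) high E[OF that] False in auto)
  qed
  have side: "int m1 < cl (y (t j)) \<and> int m1 < cl (y (b j))"
    if "p < j" "j \<le> M" "compat ?y L m1" "int m1 < cl (?y (t' j))" for j m1
  proof -
    have j1: "1 \<le> j" using that by simp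
    have "int m1 < cl (?y (b j))"
      using compat_side[OF sp' that(3) bot_band[OF up(1) t' up(2) j1 that(2)] top_band[OF up(1) t' j1 that(2)]]
        match[OF up(1) t' up(2) j1 that(2)] that by auto
    then have "int m1 < cl (y (b j))" using up(5) that by simp
    moreover have "t j < L" using top_band[OF y t j1 that(2)] K_pos unfolding band_def by auto
    then have "cl (y (b j)) \<le> cl (y (t j))"
      using cl_mono[OF spread_mono[OF configD(2)[OF y] match(1)[OF y t b j1 that(2)]]] by simp
    ultimately show ?thesis by simp
  qed
  have "good (Suc f) M t' ?y (insert m E)"
    unfolding good_def
  proof (intro conjI allI ballI impI)
    fix j assume "1 \<le> j \<and> j \<le> M \<and> Suc f \<le> j"
    then show "even (level ?y (t' j) - level ?y 0)" using f by simp
  next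
    fix m1 assume m1: "m1 \<in> insert m E"
    then have m1m: "m1 \<le> m" using Em by (auto intro: less_imp_le)
    then show "m1 < Suc f" using m by simp
    fix j assume j: "1 \<le> j \<and> j \<le> M \<and> int m1 < cl (?y (t' j))"
    show "m1 + j < Suc f"
    proof (cases "j \<le> p")
      case True
      then show ?thesis using m1m m by simp
    next
      case False
      have "compat ?y L m1" using m1 cm cE by auto
      then have s: "int m1 < cl (y (t j))" using side[of j m1] j False by simp
      then have "m1 \<noteq> m" using bp1[of j] False j by auto
      then have "m1 + j < f" using m1 g s j unfolding good_def by auto
      then show ?thesis by simp
    qed
  qed
  then have admissible': "admissible (Suc f) L ?y (insert m E)"
    unfolding admissible_def using up(1) fin m(1) cm cE E t' by blast
  \<comment> \<open>The new mark has rank at least \<open>f\<close>: if \<open>p = 0\<close> then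
    \<open>m = f\<close>, and otherwise cluster \<open>p\<close> still lies above
    \<open>m\<close>.\<close>
  have "\<not> admissible f L ?y (insert m E)"
  proof
    assume "admissible f L ?y (insert m E)"
    then have gf: "m < f" "\<And>j. 1 \<le> j \<Longrightarrow> j \<le> M \<Longrightarrow> int m < cl (?y (t' j)) \<Longrightarrow> m + j < f"
      using admissible_good[OF _ t'] unfolding good_def by auto
    have p1: "1 \<le> p" using gf(1) m by simp
    have "t p \<le> t' p" using match(1)[OF up(1) t' up(2) p1] p by auto
    moreover have "t' p < L" using top_band[OF up(1) t' p1] p K_pos unfolding band_def by auto
    ultimately show False using gf(2)[OF p1] high[OF p1] p m by auto
  qed
  moreover have "move f L y E ?y (insert m E)"
    unfolding move_def moves_by_def using t p(1) Q Em f m_def by (intro exI[of _ M] exI[of _ t] exI[of _ p]) auto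
  ultimately show ?thesis using admissible' by blast
qed

lemma move_up:
  assumes a: "admissible f L y E" and f: "1 \<le> f"
  shows "\<exists>y' E'. move f L y E y' E' \<and> admissible (Suc f) L y' E' \<and> \<not> admissible f L y' E'"
proof -
  obtain M t where t: "is_top K (band y L) M t" using a unfolding admissible_def by blast
  show ?thesis
  proof (cases "f < M")
    case True
    have "move f L y E (rot_up (t ` {1..f}) y) E" unfolding move_def moves_by_def using t True by auto
    then show ?thesis using admissible_rotate_clusters[OF a t f True] by blast
  next
    case False
    then show ?thesis using admissible_insert_mark[OF a t] by simp
  qed
qed

end

text \<open>A bijection given as a relation, which suits \<open>move\<close>, since that depends on
  the existence of a suitable selection.\<close>

lemma card_eq_relation:
  assumes "\<And>u. u \<in> X \<Longrightarrow> \<exists>v\<in>Y. R u v" and "\<And>v. v \<in> Y \<Longrightarrow> \<exists>u\<in>X. R u v"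
    and "\<And>u u' v. u \<in> X \<Longrightarrow> u' \<in> X \<Longrightarrow> R u v \<Longrightarrow> R u' v \<Longrightarrow> u = u'"
    and "\<And>u v v'. u \<in> X \<Longrightarrow> R u v \<Longrightarrow> R u v' \<Longrightarrow> v = v'"
  shows "card X = card Y"
proof -
  have "\<forall>u\<in>X. \<exists>v. v \<in> Y \<and> R u v" using assms(1) by blast
  from bchoice[OF this] obtain h where h: "\<forall>u\<in>X. h u \<in> Y \<and> R u (h u)" by blast
  have "inj_on h X"
  proof (rule inj_onI)
    fix u u' assume u: "u \<in> X" "u' \<in> X" "h u = h u'"
    then have "R u (h u)" "R u' (h u)" using h by auto
    then show "u = u'" by (rule assms(3)[OF u(1,2)])
  qed
  moreover have "h ` X = Y"
  proof
    show "h ` X \<subseteq> Y" using h by auto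
    show "Y \<subseteq> h ` X"
    proof
      fix v assume "v \<in> Y"
      from assms(2)[OF this] obtain u where u: "u \<in> X" "R u v" by (elim bexE)
      then have "R u (h u)" using h by auto
      then have "v = h u" by (rule assms(4)[OF u])
      then show "v \<in> h ` X" using u by simp
    qed
  qed
  ultimately show ?thesis using card_image[of h X] by simp
qed

context overpartition_system begin

section \<open>Removing the part, and injectivity of the move\<close>

lemma after_rot_down:
  assumes y: "config y L" and t: "is_top K (band y L) M t" and b: "is_bot K (band y L) M b" and p: "p < M"
    and u1: "\<forall>i. 1 \<le> p \<and> band y L i \<and> i < b p \<longrightarrow> \<not> b p < i + K"
    and u2: "1 \<le> p \<and> band y L (b p - K) \<longrightarrow> far (y (b p - K)) (y (b p + K - 1) - P)"
  defines "y' \<equiv> rot_down (b ` {1..p}) y" and "t' \<equiv> \<lambda>j. if j \<le> p then b j else t j"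
  shows "config y' L" "is_top K (band y' L) M t'" "rot_up (t' ` {1..p}) y' = y"
    "\<And>i. (1 \<le> p \<Longrightarrow> i < b p) \<Longrightarrow> y' i = y i" "\<And>j. 1 \<le> j \<Longrightarrow> j \<le> p \<Longrightarrow> y' (b j) = y (b j + K - 1) - P"
    "\<And>j. p < j \<Longrightarrow> j \<le> M \<Longrightarrow> y' (t j) = y (t j)"
proof -
  have sb: "separated K M b" using is_botD(1)[OF b] .
  show c: "config y' L" unfolding y'_def by (rule config_rot_down[OF y t b p]) (use u1 u2 in auto)
  show t': "is_top K (band y' L) M t'"
    unfolding y'_def t'_def by (rule is_top_rot_down[OF configD(2)[OF y] t b]) (use p u1 in auto)
  have ap: "apart (b ` {1..p})" by (rule apart_image[OF sb]) (use p in simp)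
  have "t' ` {1..p} = b ` {1..p}" unfolding t'_def by auto
  then show "rot_up (t' ` {1..p}) y' = y" unfolding y'_def using rot_up_down[OF ap] by simp
  show out: "y' i = y i" if "1 \<le> p \<Longrightarrow> i < b p" for i
    unfolding y'_def
  proof (rule rot_down_outside)
    fix s assume "s \<in> b ` {1..p}" "s \<le> i" "i < s + K"
    then obtain j where "1 \<le> j" "j \<le> p" "b j \<le> i" by auto
    then show False using separated_mono[OF sb, of j p] p that by auto
  qed
  show "y' (b j) = y (b j + K - 1) - P" if "1 \<le> j" "j \<le> p" for j
    unfolding y'_def by (rule rot_down_first) (use that in auto)
  show "y' (t j) = y (t j)" if j: "p < j" "j \<le> M" for j
  proof (rule out)
    assume "1 \<le> p"
    then show "t j < b p" using separatedD[OF is_topD(1)[OF t'], of p j] j K_pos unfolding t'_def by auto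
  qed
qed

text \<open>That \<open>good (Suc f)\<close> holds and \<open>good f\<close> fails means that
  cluster \<open>f\<close> is odd and all lower ones are even. Bands of different parity neither
  overlap nor satisfy the hypotheses of \<open>level_near\<close>; these are the two conditions for
  rotating down.\<close>

lemma admissible_unrotate_clusters:
  assumes a: "admissible (Suc f) L y E" and na: "\<not> admissible f L y E" and t: "is_top K (band y L) M t"
    and f: "1 \<le> f" "f < M"
  shows "\<exists>z. move f L z E y E \<and> admissible f L z E"
proof -
  have y: "config y L" and E: "\<And>m. m \<in> E \<Longrightarrow> 1 \<le> m \<and> compat y L m" using a unfolding admissible_def by auto
  have g: "good (Suc f) M t y E" using admissible_good[OF a t] .
  have E0: "E = {}" using good_imp_empty[OF y t g E] f by auto
  have gt: "even (level y (t j) - level y 0)" if "f < j" "j \<le> M" for j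
    using g that unfolding good_def by auto
  have "\<not> good f M t y E" using na a t unfolding admissible_def by blast
  then obtain j where j: "1 \<le> j" "j \<le> M" "f \<le> j" "odd (level y (t j) - level y 0)"
    unfolding good_def E0 by auto
  then have "j = f" using gt[of j] by (cases "j = f") auto
  then have of: "odd (level y (t f) - level y 0)" using j by simp
  obtain b where b: "is_bot K (band y L) M b" using bot_exists[OF configD(2)[OF y] t] .
  have sb: "separated K M b" using is_botD(1)[OF b] .
  have lev_b: "even (level y (b j) - level y 0)" if "f < j" "j \<le> M" for j
    using even_level_match[OF y t b, of j] gt[OF that] that by auto
  have lev_bf: "odd (level y (b f) - level y 0)"
    using even_level_match[OF y t b, of f] of f by auto
  have low: "even (level y i - level y 0)" if i: "band y L i" "i < b f" for i
  proof -
    obtain j where j: "1 \<le> j" "j \<le> M" "b j \<le> i" "i < b j + K" using is_botD(3)[OF b i(1)] by blast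
    have "f < j" using separated_mono[OF sb j(1), of f] i j f by (metis le_trans linorder_not_le less_imp_le)
    then show ?thesis
      using level_overlap[OF configD(2)[OF y] A configD(3)[OF y] bot_band[OF y t b j(1,2)] i(1) j(3,4)] lev_b[of j] j by auto
  qed
  have bfK: "K \<le> b f" using bot_ge[OF y t b f] .
  have u1: False if "band y L i" "i < b f" "b f < i + K" for i
    using level_overlap[OF configD(2)[OF y] A configD(3)[OF y] that(1) bot_band[OF y t b f(1)]]
      low[OF that(1,2)] lev_bf that f by auto
  have u2: "far (y (b f - K)) (y (b f + K - 1) - P)" if B: "band y L (b f - K)"
  proof (rule ccontr)
    assume n: "\<not> far (y (b f - K)) (y (b f + K - 1) - P)"
    \<comment> \<open>Here \<open>d = K\<close>, and a difference of \<open>2 * int K\<close> would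
      preserve the parity.\<close>
    have "level y (b f - K + K) = level y (b f - K) + 2 * int K"
      by (rule level_near[OF configD(2)[OF y] A configD(3)[OF y] B])
        (use bfK n bot_band[OF y t b f(1)] f in auto)
    then show False using low[OF B] lev_bf bfK K_pos by auto
  qed
  let ?z = "rot_down (b ` {1..f}) y"
  let ?t = "\<lambda>j. if j \<le> f then b j else t j"
  have u: "\<forall>i. 1 \<le> f \<and> band y L i \<and> i < b f \<longrightarrow> \<not> b f < i + K"
    "1 \<le> f \<and> band y L (b f - K) \<longrightarrow> far (y (b f - K)) (y (b f + K - 1) - P)"
    using u1 u2 by auto
  note dn = after_rot_down[OF y t b f(2) u]
  have img: "?t ` {1..f} = b ` {1..f}" by auto
  have ap: "apart (b ` {1..f})" by (rule apart_image[OF sb]) (use f in simp)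
  have below: "level y i = level ?z i" if "i + K \<le> b f" for i
  proof -
    have "level (rot_up (b ` {1..f}) ?z) i = level ?z i"
    proof (rule level_rot_up_below)
      fix s assume "s \<in> b ` {1..f}"
      then have "b f \<le> s" using separated_mono[OF sb, of _ f] f by auto
      then show "i + K \<le> s" using that by simp
    qed
    then show ?thesis using rot_up_down[OF ap] by simp
  qed
  have l0: "level y 0 = level ?z 0" using below bfK by simp
  have "level (rot_up (b ` {1..f}) ?z) (b f) = level ?z (b f) + 1"
    by (rule level_rot_up[OF ap]) (use f in auto)
  then have lf: "level y (b f) = level ?z (b f) + 1" using rot_up_down[OF ap] by simp
  have "good f M ?t ?z {}"
    unfolding good_def
  proof (intro conjI allI impI ballI)
    fix j assume j: "1 \<le> j \<and> j \<le> M \<and> f \<le> j"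
    show "even (level ?z (?t j) - level ?z 0)"
    proof (cases "j = f")
      case True
      then show ?thesis using lf lev_bf l0 by simp
    next
      case False
      then have "t j + K \<le> b f" using separatedD[OF is_topD(1)[OF dn(2)] f(1), of j] j by auto
      then show ?thesis using below[of "t j"] gt[of j] l0 j False by auto
    qed
  qed auto
  then have "admissible f L ?z E" unfolding admissible_def E0 using dn(1,2) by blast
  moreover have "move f L ?z E y E"
    unfolding move_def moves_by_def using dn(2,3) f by (intro exI[of _ M] exI[of _ ?t] exI[of _ f]) auto
  ultimately show ?thesis by blast
qed

text \<open>Here the two conditions for rotating down come from the mark instead of the parity: it
  separates the \<open>p\<close> clusters above it from every lower band and leaves enough room
  between them.\<close>

lemma admissible_remove_mark:
  assumes a: "admissible (Suc f) L y E" and na: "\<not> admissible f L y E" and t: "is_top K (band y L) M t"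
    and f: "M \<le> f"
  shows "\<exists>z F. move f L z F y E \<and> admissible f L z F"
proof -
  have y: "config y L" and E: "\<And>m. m \<in> E \<Longrightarrow> 1 \<le> m \<and> compat y L m" and fin: "finite E"
    using a unfolding admissible_def by auto
  have g: "good (Suc f) M t y E" using admissible_good[OF a t] .
  have g1: "m \<le> f" if "m \<in> E" for m using g that unfolding good_def by auto
  have g2: "m + j \<le> f" if "m \<in> E" "1 \<le> j" "j \<le> M" "int m < cl (y (t j))" for m j
    using g that unfolding good_def by (meson less_Suc_eq_le)
  have M1: "1 \<le> M" using top_last[OF y t] by simp
  have par: "even (level y (t j) - level y 0)" if "j \<le> M" "f \<le> j" for j
    using even_level_last[OF y t] that f by (metis le_antisym le_trans)
  have "\<not> good f M t y E" using na a t unfolding admissible_def by blast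
  \<comment> \<open>Parity cannot be what fails, since only cluster \<open>M\<close> can have an
    index of at least \<open>f\<close>. So the failure comes from a mark of rank
    \<open>f\<close>.\<close>
  then obtain m where m: "m \<in> E" "m = f \<or> (\<exists>j. 1 \<le> j \<and> j \<le> M \<and> int m < cl (y (t j)) \<and> m + j = f)"
    using par g1 g2 unfolding good_def by (metis le_antisym linorder_not_le order_le_less)
  define p where "p = f - m"
  have mp: "m + p = f" using g1[OF m(1)] unfolding p_def by simp
  have m1: "1 \<le> m" and cm: "compat y L m" using E[OF m(1)] by auto
  have p: "p < M" and bp: "1 \<le> p \<Longrightarrow> int m < cl (y (t p))"
  proof -
    have "p < M \<and> (1 \<le> p \<longrightarrow> int m < cl (y (t p)))"
    proof (cases "p = 0")
      case True
      then show ?thesis using M1 by simp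
    next
      case False
      then obtain j where j: "1 \<le> j" "j \<le> M" "int m < cl (y (t j))" "m + j = f" using m mp by auto
      then have "p = j" using mp by simp
      moreover have "j \<noteq> M" using cl_top_last[OF y t] j(3) m1 by auto
      ultimately show ?thesis using j by auto
    qed
    then show "p < M" "1 \<le> p \<Longrightarrow> int m < cl (y (t p))" by auto
  qed
  have low: "cl (y (t j)) < int m" if "p < j" "j \<le> M" for j
  proof -
    have "\<not> int m < cl (y (t j))" using g2[OF m(1), of j] that mp by auto
    then show ?thesis using compat_below[OF cm top_band[OF y t]] that by auto
  qed
  have Q: "int f < cl (y (t j)) + int j" if "1 \<le> j" "j \<le> p" for j
    using cl_top_gap[OF y t that] bp that p mp by auto
  have Q': "cl (y (t j)) + int j \<le> int f" if "p < j" "j \<le> M" for j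
    using cl_top_gap[OF y t, of "Suc p" j] low[of "Suc p"] that p mp by auto
  have Em: "m' < m" if m': "m' \<in> E - {m}" for m'
  proof (cases "p = 0")
    case True
    then show ?thesis using g1[of m'] m' mp by auto
  next
    case False
    have "int m' < cl (y (t p))"
    proof (rule mark_above[OF y t, of m' f p])
      show "compat y L m'" "m' \<le> f" using E g1 m' by auto
      show "m' + j \<le> f" if "1 \<le> j" "j \<le> M" "int m' < cl (y (t j))" for j
        using g2[of m' j] that m' by simp
    qed (use Q p False in auto)
    then show ?thesis using g2[of m' p] False p mp m' by auto
  qed
  obtain b where b: "is_bot K (band y L) M b" using bot_exists[OF configD(2)[OF y] t] .
  have sb: "separated K M b" using is_botD(1)[OF b] .
  have side: "int m < cl (y (b j)) \<longleftrightarrow> int m < cl (y (t j))" if "1 \<le> j" "j \<le> M" for j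
    using compat_side[OF configD(2)[OF y] cm bot_band[OF y t b that] top_band[OF y t that]] match[OF y t b that] by auto
  have above: "int m < cl (y (b j))" if "1 \<le> j" "j \<le> p" for j
    using side[of j] Q[OF that] that p bp cl_top_gap[OF y t that] by auto
  have below: "\<not> int m < cl (y i)" if i: "band y L i" "i < b p" "1 \<le> p" for i
  proof -
    obtain j where j: "1 \<le> j" "j \<le> M" "b j \<le> i" "i < b j + K" using is_botD(3)[OF b i(1)] by blast
    have "p < j" using separated_mono[OF sb j(1), of p] i j p by (metis le_trans linorder_not_le less_imp_le)
    then have "\<not> int m < cl (y (b j))" using side[of j] low[of j] j by auto
    then show ?thesis
      using compat_side[OF configD(2)[OF y] cm bot_band[OF y t b j(1,2)] i(1) j(3,4)] by simp
  qed
  have u1: False if "1 \<le> p" "band y L i" "i < b p" "b p < i + K" for i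
    using compat_side[OF configD(2)[OF y] cm that(2) bot_band[OF y t b that(1)]] below[OF that(2,3,1)]
      above[of p] that p by auto
  have u2: "far (y (b p - K)) (y (b p + K - 1) - P)" if p1: "1 \<le> p" and B: "band y L (b p - K)"
  proof -
    have "K \<le> b p" using bot_ge[OF y t b p1 p] .
    then have "cl (y (b p - K)) < int m"
      using compat_below[OF cm B below[OF B _ p1]] K_pos by auto
    \<comment> \<open>With the bound \<open>(int m + 1) * P\<close> for the upper entry this leaves
      a gap of more than \<open>2 * P\<close>.\<close>
    then have 1: "y (b p - K) \<le> (int m - 1) * P" using cl_le[of "y (b p - K)" "int m - 1"] by simp
    have "int m + 1 < cl (y (b p + K - 1))"
      using compat_above[OF cm bot_band[OF y t b p1] above[OF p1]] p by auto
    then have "(int m + 1) * P < y (b p + K - 1)" using less_cl by simp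
    then show ?thesis using 1 by (intro farI) (simp add: algebra_simps)
  qed
  let ?z = "rot_down (b ` {1..p}) y"
  let ?t = "\<lambda>j. if j \<le> p then b j else t j"
  have u: "\<forall>i. 1 \<le> p \<and> band y L i \<and> i < b p \<longrightarrow> \<not> b p < i + K"
    "1 \<le> p \<and> band y L (b p - K) \<longrightarrow> far (y (b p - K)) (y (b p + K - 1) - P)"
    using u1 u2 by auto
  note dn = after_rot_down[OF y t b p u]
  have zb: "int m < cl (?z (b j))" if "1 \<le> j" "j \<le> p" for j
    using compat_above[OF cm bot_band[OF y t b that(1)] above[OF that]] dn(5)[OF that] that p by simp
  have Qz: "j \<le> p \<longleftrightarrow> int f < cl (?z (?t j)) + int j" if j: "1 \<le> j" "j \<le> M" for j
  proof (cases "j \<le> p")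
    case True
    then have "int m < cl (?z (?t p))" using zb[of p] j by simp
    then show ?thesis using cl_top_gap[OF dn(1,2) j(1) True] p mp True by auto
  next
    case False
    then show ?thesis using Q'[of j] dn(6)[of j] j by auto
  qed
  have cz: "compat ?z L m'" if m': "m' \<in> E - {m}" for m'
  proof (cases "p = 0")
    case True
    then show ?thesis using E m' by simp
  next
    case False
    then have p1: "1 \<le> p" by simp
    show ?thesis
    proof (rule compat_transfer[of "b p", OF _ _ _ Em[OF m']])
      show "?z i = y i" if "i < b p" for i using dn(4) that by simp
      show "int m < cl (?z i)" if i: "b p \<le> i" "i < L" for i
        using cl_mono[OF spread_mono[OF configD(2)[OF dn(1)] i]] zb[OF p1] by force
      show "compat y L m'" using E m' by simp
    qed
  qed
  have "good f M ?t ?z (E - {m})"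
    unfolding good_def
  proof (intro conjI allI ballI impI)
    fix j assume "1 \<le> j \<and> j \<le> M \<and> f \<le> j"
    then have j: "j = M" using f by simp
    show "even (level ?z (?t j) - level ?z 0)" unfolding j using even_level_last[OF dn(1,2)] .
  next
    fix m' assume m': "m' \<in> E - {m}"
    then show "m' < f" using Em[OF m'] mp by simp
    fix j assume j: "1 \<le> j \<and> j \<le> M \<and> int m' < cl (?z (?t j))"
    show "m' + j < f"
    proof (cases "j \<le> p")
      case True
      then show ?thesis using Em[OF m'] mp by simp
    next
      case False
      then show ?thesis using Q'[of j] dn(6)[of j] j by auto
    qed
  qed
  then have "admissible f L ?z (E - {m})" unfolding admissible_def using dn(1,2) fin E cz by blast
  moreover have "move f L ?z (E - {m}) y E"
  proof -
    have "f - p = m" using mp by simp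
    then show ?thesis
      unfolding move_def moves_by_def using dn(2,3) p f Qz Em m(1)
      by (intro exI[of _ M] exI[of _ ?t] exI[of _ p]) (auto simp del: One_nat_def)
  qed
  ultimately show ?thesis by blast
qed

lemma move_down:
  assumes a: "admissible (Suc f) L y E" and na: "\<not> admissible f L y E" and f: "1 \<le> f"
  shows "\<exists>z F. move f L z F y E \<and> admissible f L z F"
proof -
  obtain M t where t: "is_top K (band y L) M t" using a unfolding admissible_def by blast
  show ?thesis
    using admissible_unrotate_clusters[OF a na t f] admissible_remove_mark[OF a na t] by (cases "f < M") auto
qed

text \<open>Everything is read off the image. The inserted mark is the largest element of
  \<open>E\<close> and determines \<open>p\<close>, while for rotations \<open>p = f\<close>. The
  rotated clusters are the top \<open>p\<close> clusters of the bottom selection of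
  \<open>y\<close>, which is unique.\<close>

lemma move_inj:
  assumes m1: "move f L y1 E1 y E" and m2: "move f L y2 E2 y E" and y1: "config y1 L" and y2: "config y2 L"
  shows "y1 = y2 \<and> E1 = E2"
proof -
  obtain M1 t1 p1 where 1: "is_top K (band y1 L) M1 t1" "p1 < M1" "y = rot_up (t1 ` {1..p1}) y1"
    "moves_by f M1 t1 p1 y1 E1 E" using m1 unfolding move_def by blast
  obtain M2 t2 p2 where 2: "is_top K (band y2 L) M2 t2" "p2 < M2" "y = rot_up (t2 ` {1..p2}) y2"
    "moves_by f M2 t2 p2 y2 E2 E" using m2 unfolding move_def by blast
  obtain b1 where b1: "is_bot K (band y1 L) M1 b1" using bot_exists[OF configD(2)[OF y1] 1(1)] .
  obtain b2 where b2: "is_bot K (band y2 L) M2 b2" using bot_exists[OF configD(2)[OF y2] 2(1)] .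
  note u1 = after_rot_up[OF y1 1(1) b1 1(2), folded 1(3)]
  note u2 = after_rot_up[OF y2 2(1) b2 2(2), folded 2(3)]
  obtain t' where "is_top K (band y L) M1 t'" using top_exists[OF configD(2)[OF u1(1)] u1(2)] .
  then have M: "M2 = M1" using top_bot_match(1)[OF _ u2(2) K_pos] by blast
  have pE: "p1 = p2 \<and> E1 = E2"
  proof (cases "f < M1")
    case True
    then show ?thesis using 1(4) 2(4) M unfolding moves_by_def by auto
  next
    case False
    then have e1: "\<forall>m\<in>E1. m < f - p1" "E = insert (f - p1) E1" and e2: "\<forall>m\<in>E2. m < f - p2" "E = insert (f - p2) E2"
      using 1(4) 2(4) M unfolding moves_by_def by auto
    have "f - p1 \<in> insert (f - p2) E2" "f - p2 \<in> insert (f - p1) E1" using e1(2) e2(2) by auto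
    then have eq: "f - p1 = f - p2" using e1(1) e2(1) by force
    then have "p1 = p2" using 1(2) 2(2) M False by linarith
    moreover have "E1 = E - {f - p1}" "E2 = E - {f - p2}" using e1 e2 by auto
    ultimately show ?thesis by simp
  qed
  have "t1 j = t2 j" if "j \<in> {1..p1}" for j
    using is_bot_unique[OF u1(2) u2(2)[unfolded M] K_pos, of j] that pE 1(2) by auto
  then have img: "t1 ` {1..p1} = t2 ` {1..p2}" using pE by auto
  have "apart (t1 ` {1..p1})" "apart (t2 ` {1..p2})"
    using apart_image[OF is_topD(1)[OF 1(1)], of p1] apart_image[OF is_topD(1)[OF 2(1)], of p2] 1(2) 2(2) by auto
  then have "y1 = rot_down (t1 ` {1..p1}) y" "y2 = rot_down (t2 ` {1..p2}) y"
    using rot_down_up 1(3) 2(3) by metis+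
  then show ?thesis using img pE by simp
qed

lemma move_fun:
  assumes m1: "move f L y E y1 E1" and m2: "move f L y E y2 E2" and y: "config y L"
  shows "y1 = y2 \<and> E1 = E2"
proof -
  obtain M1 t1 p1 where 1: "is_top K (band y L) M1 t1" "p1 < M1" "y1 = rot_up (t1 ` {1..p1}) y"
    "moves_by f M1 t1 p1 y E E1" using m1 unfolding move_def by blast
  obtain M2 t2 p2 where 2: "is_top K (band y L) M2 t2" "p2 < M2" "y2 = rot_up (t2 ` {1..p2}) y"
    "moves_by f M2 t2 p2 y E E2" using m2 unfolding move_def by blast
  have M: "M2 = M1" using is_top_count_unique[OF configD(2)[OF y] 1(1) 2(1)] .
  have t: "t2 j = t1 j" if "1 \<le> j" "j \<le> M1" for j
    using is_top_unique[OF 1(1) 2(1)[unfolded M] K_pos that] .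
  have p: "p1 = p2"
  proof (cases "f < M1")
    case True
    then show ?thesis using 1(4) 2(4) M unfolding moves_by_def by auto
  next
    case False
    then have "j \<le> p1 \<longleftrightarrow> j \<le> p2" if "1 \<le> j" "j \<le> M1" for j
      using 1(4) 2(4) M t[OF that] that unfolding moves_by_def by auto
    from this[of p1] this[of p2] show ?thesis using 1(2) 2(2) M by (cases "p1 = 0"; cases "p2 = 0") auto
  qed
  moreover have "t2 ` {1..p2} = t1 ` {1..p1}" by (rule image_cong) (use p t 1(2) in auto)
  ultimately show ?thesis using 1(3,4) 2(3,4) M unfolding moves_by_def by (cases "f < M1") auto
qed

section \<open>Weights and the recursion in \<open>f\<close>\<close>

definition weight :: "nat \<Rightarrow> (nat \<Rightarrow> int) \<Rightarrow> nat set \<Rightarrow> int" where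
  "weight L y E = (\<Sum>i<L. y i) + P * (\<Sum>m\<in>E. int m)"

text \<open>Rotating \<open>p\<close> clusters adds \<open>p\<close> units of \<open>P\<close>, and
  the mark \<open>f - p\<close>, if any, supplies the rest.\<close>

lemma move_weight:
  assumes m: "move f L y E y' E'" and y: "config y L" and E: "finite E"
  shows "weight L y' E' = weight L y E + P * int f"
proof -
  obtain M t p where 1: "is_top K (band y L) M t" "p < M" "y' = rot_up (t ` {1..p}) y"
    "moves_by f M t p y E E'" using m unfolding move_def by blast
  have ap: "apart (t ` {1..p})" by (rule apart_image[OF is_topD(1)[OF 1(1)]]) (use 1(2) in simp)
  have bL: "s + K \<le> L" if "s \<in> t ` {1..p}" for s using that top_band[OF y 1(1)] 1(2) unfolding band_def by auto
  have "inj_on t {1..p}"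
  proof (rule linorder_inj_onI)
    fix i j assume "i < j" "i \<in> {1..p}" "j \<in> {1..p}"
    then have "t j + K \<le> t i" using separatedD[OF is_topD(1)[OF 1(1)], of i j] 1(2) by auto
    then show "t i \<noteq> t j" using K_pos by simp
  qed auto
  then have card: "card (t ` {1..p}) = p" by (simp add: card_image)
  have "(\<Sum>i<L. y' i) = (\<Sum>i<L. y i) + P * int (card {s \<in> t ` {1..p}. s + K \<le> L})"
    unfolding 1(3) by (rule sum_rot_up[of "\<lambda>x. x", OF _ ap]) (use bL in \<open>force+\<close>)
  moreover have "{s \<in> t ` {1..p}. s + K \<le> L} = t ` {1..p}" using bL by blast
  ultimately have s: "(\<Sum>i<L. y' i) = (\<Sum>i<L. y i) + P * int p" using card by simp
  show ?thesis
  proof (cases "f < M")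
    case True
    then show ?thesis using 1(4) s unfolding weight_def moves_by_def by auto
  next
    case False
    then have e: "\<forall>m\<in>E. m < f - p" "E' = insert (f - p) E" using 1(4) unfolding moves_by_def by auto
    then have "(\<Sum>m\<in>E'. int m) = int (f - p) + (\<Sum>m\<in>E. int m)" using E by (subst e(2)) (subst sum.insert, auto)
    then have "P * (int p + (\<Sum>m\<in>E'. int m)) = P * (int f + (\<Sum>m\<in>E. int m))"
      using False 1(2) by (simp add: of_nat_diff)
    then show ?thesis using s unfolding weight_def by (simp add: distrib_left)
  qed
qed

definition states :: "nat \<Rightarrow> int \<Rightarrow> (nat \<times> (nat \<Rightarrow> int) \<times> nat set) set" where
  "states f n = {(L, y, E). admissible f L y E \<and> weight L y E = n}"

lemma good_mono: "good f M t y E \<Longrightarrow> good (Suc f) M t y E"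
  unfolding good_def by (auto simp: less_SucI)

lemma admissible_mono: "admissible f L y E \<Longrightarrow> admissible (Suc f) L y E"
  unfolding admissible_def using good_mono by blast

text \<open>\<open>move\<close> maps the states of weight \<open>n - P * int f\<close> bijectively
  onto those of weight \<open>n\<close> that are admissible for \<open>Suc f\<close> but not for
  \<open>f\<close>.\<close>

lemma card_states_Suc:
  assumes f: "1 \<le> f" and fin: "finite (states f (n - P * int f))" "finite (states (Suc f) n)"
  shows "card (states (Suc f) n) = card (states f n) + card (states f (n - P * int f))"
proof -
  let ?X = "states f (n - P * int f)" and ?Y = "states (Suc f) n - states f n"
  let ?R = "\<lambda>(L, y, E) (L', y', E'). L' = L \<and> move f L y E y' E'"
  have up: "\<exists>v\<in>?Y. ?R u v" if u: "u \<in> ?X" for u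
  proof -
    obtain L y E where uu: "u = (L, y, E)" "admissible f L y E" "weight L y E = n - P * int f"
      using u unfolding states_def by auto
    obtain y' E' where m: "move f L y E y' E'" "admissible (Suc f) L y' E'" "\<not> admissible f L y' E'"
      using move_up[OF uu(2) f] by blast
    have "weight L y' E' = n"
      using move_weight[OF m(1)] uu unfolding admissible_def by auto
    then have "(L, y', E') \<in> ?Y" using m unfolding states_def by auto
    then show ?thesis using m uu by blast
  qed
  have down: "\<exists>u\<in>?X. ?R u v" if v: "v \<in> ?Y" for v
  proof -
    obtain L y E where vv: "v = (L, y, E)" "admissible (Suc f) L y E" "\<not> admissible f L y E" "weight L y E = n"
      using v unfolding states_def by auto
    obtain z F where m: "move f L z F y E" "admissible f L z F" using move_down[OF vv(2,3) f] by blast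
    have "weight L y E = weight L z F + P * int f"
      using move_weight[OF m(1)] m(2) unfolding admissible_def by auto
    then have "(L, z, F) \<in> ?X" using m vv unfolding states_def by auto
    then show ?thesis using m vv by blast
  qed
  have inj: "u = u'" if u: "u \<in> ?X" "u' \<in> ?X" "?R u v" "?R u' v" for u u' v
  proof -
    obtain L y E where 1: "u = (L, y, E)" "admissible f L y E" using u(1) unfolding states_def by auto
    obtain L' y' E' where 2: "u' = (L', y', E')" "admissible f L' y' E'" using u(2) unfolding states_def by auto
    obtain L1 z F where 3: "v = (L1, z, F)" by (cases v) auto
    have "L1 = L" "move f L y E z F" "L1 = L'" "move f L' y' E' z F" using u(3,4) 1 2 3 by auto
    then show "u = u'" using move_inj[of f L y E z F y' E'] 1 2 unfolding admissible_def by auto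
  qed
  have func: "v = v'" if u: "u \<in> ?X" "?R u v" "?R u v'" for u v v'
  proof -
    obtain L y E where 1: "u = (L, y, E)" "admissible f L y E" using u(1) unfolding states_def by auto
    obtain L1 z F where 2: "v = (L1, z, F)" by (cases v) auto
    obtain L2 z' F' where 3: "v' = (L2, z', F')" by (cases v') auto
    have "L1 = L" "move f L y E z F" "L2 = L" "move f L y E z' F'" using u(2,3) 1 2 3 by auto
    then show "v = v'" using move_fun[of f L y E z F z' F'] 1 2 3 unfolding admissible_def by auto
  qed
  have "card ?X = card ?Y" by (rule card_eq_relation[where R = ?R, OF up down inj func])
  moreover have sub: "states f n \<subseteq> states (Suc f) n" unfolding states_def using admissible_mono by auto
  moreover have "card ?Y = card (states (Suc f) n) - card (states f n)"
    by (rule card_Diff_subset[OF finite_subset[OF sub fin(2)] sub])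
  moreover have "card (states f n) \<le> card (states (Suc f) n)" by (rule card_mono[OF fin(2) sub])
  ultimately show ?thesis by linarith
qed

section \<open>Lists of parts in place of sequences, and the two extreme values of
  \<open>f\<close>\<close>

definition ext :: "nat list \<Rightarrow> nat \<Rightarrow> int" where
  "ext xs i = (if i < K then base i else if i < K + length xs then int (xs ! (i - K)) else 0)"

definition list_states :: "nat \<Rightarrow> nat \<Rightarrow> (nat list \<times> nat set) set" where
  "list_states f n = {(xs, E). admissible f (K + length xs) (ext xs) E \<and>
     int (sum_list xs) + P * (\<Sum>m\<in>E. int m) = int n}"

lemma ext_nth: "i < length xs \<Longrightarrow> ext xs (K + i) = int (xs ! i)"
  unfolding ext_def by simp

lemma ext_base: "i < K \<Longrightarrow> ext xs i = base i"
  unfolding ext_def by simp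

lemma ext_inj:
  assumes "ext xs = ext ys" "length xs = length ys" shows "xs = ys"
proof (rule nth_equalityI[OF assms(2)])
  fix i assume "i < length xs"
  then show "xs ! i = ys ! i" using ext_nth[of i xs] ext_nth[of i ys] assms by simp
qed

lemma config_ext:
  assumes y: "config y L"
  shows "\<exists>xs. L = K + length xs \<and> y = ext xs"
proof (intro exI conjI)
  let ?xs = "map (\<lambda>i. nat (y i)) [K..<L]"
  show L: "L = K + length ?xs" using configD(1)[OF y] by simp
  show "y = ext ?xs"
  proof
    fix i
    show "y i = ext ?xs i"
      using configD(1)[OF y] configD(4)[OF y, of i] configD(5)[OF y, of i] config_pos[OF y, of i] unfolding ext_def
      by (cases "i < K") auto
  qed
qed

lemma sum_base: "(\<Sum>i<K. base i) = - P * int c"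
proof -
  have "(\<Sum>i<K. base i) = (\<Sum>i\<in>{..<c}. - P)"
    by (rule sum.mono_neutral_cong_right) (use c in \<open>auto simp: base_def\<close>)
  then show ?thesis by (simp add: mult.commute)
qed

lemma weight_ext: "weight (K + length xs) (ext xs) E = int (sum_list xs) + P * (\<Sum>m\<in>E. int m) - P * int c"
proof -
  have "(\<Sum>i<K + length xs. ext xs i) = (\<Sum>i<K. ext xs i) + (\<Sum>i\<in>{K..<K + length xs}. ext xs i)"
    using sum.atLeastLessThan_concat[of 0 K "K + length xs" "ext xs"] by (simp add: lessThan_atLeast0)
  also have "(\<Sum>i<K. ext xs i) = (\<Sum>i<K. base i)" by (rule sum.cong) (auto simp: ext_base)
  also have "(\<Sum>i\<in>{K..<K + length xs}. ext xs i) = (\<Sum>i\<in>{0..<length xs}. ext xs (i + K))"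
    using sum.shift_bounds_nat_ivl[of "ext xs" 0 K "length xs"] by (simp add: add.commute)
  also have "\<dots> = (\<Sum>i\<in>{0..<length xs}. int (xs ! i))"
    by (rule sum.cong) (auto simp: ext_def)
  also have "\<dots> = int (sum_list xs)" by (simp add: sum_list_sum_nth)
  finally show ?thesis unfolding weight_def sum_base by simp
qed

lemma states_eq_image:
  "states f (int n - P * int c) = (\<lambda>(xs, E). (K + length xs, ext xs, E)) ` list_states f n"
proof
  show "(\<lambda>(xs, E). (K + length xs, ext xs, E)) ` list_states f n \<subseteq> states f (int n - P * int c)"
    unfolding list_states_def states_def by (auto simp: weight_ext)
  show "states f (int n - P * int c) \<subseteq> (\<lambda>(xs, E). (K + length xs, ext xs, E)) ` list_states f n"
  proof
    fix u assume "u \<in> states f (int n - P * int c)"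
    then obtain L y E where u: "u = (L, y, E)" "admissible f L y E" "weight L y E = int n - P * int c"
      unfolding states_def by auto
    then obtain xs where xs: "L = K + length xs" "y = ext xs" using config_ext[of y L] unfolding admissible_def by blast
    then have "(xs, E) \<in> list_states f n" using u weight_ext[of xs E] unfolding list_states_def by auto
    then show "u \<in> (\<lambda>(xs, E). (K + length xs, ext xs, E)) ` list_states f n" using u xs by force
  qed
qed

lemma card_list_states: "card (list_states f n) = card (states f (int n - P * int c))"
proof -
  have "inj_on (\<lambda>(xs, E). (K + length xs, ext xs, E)) (list_states f n)"
    by (rule inj_onI) (use ext_inj in auto)
  then show ?thesis unfolding states_eq_image by (simp add: card_image)
qed

lemma finite_states: "finite (list_states f n) \<Longrightarrow> finite (states f (int n - P * int c))"
  unfolding states_eq_image by simp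

text \<open>Only the \<open>c\<close> virtual parts of value \<open>- P\<close> count negatively.
  This covers the coefficients whose degree is too small for the part \<open>f\<close>.\<close>

lemma states_empty:
  assumes "w < - P * int c" shows "states f w = {}"
proof (rule ccontr)
  assume "states f w \<noteq> {}"
  then obtain L y E where u: "admissible f L y E" "weight L y E = w" unfolding states_def by auto
  then obtain xs where "L = K + length xs" "y = ext xs" using config_ext[of y L] unfolding admissible_def by blast
  then have "w = int (sum_list xs) + P * (\<Sum>m\<in>E. int m) - P * int c" using u weight_ext by simp
  moreover have "0 \<le> P * (\<Sum>m\<in>E. int m)" using P_pos by (simp add: sum_nonneg)
  ultimately show False using assms by simp
qed

lemma card_list_states_Suc:
  assumes f: "1 \<le> f" and fin: "\<And>n. finite (list_states f n)" "\<And>n. finite (list_states (Suc f) n)"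
  shows "card (list_states (Suc f) n) =
    card (list_states f n) + (if P * int f \<le> int n then card (list_states f (nat (int n - P * int f))) else 0)"
proof -
  let ?w = "int n - P * int c"
  have fw: "finite (states f (?w - P * int f))"
    "card (states f (?w - P * int f)) = (if P * int f \<le> int n then card (list_states f (nat (int n - P * int f))) else 0)"
  proof -
    consider "P * int f \<le> int n" | "\<not> P * int f \<le> int n" by blast
    then have "finite (states f (?w - P * int f)) \<and>
      card (states f (?w - P * int f)) = (if P * int f \<le> int n then card (list_states f (nat (int n - P * int f))) else 0)"
    proof cases
      case 1
      then have e: "?w - P * int f = int (nat (int n - P * int f)) - P * int c" by simp
      show ?thesis
        using finite_states[OF fin(1), of "nat (int n - P * int f)"]
          card_list_states[of f "nat (int n - P * int f)"] 1 unfolding e by simp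
    next
      case 2
      then show ?thesis using states_empty[of "?w - P * int f"] by simp
    qed
    then show "finite (states f (?w - P * int f))"
      "card (states f (?w - P * int f)) = (if P * int f \<le> int n then card (list_states f (nat (int n - P * int f))) else 0)"
      by auto
  qed
  show ?thesis
    using card_states_Suc[OF f fw(1) finite_states[OF fin(2)]] fw(2) unfolding card_list_states by simp
qed

text \<open>
  In a configuration of size \<open>n\<close> the ranks \<open>m + j\<close> and the relevant cluster indices are at most
  \<open>n\<close>, so \<open>good\<close> imposes nothing once \<open>f > n\<close>.
\<close>

lemma good_large:
  assumes y: "config (ext xs) (K + length xs)" and t: "is_top K (band (ext xs) (K + length xs)) M t"
    and E: "finite E" "\<And>m. m \<in> E \<Longrightarrow> 1 \<le> m"
    and n: "int (sum_list xs) + P * (\<Sum>m\<in>E. int m) = int n" "n < f"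
  shows "good f M t (ext xs) E"
proof -
  let ?y = "ext xs" and ?L = "K + length xs"
  have P1: "x \<le> P * x" if "0 \<le> x" for x using P_pos that by (simp add: mult_le_cancel_right1)
  have Esum: "0 \<le> P * (\<Sum>m\<in>E. int m)" using P_pos by (simp add: sum_nonneg)
  have Em: "P * int m \<le> P * (\<Sum>m\<in>E. int m)" if "m \<in> E" for m
    using P_pos member_le_sum[OF that _ E(1), of int] by simp
  have part: "?y i \<le> int (sum_list xs)" if i: "K \<le> i" "i < ?L" for i
    using member_le_sum_list[of "xs ! (i - K)" xs] ext_nth[of "i - K" xs] i by auto
  have top: "P * (cl (?y (t 1)) - 1) < int (sum_list xs)" if "1 < M"
  proof -
    have "t 1 < ?L" using top_band[OF y t, of 1] that K_pos unfolding band_def by auto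
    then have "?y (t 1) \<le> int (sum_list xs)" using part top_ge[OF y t, of 1] that by auto
    moreover have "(cl (?y (t 1)) - 1) * P < ?y (t 1)" using less_cl[of "cl (?y (t 1)) - 1" "?y (t 1)"] by simp
    ultimately show ?thesis by (simp add: mult.commute)
  qed
  show ?thesis
    unfolding good_def
  proof (intro conjI allI ballI impI)
    fix j assume j: "1 \<le> j \<and> j \<le> M \<and> f \<le> j"
    show "even (level ?y (t j) - level ?y 0)"
    proof (cases "j = M")
      case True
      then show ?thesis using even_level_last[OF y t] by simp
    next
      case False
      then have M: "1 < M" using j by simp
      then have "int M - 1 \<le> cl (?y (t 1))" using cl_top_ge[OF y t, of 1] by simp
      then have c2: "int M - 2 \<le> cl (?y (t 1)) - 1" by simp
      then have "int M - 2 \<le> P * (cl (?y (t 1)) - 1)" using P1[of "cl (?y (t 1)) - 1"] M by simp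
      then have "int M - 2 < int n" using top[OF M] n Esum by simp
      then show ?thesis using j False n(2) by simp
    qed
  next
    fix m assume m: "m \<in> E"
    have "int m \<le> P * int m" using P1 by simp
    then have mn: "int m \<le> int n" using Em[OF m] n(1) by linarith
    then show "m < f" using n(2) by simp
    fix j assume j: "1 \<le> j \<and> j \<le> M \<and> int m < cl (?y (t j))"
    have "j \<noteq> M" using cl_top_last[OF y t] j by auto
    then have M: "1 < M" using j by simp
    have "int m + int j \<le> cl (?y (t 1))" using cl_top_gap[OF y t, of 1 j] j by simp
    then have "int m + int j - 1 \<le> cl (?y (t 1)) - 1" "0 \<le> cl (?y (t 1)) - 1" using E(2)[OF m] j by auto
    then have "int m + int j - 1 < int (sum_list xs)" using P1[of "cl (?y (t 1)) - 1"] top[OF M] by linarith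
    then show "m + j < f" using Em[OF m] \<open>int m \<le> P * int m\<close> n E(2)[OF m] by linarith
  qed
qed

lemma list_states_large:
  assumes "n < f"
  shows "list_states f n = {(xs, E). config (ext xs) (K + length xs) \<and> finite E \<and>
    (\<forall>m\<in>E. 1 \<le> m \<and> compat (ext xs) (K + length xs) m) \<and>
    int (sum_list xs) + P * (\<Sum>m\<in>E. int m) = int n}"
proof -
  have "admissible f (K + length xs) (ext xs) E"
    if a: "config (ext xs) (K + length xs)" "finite E"
      "\<forall>m\<in>E. 1 \<le> m \<and> compat (ext xs) (K + length xs) m"
      "int (sum_list xs) + P * (\<Sum>m\<in>E. int m) = int n" for xs E
  proof -
    obtain M t where t: "is_top K (band (ext xs) (K + length xs)) M t"
      using is_top_exists[OF finite_band[OF configD(2)[OF a(1)]] K_pos] by blast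
    have "good f M t (ext xs) E" by (rule good_large[OF a(1) t a(2) _ a(4) assms]) (use a(3) in blast)
    then show ?thesis using a t unfolding admissible_def by blast
  qed
  then show ?thesis unfolding list_states_def admissible_def by blast
qed

text \<open>For \<open>f = 1\<close> a mark would need \<open>1 \<le> m < 1\<close>, and every band
  has the parity of the cluster that blocks it, so (5) for the clusters is (5) for all
  bands.\<close>

lemma list_states_1:
  "list_states 1 n = {(xs, E). E = {} \<and> config (ext xs) (K + length xs) \<and>
    (\<forall>i. band (ext xs) (K + length xs) i \<longrightarrow> even (level (ext xs) i - level (ext xs) 0)) \<and> sum_list xs = n}"
proof -
  have "admissible 1 L y E \<longleftrightarrow> E = {} \<and> config y L \<and> (\<forall>i. band y L i \<longrightarrow> even (level y i - level y 0))" for L y E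
  proof
    assume a: "admissible 1 L y E"
    then obtain M t where t: "is_top K (band y L) M t" and g: "good 1 M t y E" and y: "config y L"
      unfolding admissible_def by blast
    have "E = {}" using a g unfolding admissible_def good_def by fastforce
    moreover have "even (level y i - level y 0)" if i: "band y L i" for i
    proof -
      obtain j where j: "1 \<le> j" "j \<le> M" "i \<le> t j" "t j < i + K" using is_topD(3)[OF t i] by blast
      have "even (level y (t j) - level y i)"
        by (rule level_overlap[OF configD(2)[OF y] A configD(3)[OF y] i top_band[OF y t j(1,2)] j(3,4)])
      moreover have "even (level y (t j) - level y 0)" using g j unfolding good_def by auto
      ultimately show ?thesis by simp
    qed
    ultimately show "E = {} \<and> config y L \<and> (\<forall>i. band y L i \<longrightarrow> even (level y i - level y 0))" using y by blast
  next
    assume a: "E = {} \<and> config y L \<and> (\<forall>i. band y L i \<longrightarrow> even (level y i - level y 0))"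
    then obtain M t where t: "is_top K (band y L) M t"
      using is_top_exists[OF finite_band[OF configD(2)] K_pos] by blast
    then have "good 1 M t y E" using a is_topD(2)[OF t] unfolding good_def by auto
    then show "admissible 1 L y E" using a t unfolding admissible_def by blast
  qed
  then show ?thesis unfolding list_states_def by auto
qed

lemma admissible_mono_le: "f \<le> f' \<Longrightarrow> admissible f L y E \<Longrightarrow> admissible f' L y E"
  by (induction f' rule: dec_induct) (auto intro: admissible_mono)

lemma list_states_mono: "f \<le> f' \<Longrightarrow> list_states f n \<subseteq> list_states f' n"
  unfolding list_states_def using admissible_mono_le by auto

end

section \<open>Partitions and overpartitions as configurations\<close>

text \<open>Partitions are decreasing lists, whereas configurations increase; spacing conditions are
  transported by reversing the indices.\<close>

lemma all_rev_nth:
  "(\<forall>i. i + d < length xs \<longrightarrow> Q (rev xs ! i) (rev xs ! (i + d))) \<longleftrightarrow>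
   (\<forall>j. j + d < length xs \<longrightarrow> Q (xs ! (j + d)) (xs ! j))"
proof (intro iffI allI impI)
  fix j assume a: "\<forall>i. i + d < length xs \<longrightarrow> Q (rev xs ! i) (rev xs ! (i + d))" "j + d < length xs"
  obtain i where i: "i + j + d + 1 = length xs" using a(2) less_imp_Suc_add[OF a(2)] by auto
  then have "length xs - Suc i = j + d" "length xs - Suc (i + d) = j" by auto
  then have "rev xs ! i = xs ! (j + d)" "rev xs ! (i + d) = xs ! j"
    using rev_nth[of i xs] rev_nth[of "i + d" xs] i by auto
  then show "Q (xs ! (j + d)) (xs ! j)" using a(1)[rule_format, of i] i by simp
next
  fix i assume a: "\<forall>j. j + d < length xs \<longrightarrow> Q (xs ! (j + d)) (xs ! j)" "i + d < length xs"
  obtain j where j: "i + j + d + 1 = length xs" using a(2) less_imp_Suc_add[OF a(2)] by auto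
  then have "length xs - Suc i = j + d" "length xs - Suc (i + d) = j" by auto
  then have "rev xs ! i = xs ! (j + d)" "rev xs ! (i + d) = xs ! j"
    using rev_nth[of i xs] rev_nth[of "i + d" xs] j by auto
  then show "Q (rev xs ! i) (rev xs ! (i + d))" using a(1)[rule_format, of j] j by simp
qed

lemma sorted_count_le_1_iff:
  assumes s: "sorted xs"
  shows "(\<forall>x\<in>set xs. 1 < count_list xs x \<longrightarrow> Q x) \<longleftrightarrow>
    (\<forall>i. Suc i < length xs \<longrightarrow> \<not> Q (xs ! i) \<longrightarrow> xs ! i < xs ! Suc i)"
proof -
  have count: "count_list xs x = card {i. i < length xs \<and> xs ! i = x}" for x
    by (simp add: count_list_eq_length_filter length_filter_conv_card eq_commute)
  show ?thesis
  proof (intro iffI allI impI ballI)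
    fix i assume a: "\<forall>x\<in>set xs. 1 < count_list xs x \<longrightarrow> Q x" "Suc i < length xs" "\<not> Q (xs ! i)"
    show "xs ! i < xs ! Suc i"
    proof (rule ccontr)
      assume "\<not> ?thesis"
      then have "xs ! Suc i = xs ! i" using sorted_nth_mono[OF s, of i "Suc i"] a(2) by auto
      then have "{i, Suc i} \<subseteq> {j. j < length xs \<and> xs ! j = xs ! i}" using a(2) by auto
      then have "card {i, Suc i} \<le> count_list xs (xs ! i)" unfolding count by (intro card_mono) auto
      then show False using a by auto
    qed
  next
    fix x assume a: "\<forall>i. Suc i < length xs \<longrightarrow> \<not> Q (xs ! i) \<longrightarrow> xs ! i < xs ! Suc i"
      "x \<in> set xs" "1 < count_list xs x"
    obtain i j where ij: "i < j" "j < length xs" "xs ! i = x" "xs ! j = x"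
    proof -
      have "\<exists>i j. i \<in> {i. i < length xs \<and> xs ! i = x} \<and> j \<in> {i. i < length xs \<and> xs ! i = x} \<and> i \<noteq> j"
        using a(3) card_le_Suc0_iff_eq[of "{i. i < length xs \<and> xs ! i = x}"] unfolding count by auto
      then show ?thesis using that by (metis (mono_tags, lifting) linorder_neqE_nat mem_Collect_eq)
    qed
    have "xs ! Suc i \<le> xs ! j" using sorted_nth_mono[OF s, of "Suc i" j] ij by auto
    then show "Q x" using a(1) ij by (metis Suc_lessI Suc_lessD less_trans_Suc linorder_not_le)
  qed
qed

lemma sorted_card_le_iff:
  fixes xs :: "nat list"
  assumes s: "sorted xs"
  shows "card {i. i < length xs \<and> xs ! i \<le> e} \<le> c \<longleftrightarrow> (\<forall>i<length xs. c \<le> i \<longrightarrow> e < xs ! i)"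
proof (intro iffI allI impI)
  fix i assume a: "card {i. i < length xs \<and> xs ! i \<le> e} \<le> c" "i < length xs" "c \<le> i"
  show "e < xs ! i"
  proof (rule ccontr)
    assume n: "\<not> e < xs ! i"
    have "{..i} \<subseteq> {i. i < length xs \<and> xs ! i \<le> e}"
    proof
      fix j assume "j \<in> {..i}"
      then show "j \<in> {i. i < length xs \<and> xs ! i \<le> e}"
        using sorted_nth_mono[OF s, of j i] a(2) n by auto
    qed
    then have "card {..i} \<le> card {i. i < length xs \<and> xs ! i \<le> e}" by (intro card_mono) auto
    then show False using a by simp
  qed
next
  assume a: "\<forall>i<length xs. c \<le> i \<longrightarrow> e < xs ! i"
  have "{i. i < length xs \<and> xs ! i \<le> e} \<subseteq> {..<c}" using a by (auto simp: not_le[symmetric])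
  then show "card {i. i < length xs \<and> xs ! i \<le> e} \<le> c" using card_mono[of "{..<c}"] by fastforce
qed

lemma card_rev_nth: "card {i. i < length xs \<and> Q (rev xs ! i)} = card {i. i < length xs \<and> Q (xs ! i)}"
  using length_filter_conv_card[of Q "rev xs"] length_filter_conv_card[of Q xs] by (simp add: rev_filter[symmetric])

section \<open>Bressoud's partitions as configurations without marks, with \<open>K = k - 1\<close>
  and \<open>c = r - 1\<close>\<close>

locale bressoud_params =
  fixes K c \<eta> l :: nat and \<alpha> :: "nat \<Rightarrow> nat"
  assumes K_gt_0: "0 < K" and \<eta>_gt_0: "0 < \<eta>" and c_le_K: "c \<le> K" and l_le_K: "l \<le> K"
    and \<alpha>: "\<forall>i\<in>{1..l}. 0 < \<alpha> i \<and> \<alpha> i < \<eta>"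

sublocale bressoud_params \<subseteq> overpartition_system K "int \<eta>" "(\<lambda>t. int (\<alpha> t)) ` {1..l}" c
proof
  show "card ((\<lambda>t. int (\<alpha> t)) ` {1..l}) \<le> K" using card_image_le[of "{1..l}" "\<lambda>t. int (\<alpha> t)"] l_le_K by simp
qed (use K_gt_0 \<eta>_gt_0 c_le_K in auto)

context bressoud_params
begin

abbreviation over_set :: "nat \<Rightarrow> opart list set" where
  "over_set \<equiv> overB_set 1 l \<alpha> \<eta> (Suc K) (Suc c)"

abbreviation bressoud_set :: "nat \<Rightarrow> nat list set" where
  "bressoud_set \<equiv> bressoudB_set 0 l \<alpha> \<eta> (Suc K) (Suc c)"

definition residue_ok :: "nat \<Rightarrow> bool" where
  "residue_ok x \<longleftrightarrow> [x = 0] (mod \<eta>) \<or> (\<exists>t\<in>{1..l}. [x = \<alpha> t] (mod \<eta>))"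

definition list_config :: "nat list \<Rightarrow> bool" where
  "list_config xs \<longleftrightarrow> (\<forall>x\<in>set xs. 0 < x \<and> residue_ok x) \<and>
     (\<forall>i. Suc i < length xs \<longrightarrow> xs ! i \<le> xs ! Suc i \<and> (\<not> \<eta> dvd xs ! i \<longrightarrow> xs ! i < xs ! Suc i)) \<and>
     (\<forall>i. i + K < length xs \<longrightarrow> far (int (xs ! i)) (int (xs ! (i + K)))) \<and>
     (\<forall>i<length xs. c \<le> i \<longrightarrow> \<eta> < xs ! i)"

lemma residue_ok_iff: "residue_ok x \<longleftrightarrow> int \<eta> dvd int x \<or> int x mod int \<eta> \<in> (\<lambda>t. int (\<alpha> t)) ` {1..l}"
proof -
  have "[x = \<alpha> t] (mod \<eta>) \<longleftrightarrow> int x mod int \<eta> = int (\<alpha> t)" if "t \<in> {1..l}" for t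
    using \<alpha> that unfolding cong_def by (simp add: zmod_int[symmetric])
  then show ?thesis unfolding residue_ok_def by (auto simp: cong_0_iff)
qed

lemma far_int: "far (int x) (int z) \<longleftrightarrow> (if \<eta> dvd x then x + \<eta> < z else x + \<eta> \<le> z)"
  unfolding far_def by auto

lemma far_int': "far (int x) (int z) \<longleftrightarrow> (if \<eta> dvd z then x + \<eta> < z else x + \<eta> \<le> z)"
  unfolding far_int by (cases "z = x + \<eta>") auto

text \<open>Part \<open>i\<close> stands \<open>K\<close> places above the virtual part
  \<open>base i\<close> when \<open>i < K\<close>. Being far from \<open>- P\<close> means being
  positive, and being far from 0 means exceeding \<open>\<eta>\<close>; together this is condition
  (4).\<close>

lemma config_ext_iff: "config (ext xs) (K + length xs) \<longleftrightarrow> list_config xs"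
proof
  assume y: "config (ext xs) (K + length xs)"
  note sp = configD(2)[OF y]
  have pos: "0 < xs ! i" if "i < length xs" for i
    using config_pos[OF y, of "K + i"] ext_nth[of i xs] that by simp
  have res: "residue_ok (xs ! i)" if "i < length xs" for i
    using configD(3)[OF y] ext_nth[OF that] that unfolding residues_in_def residue_ok_iff
    by (metis nat_add_left_cancel_less)
  have srt: "xs ! i \<le> xs ! Suc i \<and> (\<not> \<eta> dvd xs ! i \<longrightarrow> xs ! i < xs ! Suc i)" if "Suc i < length xs" for i
    using spread_mono[OF sp, of "K + i" "K + Suc i"] spread_strict[OF sp, of "K + i" "K + Suc i"]
      ext_nth[of i xs] ext_nth[of "Suc i" xs] that by auto
  have far: "far (int (xs ! i)) (int (xs ! (i + K)))" if "i + K < length xs" for i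
    using spread_far[OF sp, of "K + i"] ext_nth[of i xs] ext_nth[of "i + K" xs] that by (simp add: add.assoc)
  have "\<eta> < xs ! i" if i: "i < length xs" "c \<le> i" for i
  proof -
    have "far (ext xs c) (ext xs (K + c))" using spread_far[OF sp, of c] i by (simp add: add.commute)
    moreover have "ext xs c = 0 \<or> 0 < ext xs c"
      using ext_base[of c xs] config_pos[OF y, of c] i unfolding base_def by (cases "c < K") auto
    ultimately have "int \<eta> < ext xs (K + c)" unfolding far_def by (auto split: if_splits)
    also have "\<dots> \<le> ext xs (K + i)" by (rule spread_mono[OF sp]) (use i in auto)
    finally show ?thesis using ext_nth[OF i(1)] by simp
  qed
  then show "list_config xs" unfolding list_config_def using pos res srt far by (auto simp: in_set_conv_nth)
next
  assume a: "list_config xs"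
  have e1: "ext xs i = int (xs ! (i - K))" if "K \<le> i" "i < K + length xs" for i using that unfolding ext_def by simp
  have dvd0: "int \<eta> dvd base i" for i unfolding base_def by simp
  have "spread (ext xs) (K + length xs)"
    unfolding spread_def
  proof (intro conjI allI impI)
    fix i assume i: "Suc i < K + length xs"
    have "ext xs i \<le> ext xs (Suc i) \<and> (\<not> int \<eta> dvd ext xs i \<longrightarrow> ext xs i < ext xs (Suc i))"
    proof (cases "Suc i < K")
      case True
      then show ?thesis using ext_base[of i xs] ext_base[of "Suc i" xs] dvd0[of i] by (auto simp: base_def)
    next
      case False
      show ?thesis
      proof (cases "i < K")
        case True
        have "0 < xs ! (Suc i - K)" using a False i unfolding list_config_def by (auto simp: in_set_conv_nth)
        then have "ext xs i < ext xs (Suc i)" using ext_base[OF True] e1[of "Suc i"] False i by (simp add: base_def)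
        then show ?thesis by simp
      next
        case F2: False
        then have "Suc i - K = Suc (i - K)" by simp
        moreover have "Suc (i - K) < length xs" using i F2 by linarith
        ultimately show ?thesis using a e1[of i] e1[of "Suc i"] i F2 unfolding list_config_def by auto
      qed
    qed
    then show "ext xs i \<le> ext xs (Suc i)" "\<not> int \<eta> dvd ext xs i \<Longrightarrow> ext xs i < ext xs (Suc i)" by auto
  next
    fix i assume i: "i + K < K + length xs"
    have e2: "ext xs (i + K) = int (xs ! i)" using e1[of "i + K"] i by simp
    show "far (ext xs i) (ext xs (i + K))"
    proof (cases "i < K")
      case True
      have "0 < xs ! i" "c \<le> i \<Longrightarrow> \<eta> < xs ! i" using a i unfolding list_config_def by (auto simp: in_set_conv_nth)
      then show ?thesis unfolding e2 using ext_base[OF True] by (auto simp: base_def far_def)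
    next
      case False
      then obtain j where j: "i = j + K" by (metis add.commute le_Suc_ex not_le)
      have "far (int (xs ! j)) (int (xs ! (j + K)))" using a i j unfolding list_config_def by auto
      then show ?thesis unfolding e2 using e1[of i] i j by simp
    qed
  qed
  moreover have "residues_in ((\<lambda>t. int (\<alpha> t)) ` {1..l}) (ext xs) (K + length xs)"
    unfolding residues_in_def
  proof (intro allI impI)
    fix i assume i: "i < K + length xs"
    show "int \<eta> dvd ext xs i \<or> ext xs i mod int \<eta> \<in> (\<lambda>t. int (\<alpha> t)) ` {1..l}"
    proof (cases "i < K")
      case True
      then show ?thesis using ext_base dvd0 by simp
    next
      case False
      then have "residue_ok (xs ! (i - K))" using a i unfolding list_config_def by simp
      then show ?thesis using e1[of i] i False unfolding residue_ok_iff by simp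
    qed
  qed
  ultimately show "config (ext xs) (K + length xs)" unfolding config_def by (auto simp: ext_def)
qed

lemma list_config_sorted: "list_config xs \<Longrightarrow> sorted xs"
  unfolding list_config_def sorted_iff_nth_Suc by blast

lemma band_ext: "band (ext xs) (K + length xs) (K + j) \<longleftrightarrow>
    j + K \<le> length xs \<and> \<not> far (int (xs ! j)) (int (xs ! (j + K - 1)))"
proof -
  have "K + j + K - 1 = K + (j + K - 1)" using K_gt_0 by simp
  then show ?thesis using ext_nth[of j xs] ext_nth[of "j + K - 1" xs] K_gt_0 unfolding band_def by auto
qed

text \<open>Ceilings exceed floors by one exactly at non-multiples, and the floors below the window
  cancel. What remains is the floor sum of the window and the number of non-multiples up to its end;
  the virtual band has level \<open>- c\<close>.\<close>

lemma level_ext: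
  assumes j: "j + K \<le> length xs"
  shows "level (ext xs) (K + j) - level (ext xs) 0 =
    (\<Sum>t\<in>{j..<j + K}. int (xs ! t div \<eta>)) + int (card {t. t < j + K \<and> \<not> \<eta> dvd xs ! t}) + int c"
proof -
  let ?y = "ext xs" and ?b = "\<lambda>x. if int \<eta> dvd x then 0 else 1 :: int"
  have split: "(\<Sum>t<a + b. h t) = (\<Sum>t<a. h t) + (\<Sum>t\<in>{a..<a + b}. h t)" for a b and h :: "nat \<Rightarrow> int"
    using sum.atLeastLessThan_concat[of 0 a "a + b" h] by (simp add: lessThan_atLeast0)
  have "level ?y (K + j) = (\<Sum>t<K + j + K. cl (?y t)) - (\<Sum>t<K + j. ?y t div int \<eta>)" unfolding level_def ..
  also have "(\<Sum>t<K + j + K. cl (?y t)) = (\<Sum>t<K + j + K. ?y t div int \<eta>) + (\<Sum>t<K + j + K. ?b (?y t))"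
    unfolding cl_eq sum.distrib ..
  also have "(\<Sum>t<K + j + K. ?y t div int \<eta>) = (\<Sum>t<K + j. ?y t div int \<eta>) + (\<Sum>t\<in>{K + j..<K + j + K}. ?y t div int \<eta>)"
    by (rule split)
  also have "(\<Sum>t\<in>{K + j..<K + j + K}. ?y t div int \<eta>) = (\<Sum>t\<in>{j..<j + K}. int (xs ! t div \<eta>))"
  proof -
    have "(\<Sum>t\<in>{K + j..<K + j + K}. ?y t div int \<eta>) = (\<Sum>t\<in>{j..<j + K}. ?y (t + K) div int \<eta>)"
      using sum.shift_bounds_nat_ivl[of "\<lambda>t. ?y t div int \<eta>" j K "j + K"] by (simp add: add.commute add.assoc)
    also have "\<dots> = (\<Sum>t\<in>{j..<j + K}. int (xs ! t div \<eta>))"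
      by (rule sum.cong) (use j in \<open>auto simp: ext_def zdiv_int\<close>)
    finally show ?thesis .
  qed
  also have "(\<Sum>t<K + j + K. ?b (?y t)) = int (card {t. t < j + K \<and> \<not> \<eta> dvd xs ! t})"
  proof -
    have "(\<Sum>t<K + (j + K). ?b (?y t)) = (\<Sum>t<K. ?b (?y t)) + (\<Sum>t\<in>{K..<K + (j + K)}. ?b (?y t))" by (rule split)
    also have "(\<Sum>t<K. ?b (?y t)) = 0" by (rule sum.neutral) (auto simp: ext_base base_def)
    also have "(\<Sum>t\<in>{K..<K + (j + K)}. ?b (?y t)) = (\<Sum>t\<in>{0..<j + K}. ?b (?y (t + K)))"
      using sum.shift_bounds_nat_ivl[of "\<lambda>t. ?b (?y t)" 0 K "j + K"] by (simp add: add.commute)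
    also have "\<dots> = (\<Sum>t\<in>{0..<j + K}. if \<not> \<eta> dvd xs ! t then 1 else 0)"
      by (rule sum.cong) (use j in \<open>auto simp: ext_def\<close>)
    also have "\<dots> = int (card ({0..<j + K} \<inter> {t. \<not> \<eta> dvd xs ! t}))" by (simp add: sum.If_cases)
    also have "{0..<j + K} \<inter> {t. \<not> \<eta> dvd xs ! t} = {t. t < j + K \<and> \<not> \<eta> dvd xs ! t}" by auto
    finally show ?thesis by (simp add: add.assoc)
  qed
  finally have "level ?y (K + j) = (\<Sum>t\<in>{j..<j + K}. int (xs ! t div \<eta>)) + int (card {t. t < j + K \<and> \<not> \<eta> dvd xs ! t})"
    by simp
  moreover have "level ?y 0 = - int c"
  proof -
    have dv: "- int \<eta> div int \<eta> = - 1" using nonzero_mult_div_cancel_right[of "int \<eta>" "- 1"] \<eta>_gt_0 by simp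
    have "level ?y 0 = (\<Sum>t<K. cl (base t))" unfolding level_def by (simp add: ext_base)
    also have "\<dots> = (\<Sum>t<K. base t div int \<eta>)" unfolding cl_eq by (rule sum.cong) (auto simp: base_def)
    also have "\<dots> = (\<Sum>t\<in>{..<c}. - 1)"
      by (rule sum.mono_neutral_cong_right) (use c_le_K dv in \<open>auto simp: base_def\<close>)
    finally show ?thesis by simp
  qed
  ultimately show ?thesis by simp
qed

lemma rev_in_bressoudB_set_iff:
  "rev xs \<in> bressoud_set n \<longleftrightarrow> (xs, {}) \<in> list_states 1 n"
proof (cases "sorted xs")
  case False
  then show ?thesis
    using list_config_sorted[of xs] unfolding list_states_1 bressoudB_set_def is_partition_def config_ext_iff
    by (auto simp: sorted_wrt_rev)
next
  case s: True
  let ?n = "length xs"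
  have c3: "(\<forall>i. i + K < ?n \<longrightarrow> (if \<eta> dvd rev xs ! i then rev xs ! i > rev xs ! (i + K) + \<eta>
       else rev xs ! i \<ge> rev xs ! (i + K) + \<eta>)) \<longleftrightarrow> (\<forall>i. i + K < ?n \<longrightarrow> far (int (xs ! i)) (int (xs ! (i + K))))"
    using all_rev_nth[of K xs "\<lambda>a b. if \<eta> dvd a then a > b + \<eta> else a \<ge> b + \<eta>"] unfolding far_int' by simp
  have c2: "(\<forall>x\<in>set xs. 1 < count_list (rev xs) x \<longrightarrow> \<eta> dvd x) \<longleftrightarrow>
      (\<forall>i. Suc i < ?n \<longrightarrow> \<not> \<eta> dvd xs ! i \<longrightarrow> xs ! i < xs ! Suc i)"
    using sorted_count_le_1_iff[OF s, of "\<lambda>x. \<eta> dvd x"] by simp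
  have c4: "int (card {i. i < ?n \<and> rev xs ! i \<le> \<eta>}) \<le> int (Suc c) - 1 \<longleftrightarrow> (\<forall>i<?n. c \<le> i \<longrightarrow> \<eta> < xs ! i)"
    using sorted_card_le_iff[OF s, of \<eta> c] card_rev_nth[of xs "\<lambda>x. x \<le> \<eta>"] by simp
  have srt: "\<forall>i. Suc i < ?n \<longrightarrow> xs ! i \<le> xs ! Suc i" using s by (simp add: sorted_iff_nth_Suc)
  have conf: "list_config xs \<longleftrightarrow> (\<forall>x\<in>set xs. 0 < x \<and> residue_ok x) \<and>
      (\<forall>x\<in>set xs. 1 < count_list (rev xs) x \<longrightarrow> \<eta> dvd x) \<and>
      (\<forall>i. i + K < ?n \<longrightarrow> (if \<eta> dvd rev xs ! i then rev xs ! i > rev xs ! (i + K) + \<eta>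
       else rev xs ! i \<ge> rev xs ! (i + K) + \<eta>)) \<and>
      int (card {i. i < ?n \<and> rev xs ! i \<le> \<eta>}) \<le> int (Suc c) - 1"
    unfolding c2 c3 c4 list_config_def using srt by blast
  let ?par = "\<lambda>i. [(\<Sum>t\<in>{i..<i + K}. int (rev xs ! t div \<eta>)) = int (Suc c) - 1 + int (bressoudV \<eta> (rev xs) (rev xs ! i))] (mod 2)"
  let ?near = "\<lambda>i. if \<eta> dvd rev xs ! i then rev xs ! i \<le> rev xs ! (i + K - 1) + \<eta>
      else rev xs ! i < rev xs ! (i + K - 1) + \<eta>"
  have bands: "(\<forall>i. band (ext xs) (K + ?n) i \<longrightarrow> even (level (ext xs) i - level (ext xs) 0)) \<longleftrightarrow>
      (\<forall>i. i + K - 1 < ?n \<longrightarrow> ?near i \<longrightarrow> ?par i)" if lc: "list_config xs"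
  proof -
    have y: "config (ext xs) (K + ?n)" using config_ext_iff lc by simp
    \<comment> \<open>Bands that start among the virtual parts overlap the virtual band and impose
      nothing.\<close>
    have low: "even (level (ext xs) i - level (ext xs) 0)" if "band (ext xs) (K + ?n) i" "i < K" for i
      by (rule level_overlap[OF configD(2)[OF y] A configD(3)[OF y] config_band_0[OF y] that(1)]) (use that in auto)
    \<comment> \<open>Position \<open>i\<close> of the decreasing list corresponds to the window of
      the increasing list that starts at \<open>j = length xs - K - i\<close>.\<close>
    have one: "(band (ext xs) (K + ?n) (K + j) \<longrightarrow> even (level (ext xs) (K + j) - level (ext xs) 0)) \<longleftrightarrow>
        (?near i \<longrightarrow> ?par i)" if ij: "i + j + K = ?n" for i j
    proof -
      have jK: "j + K \<le> ?n" using ij by simp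
      have r1: "rev xs ! i = xs ! (j + K - 1)" "rev xs ! (i + K - 1) = xs ! j"
        using ij K_gt_0 by (auto simp: rev_nth intro!: arg_cong[of _ _ "(!) xs"])
      have near: "band (ext xs) (K + ?n) (K + j) \<longleftrightarrow> ?near i"
        unfolding band_ext far_int' r1 using jK by auto
      have sum: "(\<Sum>t\<in>{i..<i + K}. int (rev xs ! t div \<eta>)) = (\<Sum>t\<in>{j..<j + K}. int (xs ! t div \<eta>))"
        by (rule sum.reindex_bij_witness[of _ "\<lambda>t. ?n - Suc t" "\<lambda>t. ?n - Suc t"])
          (use ij in \<open>auto simp: rev_nth\<close>)
      have V: "bressoudV \<eta> (rev xs) (rev xs ! i) = card {t. t < j + K \<and> \<not> \<eta> dvd xs ! t}"
      proof -
        have "bressoudV \<eta> (rev xs) (rev xs ! i) = card {t. t < ?n \<and> \<not> \<eta> dvd xs ! t \<and> xs ! t \<le> xs ! (j + K - 1)}"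
          using card_rev_nth[of xs "\<lambda>x. \<not> \<eta> dvd x \<and> x \<le> xs ! (j + K - 1)"] unfolding bressoudV_def r1 by simp
        also have "{t. t < ?n \<and> \<not> \<eta> dvd xs ! t \<and> xs ! t \<le> xs ! (j + K - 1)} = {t. t < j + K \<and> \<not> \<eta> dvd xs ! t}"
        proof -
          \<comment> \<open>Equal parts are multiples of \<open>\<eta>\<close>, so a non-multiple
            beyond the window strictly exceeds its last entry and is not counted.\<close>
          have "xs ! t \<le> xs ! (j + K - 1) \<longleftrightarrow> t < j + K" if t: "t < ?n" "\<not> \<eta> dvd xs ! t" for t
          proof (cases "t < j + K")
            case True
            then show ?thesis using sorted_nth_mono[OF s, of t "j + K - 1"] jK K_gt_0 by auto
          next
            case False
            have "ext xs (K + (j + K - 1)) < ext xs (K + t)"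
              by (rule spread_strict'[OF configD(2)[OF y]]) (use t False K_gt_0 ext_nth[of t xs] in auto)
            then show ?thesis using False ext_nth[of t xs] ext_nth[of "j + K - 1" xs] t jK K_gt_0 by auto
          qed
          then show ?thesis using jK by auto
        qed
        finally show ?thesis .
      qed
      have "?par i \<longleftrightarrow> even ((\<Sum>t\<in>{j..<j + K}. int (xs ! t div \<eta>)) - (int c + int (card {t. t < j + K \<and> \<not> \<eta> dvd xs ! t})))"
        unfolding sum V by (simp add: cong_iff_dvd_diff)
      also have "\<dots> \<longleftrightarrow> even (level (ext xs) (K + j) - level (ext xs) 0)"
        unfolding level_ext[OF jK] by presburger
      finally show ?thesis using near by simp
    qed
    show ?thesis
    proof (intro iffI allI impI)
      fix i assume a: "\<forall>i. band (ext xs) (K + ?n) i \<longrightarrow> even (level (ext xs) i - level (ext xs) 0)"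
        and i: "i + K - 1 < ?n" "?near i"
      have "i + (?n - K - i) + K = ?n" using i(1) K_gt_0 by simp
      from one[OF this] show "?par i" using a i(2) by blast
    next
      fix i assume a: "\<forall>i. i + K - 1 < ?n \<longrightarrow> ?near i \<longrightarrow> ?par i" and i: "band (ext xs) (K + ?n) i"
      show "even (level (ext xs) i - level (ext xs) 0)"
      proof (cases "i < K")
        case True
        then show ?thesis using low i by simp
      next
        case False
        define j where "j = i - K"
        have ij: "i = K + j" using False unfolding j_def by simp
        then have jK: "j + K \<le> ?n" using i unfolding band_def by simp
        have "(?n - K - j) + j + K = ?n" "?n - K - j + K - 1 < ?n" using jK K_gt_0 by auto
        then show ?thesis using one[of "?n - K - j" j] a i ij by blast
      qed
    qed
  qed
  have part: "is_partition n (rev xs) \<longleftrightarrow> (\<forall>x\<in>set xs. 0 < x) \<and> sum_list xs = n"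
    unfolding is_partition_def using s by (simp add: sorted_wrt_rev sum_list_rev)
  have "rev xs \<in> bressoud_set n \<longleftrightarrow>
      is_partition n (rev xs) \<and> (\<forall>x\<in>set xs. residue_ok x) \<and>
      (\<forall>x\<in>set xs. 1 < count_list (rev xs) x \<longrightarrow> \<eta> dvd x) \<and>
      (\<forall>i. i + K < ?n \<longrightarrow> (if \<eta> dvd rev xs ! i then rev xs ! i > rev xs ! (i + K) + \<eta>
       else rev xs ! i \<ge> rev xs ! (i + K) + \<eta>)) \<and>
      int (card {i. i < ?n \<and> rev xs ! i \<le> \<eta>}) \<le> int (Suc c) - 1 \<and>
      (\<forall>i. i + K - 1 < ?n \<longrightarrow> ?near i \<longrightarrow> ?par i)"
    unfolding bressoudB_set_def residue_ok_def by simp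
  also have "\<dots> \<longleftrightarrow> list_config xs \<and> (\<forall>i. i + K - 1 < ?n \<longrightarrow> ?near i \<longrightarrow> ?par i) \<and> sum_list xs = n"
    unfolding conf part by blast
  also have "\<dots> \<longleftrightarrow> (xs, {}) \<in> list_states 1 n"
  proof -
    have "(xs, {}) \<in> list_states 1 n \<longleftrightarrow> list_config xs \<and>
        (\<forall>i. band (ext xs) (K + ?n) i \<longrightarrow> even (level (ext xs) i - level (ext xs) 0)) \<and> sum_list xs = n"
      unfolding list_states_1 config_ext_iff by simp
    then show ?thesis using bands by blast
  qed
  finally show ?thesis .
qed

lemma card_bressoudB_set: "bressoudB 0 l \<alpha> \<eta> (Suc K) (Suc c) n = card (list_states 1 n)"
proof -
  let ?h = "\<lambda>\<pi>. (rev \<pi>, {} :: nat set)"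
  have inj: "inj_on ?h (bressoud_set n)" by (rule inj_onI) simp
  have img: "?h ` bressoud_set n = list_states 1 n"
  proof
    show "?h ` bressoud_set n \<subseteq> list_states 1 n"
      using rev_in_bressoudB_set_iff[of "rev _"] by fastforce
    show "list_states 1 n \<subseteq> ?h ` bressoud_set n"
    proof
      fix u assume u: "u \<in> list_states 1 n"
      then obtain xs where xs: "u = (xs, {})" unfolding list_states_1 by auto
      then have "rev xs \<in> bressoud_set n" using u rev_in_bressoudB_set_iff by simp
      then show "u \<in> ?h ` bressoud_set n" using xs by force
    qed
  qed
  show ?thesis unfolding bressoudB_def using card_image[OF inj] unfolding img by simp
qed

end

section \<open>Spacing conditions as numbers of entries in a range of values\<close>

lemma window_exists:
  fixes z :: "'a :: linorder list"
  assumes z: "sorted z" and mono: "\<And>w w'. R w \<Longrightarrow> w \<le> w' \<Longrightarrow> R w'"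
    and d: "d < length (filter (\<lambda>w. a \<le> w \<and> \<not> R w) z)"
  obtains i where "i + d < length z" "a \<le> z ! i" "a \<in> set z \<Longrightarrow> z ! i = a" "\<not> R (z ! (i + d))"
proof -
  define I where "I = {i. i < length z \<and> a \<le> z ! i \<and> \<not> R (z ! i)}"
  have dI: "d < card I" using d unfolding I_def by (simp add: length_filter_conv_card)
  then obtain x where x: "x \<in> I" by (metis card.empty equals0I not_less0)
  define i where "i = (LEAST i. i < length z \<and> a \<le> z ! i)"
  have i: "i < length z" "a \<le> z ! i" and least: "\<And>j. j < length z \<Longrightarrow> a \<le> z ! j \<Longrightarrow> i \<le> j"
    using LeastI[of "\<lambda>i. i < length z \<and> a \<le> z ! i" x] Least_le[of "\<lambda>i. i < length z \<and> a \<le> z ! i"] x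
    unfolding i_def I_def by auto
  have "\<not> I \<subseteq> {i..<i + d}"
  proof
    assume "I \<subseteq> {i..<i + d}"
    then have "card I \<le> card {i..<i + d}" by (intro card_mono) auto
    then show False using dI by simp
  qed
  then obtain j where j: "j \<in> I" "i + d \<le> j" using least unfolding I_def by force
  have jl: "i + d < length z" using j unfolding I_def by auto
  have "\<not> R (z ! (i + d))" using mono[of "z ! (i + d)" "z ! j"] sorted_nth_mono[OF z j(2)] j(1) unfolding I_def by auto
  moreover have "z ! i = a" if az: "a \<in> set z"
  proof -
    obtain j where "j < length z" "z ! j = a" using az by (auto simp: in_set_conv_nth)
    then show ?thesis using least[of j] sorted_nth_mono[OF z, of i j] i by auto
  qed
  ultimately show thesis using that jl i by blast
qed

lemma window_length:
  fixes z :: "'a :: linorder list"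
  assumes z: "sorted z" and mono: "\<And>w w'. R w \<Longrightarrow> w \<le> w' \<Longrightarrow> R w'"
    and i: "i + d < length z" "a \<le> z ! i" "\<not> R (z ! (i + d))"
  shows "d < length (filter (\<lambda>w. a \<le> w \<and> \<not> R w) z)"
proof -
  have "{i..i + d} \<subseteq> {j. j < length z \<and> a \<le> z ! j \<and> \<not> R (z ! j)}"
  proof
    fix j assume j: "j \<in> {i..i + d}"
    have "z ! i \<le> z ! j" "z ! j \<le> z ! (i + d)" using j i by (auto intro!: sorted_nth_mono[OF z])
    then show "j \<in> {j. j < length z \<and> a \<le> z ! j \<and> \<not> R (z ! j)}" using mono[of "z ! j" "z ! (i + d)"] i j by auto
  qed
  then have "card {i..i + d} \<le> card {j. j < length z \<and> a \<le> z ! j \<and> \<not> R (z ! j)}" by (intro card_mono) auto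
  then show ?thesis by (simp add: length_filter_conv_card)
qed

text \<open>Turns a condition on positions into a bound on the number of entries in a range of
  values. Such numbers add up when plain parts and marks are merged, while positions do not.\<close>

lemma spacing_iff_window:
  fixes z :: "'a :: linorder list"
  assumes z: "sorted z" and mono: "\<And>x w w'. R x w \<Longrightarrow> w \<le> w' \<Longrightarrow> R x w'"
  shows "(\<forall>i. i + d < length z \<longrightarrow> R (z ! i) (z ! (i + d))) \<longleftrightarrow>
    (\<forall>x\<in>set z. length (filter (\<lambda>w. x \<le> w \<and> \<not> R x w) z) \<le> d)"
proof (intro iffI allI impI ballI)
  fix x assume a: "\<forall>i. i + d < length z \<longrightarrow> R (z ! i) (z ! (i + d))" "x \<in> set z"
  show "length (filter (\<lambda>w. x \<le> w \<and> \<not> R x w) z) \<le> d"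
  proof (rule ccontr)
    assume "\<not> ?thesis"
    then have "d < length (filter (\<lambda>w. x \<le> w \<and> \<not> R x w) z)" by simp
    then obtain i where "i + d < length z" "x \<in> set z \<Longrightarrow> z ! i = x" "\<not> R x (z ! (i + d))"
      using window_exists[OF z, of "R x" d x] mono by metis
    then show False using a by auto
  qed
next
  fix i assume a: "\<forall>x\<in>set z. length (filter (\<lambda>w. x \<le> w \<and> \<not> R x w) z) \<le> d" "i + d < length z"
  show "R (z ! i) (z ! (i + d))"
  proof (rule ccontr)
    assume "\<not> ?thesis"
    then have "d < length (filter (\<lambda>w. z ! i \<le> w \<and> \<not> R (z ! i) w) z)"
      using window_length[OF z, of "R (z ! i)" i d "z ! i"] mono a(2) by blast
    then show False using a by (meson add_lessD1 not_le nth_mem)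
  qed
qed

section \<open>Condition (3) for merged plain parts and marks\<close>

context bressoud_params
begin

text \<open>The overline is determined: non-multiples must carry one by (2), and overlined multiples
  are treated separately as \<open>extra\<close>.\<close>

definition plain :: "nat \<Rightarrow> opart" where
  "plain x = Part x (\<not> \<eta> dvd x)"

definition extra :: "nat \<Rightarrow> opart" where
  "extra m = Part (m * \<eta>) True"

definition ofar :: "opart \<Rightarrow> opart \<Rightarrow> bool" where
  "ofar x w \<longleftrightarrow> (if overlined w then shift x \<eta> \<le> w else shift x \<eta> < w)"

definition merge :: "nat list \<Rightarrow> nat set \<Rightarrow> opart list" where
  "merge xs E = rev (sort (map plain xs @ map extra (sorted_list_of_set E)))"

lemma ofar_mono: "ofar x w \<Longrightarrow> w \<le> w' \<Longrightarrow> ofar x w'"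
  unfolding ofar_def less_eq_opart_def less_opart_def shift_def by (auto split: if_splits)

lemma ofar_plain: "ofar (plain a) (plain b) \<longleftrightarrow> far (int a) (int b)"
  unfolding ofar_def plain_def shift_def far_int' less_eq_opart_def less_opart_def by auto

lemma plain_le_plain: "plain a \<le> plain b \<longleftrightarrow> a \<le> b"
  unfolding plain_def less_eq_opart_def by auto

text \<open>The half-open interval of length \<open>\<eta>\<close> starting at \<open>a\<close>
  contains exactly one multiple of \<open>\<eta>\<close>, given by the ceiling.\<close>

lemma window_plain_extra:
  "plain a \<le> extra m \<and> \<not> ofar (plain a) (extra m) \<longleftrightarrow> int m = cl (int a)"
proof -
  have "plain a \<le> extra m \<and> \<not> ofar (plain a) (extra m) \<longleftrightarrow> a \<le> m * \<eta> \<and> m * \<eta> < a + \<eta>"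
    unfolding ofar_def plain_def extra_def shift_def less_eq_opart_def by auto
  also have "\<dots> \<longleftrightarrow> cl (int a) \<le> int m \<and> int m - 1 < cl (int a)"
    unfolding less_cl cl_le by (auto simp: left_diff_distrib simp flip: of_nat_mult of_nat_add)
  finally show ?thesis by linarith
qed

text \<open>An overlined part follows the plain one of equal size. Hence the window of the mark
  \<open>m\<close> excludes the plain \<open>m * \<eta>\<close> but includes the plain
  \<open>Suc m * \<eta>\<close>.\<close>

lemma window_extra_plain:
  "extra m \<le> plain b \<and> \<not> ofar (extra m) (plain b) \<longleftrightarrow> m * \<eta> + 1 \<le> b \<and> \<not> Suc m * \<eta> < b"
proof (cases "\<eta> dvd b")
  case True
  then show ?thesis
    unfolding ofar_def plain_def extra_def shift_def less_eq_opart_def less_opart_def by auto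
next
  case False
  then have "b \<noteq> m * \<eta>" "b \<noteq> Suc m * \<eta>" by auto
  then show ?thesis
    using False unfolding ofar_def plain_def extra_def shift_def less_eq_opart_def less_opart_def by auto
qed

lemma window_extra_extra:
  "extra m \<le> extra m' \<and> \<not> ofar (extra m) (extra m') \<longleftrightarrow> m' = m"
proof -
  have "extra m \<le> extra m' \<and> \<not> ofar (extra m) (extra m') \<longleftrightarrow> m * \<eta> \<le> m' * \<eta> \<and> m' * \<eta> < Suc m * \<eta>"
    unfolding ofar_def extra_def shift_def less_eq_opart_def by auto
  also have "\<dots> \<longleftrightarrow> m \<le> m' \<and> m' < Suc m" using \<eta>_gt_0 by (simp only: mult_le_cancel2 mult_less_cancel2) simp
  finally show ?thesis by linarith
qed

definition window :: "nat list \<Rightarrow> nat \<Rightarrow> nat" where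
  "window xs a = length (filter (\<lambda>b. a \<le> b \<and> \<not> far (int a) (int b)) xs)"

definition block :: "nat list \<Rightarrow> nat \<Rightarrow> nat" where
  "block xs m = length (filter (\<lambda>b. m * \<eta> + 1 \<le> b \<and> \<not> Suc m * \<eta> < b) xs)"

lemma length_filter_merge:
  assumes "finite E"
  shows "length (filter Q (merge xs E)) = length (filter (Q \<circ> plain) xs) + card {m\<in>E. Q (extra m)}"
proof -
  let ?ys = "map plain xs @ map extra (sorted_list_of_set E)"
  have "mset (filter Q (merge xs E)) = mset (filter Q ?ys)"
    unfolding merge_def by (simp add: mset_filter)
  then have "length (filter Q (merge xs E)) = length (filter Q ?ys)" by (rule mset_eq_length)
  also have "\<dots> = length (filter (Q \<circ> plain) xs) + length (filter (Q \<circ> extra) (sorted_list_of_set E))"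
    by (simp add: filter_map)
  also have "length (filter (Q \<circ> extra) (sorted_list_of_set E)) = card {m\<in>E. Q (extra m)}"
    using distinct_length_filter[of "sorted_list_of_set E" "Q \<circ> extra"] assms
    by (simp add: Int_def conj_commute)
  finally show ?thesis .
qed

lemma set_merge: "finite E \<Longrightarrow> set (merge xs E) = plain ` set xs \<union> extra ` E"
  unfolding merge_def by simp

text \<open>Each window holds at most one mark: from a plain part \<open>a\<close> only its ceiling,
  from a mark only that mark itself.\<close>

lemma merge_spacing_iff:
  assumes E: "finite E"
  shows "(\<forall>i. i + K < length (merge xs E) \<longrightarrow>
        (if overlined (merge xs E ! i) then merge xs E ! i \<ge> shift (merge xs E ! (i + K)) \<eta>
         else merge xs E ! i > shift (merge xs E ! (i + K)) \<eta>)) \<longleftrightarrow>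
    (\<forall>a\<in>set xs. window xs a + card {m\<in>E. int m = cl (int a)} \<le> K) \<and> (\<forall>m\<in>E. block xs m + 1 \<le> K)"
proof -
  define z where "z = rev (merge xs E)"
  have sz: "sorted z" unfolding z_def merge_def by simp
  have lz: "length (filter Q z) = length (filter (Q \<circ> plain) xs) + card {m\<in>E. Q (extra m)}" for Q
    using length_filter_merge[OF E, of Q xs] unfolding z_def by (simp add: rev_filter[symmetric])
  have m: "merge xs E = rev z" unfolding z_def by simp
  have "(\<forall>i. i + K < length (merge xs E) \<longrightarrow>
        (if overlined (merge xs E ! i) then merge xs E ! i \<ge> shift (merge xs E ! (i + K)) \<eta>
         else merge xs E ! i > shift (merge xs E ! (i + K)) \<eta>)) \<longleftrightarrow>
      (\<forall>i. i + K < length z \<longrightarrow> ofar (z ! i) (z ! (i + K)))"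
    unfolding m ofar_def
    using all_rev_nth[of K z "\<lambda>a b. if overlined a then a \<ge> shift b \<eta> else a > shift b \<eta>"] by simp
  also have "\<dots> \<longleftrightarrow> (\<forall>x\<in>set z. length (filter (\<lambda>w. x \<le> w \<and> \<not> ofar x w) z) \<le> K)"
    by (rule spacing_iff_window[OF sz ofar_mono])
  also have "\<dots> \<longleftrightarrow> (\<forall>a\<in>set xs. length (filter (\<lambda>w. plain a \<le> w \<and> \<not> ofar (plain a) w) z) \<le> K) \<and>
      (\<forall>m\<in>E. length (filter (\<lambda>w. extra m \<le> w \<and> \<not> ofar (extra m) w) z) \<le> K)"
    using set_merge[OF E, of xs] unfolding z_def by auto
  also have "\<dots> \<longleftrightarrow> (\<forall>a\<in>set xs. window xs a + card {m\<in>E. int m = cl (int a)} \<le> K) \<and>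
      (\<forall>m\<in>E. block xs m + card {m'\<in>E. m' = m} \<le> K)"
    unfolding lz window_plain_extra window_extra_extra window_def block_def comp_def window_extra_plain
      ofar_plain plain_le_plain ..
  also have "\<dots> \<longleftrightarrow> (\<forall>a\<in>set xs. window xs a + card {m\<in>E. int m = cl (int a)} \<le> K) \<and> (\<forall>m\<in>E. block xs m + 1 \<le> K)"
  proof -
    have "card {m'\<in>E. m' = m} = 1" if "m \<in> E" for m
    proof -
      have "{m'\<in>E. m' = m} = {m}" using that by auto
      then show ?thesis by simp
    qed
    then show ?thesis by simp
  qed
  finally show ?thesis .
qed

lemma list_far_iff:
  assumes "sorted xs"
  shows "(\<forall>i. i + K < length xs \<longrightarrow> far (int (xs ! i)) (int (xs ! (i + K)))) \<longleftrightarrow> (\<forall>a\<in>set xs. window xs a \<le> K)"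
  unfolding window_def
  using spacing_iff_window[OF assms, of "\<lambda>a b. far (int a) (int b)" K] far_mono by auto

text \<open>If \<open>K\<close> plain parts shared a window with a mark, they would contain a band
  that \<open>compat\<close> forbids: one starting at ceiling \<open>m\<close> in the first case,
  one with all ceilings equal to \<open>m + 1\<close> in the second.\<close>

lemma compat_imp_windows:
  assumes lc: "list_config xs" and E: "finite E" "\<forall>m\<in>E. compat (ext xs) (K + length xs) m"
  shows "(\<forall>a\<in>set xs. window xs a + card {m\<in>E. int m = cl (int a)} \<le> K) \<and> (\<forall>m\<in>E. block xs m + 1 \<le> K)"
proof (intro conjI ballI)
  have s: "sorted xs" using list_config_sorted[OF lc] .
  have e1: "ext xs (K + i) = int (xs ! i)" "ext xs (K + i + K - 1) = int (xs ! (i + (K - 1)))"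
    if "i + (K - 1) < length xs" for i
  proof -
    have "K + i + K - 1 = K + (i + (K - 1))" using K_gt_0 by simp
    then show "ext xs (K + i) = int (xs ! i)" "ext xs (K + i + K - 1) = int (xs ! (i + (K - 1)))"
      using ext_nth[of i xs] ext_nth[of "i + (K - 1)" xs] that by auto
  qed
  have bd: "band (ext xs) (K + length xs) (K + i)"
    if "i + (K - 1) < length xs" "\<not> far (int (xs ! i)) (int (xs ! (i + (K - 1))))" for i
    using that e1[OF that(1)] K_gt_0 unfolding band_def by auto
  show "window xs a + card {m\<in>E. int m = cl (int a)} \<le> K" if a: "a \<in> set xs" for a
  proof (cases "{m\<in>E. int m = cl (int a)} = {}")
    case True
    have "window xs a \<le> K" using list_far_iff[OF s] lc a unfolding list_config_def by blast
    then show ?thesis unfolding True by simp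
  next
    case False
    then obtain m where m: "m \<in> E" "int m = cl (int a)" by blast
    then have "{m\<in>E. int m = cl (int a)} = {m}" by auto
    moreover have "\<not> K - 1 < window xs a"
    proof
      assume "K - 1 < window xs a"
      then have w: "K - 1 < length (filter (\<lambda>b. a \<le> b \<and> \<not> far (int a) (int b)) xs)" unfolding window_def .
      obtain i where i: "i + (K - 1) < length xs" "a \<in> set xs \<Longrightarrow> xs ! i = a" "\<not> far (int a) (int (xs ! (i + (K - 1))))"
        by (rule window_exists[OF s _ w]) (auto intro: far_mono)
      have b: "band (ext xs) (K + length xs) (K + i)" using bd i a by auto
      have "cl (ext xs (K + i)) = int m" using e1[OF i(1)] i(2)[OF a] m by simp
      then show False using band_cl_le[OF b] E(2) m(1) b unfolding compat_def by force
    qed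
    ultimately show ?thesis using K_gt_0 by simp
  qed
  show "block xs m + 1 \<le> K" if m: "m \<in> E" for m
  proof -
    have "\<not> K - 1 < block xs m"
    proof
      assume "K - 1 < block xs m"
      then have w: "K - 1 < length (filter (\<lambda>b. m * \<eta> + 1 \<le> b \<and> \<not> Suc m * \<eta> < b) xs)" unfolding block_def .
      obtain i where i: "i + (K - 1) < length xs" "m * \<eta> + 1 \<le> xs ! i" "\<not> Suc m * \<eta> < xs ! (i + (K - 1))"
        by (rule window_exists[OF s _ w]) auto
      have "xs ! (i + (K - 1)) < xs ! i + \<eta>" using i(2,3) by simp
      then have "\<not> far (int (xs ! i)) (int (xs ! (i + (K - 1))))" unfolding far_int by auto
      then have b: "band (ext xs) (K + length xs) (K + i)" using bd i by auto
      have "int m < cl (int (xs ! i))" unfolding less_cl using i(2) by (simp flip: of_nat_mult)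
      moreover have "cl (int (xs ! (i + (K - 1)))) \<le> int (Suc m)" unfolding cl_le using i(3) by (simp only: of_nat_mult[symmetric] of_nat_le_iff not_less)
      ultimately show False using E(2) m b e1[OF i(1)] unfolding compat_def by force
    qed
    then show ?thesis using K_gt_0 by simp
  qed
qed

text \<open>A band violating \<open>compat\<close> starts at ceiling \<open>m\<close>, which
  overfills a window, or at a larger one, which overfills the block of \<open>m\<close>.\<close>

lemma windows_imp_compat:
  assumes lc: "list_config xs" and E: "finite E" "\<forall>m\<in>E. 1 \<le> m"
    and W: "\<forall>a\<in>set xs. window xs a + card {m\<in>E. int m = cl (int a)} \<le> K" "\<forall>m\<in>E. block xs m + 1 \<le> K"
    and m: "m \<in> E"
  shows "compat (ext xs) (K + length xs) m"
  unfolding compat_def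
proof (intro allI impI, rule ccontr)
  have s: "sorted xs" using list_config_sorted[OF lc] .
  fix i assume i: "band (ext xs) (K + length xs) i"
    and n: "\<not> (int m + 1 < cl (ext xs (i + K - 1)) \<or> cl (ext xs i) < int m)"
  have "\<not> i < K"
  proof
    assume "i < K"
    then have "cl (ext xs i) \<le> 0" using ext_base cl_base by simp
    then show False using n E(2) m by force
  qed
  then obtain j where j: "i = K + j" by (metis le_Suc_ex not_le)
  have jK: "j + (K - 1) < length xs" and nf: "\<not> far (int (xs ! j)) (int (xs ! (j + (K - 1))))"
    using i K_gt_0 unfolding j band_ext by auto
  have e: "ext xs i = int (xs ! j)" using ext_nth[of j xs] jK j by simp
  have "i + K - 1 = K + (j + (K - 1))" using K_gt_0 j by simp
  then have e': "ext xs (i + K - 1) = int (xs ! (j + (K - 1)))" using ext_nth[OF jK] by simp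
  have xj: "xs ! j \<in> set xs" using jK by simp
  show False
  proof (cases "cl (int (xs ! j)) = int m")
    case True
    have "K - 1 < window xs (xs ! j)"
      unfolding window_def by (rule window_length[OF s _ jK]) (use nf far_mono in auto)
    moreover have "m \<in> {m'\<in>E. int m' = cl (int (xs ! j))}" using m True by simp
    then have "1 \<le> card {m'\<in>E. int m' = cl (int (xs ! j))}" using E(1) by (auto simp: Suc_le_eq card_gt_0_iff)
    moreover have "window xs (xs ! j) + card {m'\<in>E. int m' = cl (int (xs ! j))} \<le> K" using W(1) xj by blast
    ultimately show False by linarith
  next
    case False
    then have "int m < cl (int (xs ! j))" using n e by auto
    then have 1: "m * \<eta> + 1 \<le> xs ! j" unfolding less_cl by (simp flip: of_nat_mult)
    have "cl (int (xs ! (j + (K - 1)))) \<le> int (Suc m)" using n e' by auto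
    then have 2: "\<not> Suc m * \<eta> < xs ! (j + (K - 1))" unfolding cl_le by (simp only: of_nat_mult[symmetric] of_nat_le_iff not_less)
    have "K - 1 < block xs m"
      unfolding block_def by (rule window_length[OF s, where R = "\<lambda>b. Suc m * \<eta> < b" and i = j]) (use jK 1 2 in auto)
    then show False using W(2) m by force
  qed
qed

end

section \<open>Overpartitions as pairs of plain parts and marks\<close>

lemma distinct_filter_iff_count:
  "distinct (filter Q xs) \<longleftrightarrow> (\<forall>x\<in>set xs. Q x \<longrightarrow> count_list xs x \<le> 1)"
proof -
  have "count_list (filter Q xs) x = (if Q x then count_list xs x else 0)" for x
    by (induction xs) auto
  moreover have "x \<in> set xs \<longleftrightarrow> 0 < count_list xs x" for x
    using count_list_0_iff[of xs x] by auto
  ultimately show ?thesis unfolding distinct_count_atmost_1 count_mset by (auto simp: le_Suc_eq)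
qed

context bressoud_params
begin

definition is_extra :: "opart \<Rightarrow> bool" where
  "is_extra w \<longleftrightarrow> overlined w \<and> \<eta> dvd magn w"

definition plains :: "opart list \<Rightarrow> nat list" where
  "plains \<pi> = sort (map magn (filter (Not \<circ> is_extra) \<pi>))"

definition extras :: "opart list \<Rightarrow> nat set" where
  "extras \<pi> = {m. extra m \<in> set \<pi>}"

lemma not_is_extra_plain [simp]: "\<not> is_extra (plain x)"
  unfolding is_extra_def plain_def by auto

lemma is_extra_extra [simp]: "is_extra (extra m)"
  unfolding is_extra_def extra_def by auto

lemma inj_extra: "inj_on extra S"
  by (rule inj_onI) (use \<eta>_gt_0 in \<open>auto simp: extra_def\<close>)

lemma is_extra_imp_extra: "is_extra w \<Longrightarrow> \<exists>m. w = extra m"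
  unfolding is_extra_def extra_def by (cases w) (auto elim!: dvdE simp: mult.commute)

lemma mset_merge: "mset (merge xs E) = mset (map plain xs @ map extra (sorted_list_of_set E))"
  unfolding merge_def by simp

lemma plains_merge:
  assumes "sorted xs" "finite E" shows "plains (merge xs E) = xs"
  unfolding plains_def
proof (rule properties_for_sort)
  have "mset (filter (Not \<circ> is_extra) (merge xs E)) =
      mset (filter (Not \<circ> is_extra) (map plain xs @ map extra (sorted_list_of_set E)))"
    by (simp only: mset_filter mset_merge)
  also have "filter (Not \<circ> is_extra) (map plain xs @ map extra (sorted_list_of_set E)) = map plain xs"
    by (simp add: filter_map comp_def)
  finally have "mset (map magn (filter (Not \<circ> is_extra) (merge xs E))) = mset (map magn (map plain xs))"
    by (simp only: mset_map)
  then show "mset xs = mset (map magn (filter (Not \<circ> is_extra) (merge xs E)))"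
    by (simp add: comp_def plain_def)
qed (rule assms)

lemma extras_merge:
  assumes "finite E" shows "extras (merge xs E) = E"
proof -
  have "extra m \<notin> plain ` set xs" for m using not_is_extra_plain is_extra_extra by (metis imageE)
  moreover have "extra m \<in> extra ` E \<longleftrightarrow> m \<in> E" for m using inj_image_mem_iff[OF inj_extra] .
  ultimately show ?thesis unfolding extras_def set_merge[OF assms] by auto
qed

lemma finite_extras: "finite (extras \<pi>)"
proof -
  have "extra ` extras \<pi> \<subseteq> set \<pi>" unfolding extras_def by auto
  then show ?thesis using finite_imageD[OF finite_subset[OF _ finite_set] inj_extra] by blast
qed

lemma merge_plains_extras:
  assumes s: "sorted_wrt (\<ge>) \<pi>" and d: "distinct (filter overlined \<pi>)"
    and nov: "\<forall>w\<in>set \<pi>. \<not> overlined w \<longrightarrow> \<eta> dvd magn w"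
  shows "merge (plains \<pi>) (extras \<pi>) = \<pi>"
proof -
  have pl: "plain (magn w) = w" if "w \<in> set \<pi>" "\<not> is_extra w" for w
    using that nov unfolding is_extra_def plain_def by (cases w rule: opart.exhaust) auto
  have "mset (map plain (plains \<pi>)) = mset (map plain (map magn (filter (Not \<circ> is_extra) \<pi>)))"
    unfolding plains_def by (simp only: mset_map mset_sort)
  also have "map plain (map magn (filter (Not \<circ> is_extra) \<pi>)) = filter (Not \<circ> is_extra) \<pi>"
    unfolding map_map by (rule map_idI) (use pl in auto)
  finally have 1: "mset (map plain (plains \<pi>)) = mset (filter (Not \<circ> is_extra) \<pi>)" .
  have "distinct (filter is_extra \<pi>)"
  proof -
    have "filter is_extra \<pi> = filter (\<lambda>w. \<eta> dvd magn w) (filter overlined \<pi>)"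
      unfolding is_extra_def by (auto simp: conj_commute intro: filter_cong)
    then show ?thesis using distinct_filter[OF d, of "\<lambda>w. \<eta> dvd magn w"] by (simp only:)
  qed
  then have "mset (filter is_extra \<pi>) = mset_set (set (filter is_extra \<pi>))" by (rule mset_set_set[symmetric])
  also have "set (filter is_extra \<pi>) = extra ` extras \<pi>"
    using is_extra_imp_extra unfolding extras_def by auto
  also have "mset_set (extra ` extras \<pi>) = image_mset extra (mset_set (extras \<pi>))"
    by (rule image_mset_mset_set[OF inj_extra, symmetric])
  also have "mset_set (extras \<pi>) = mset (sorted_list_of_set (extras \<pi>))"
    using mset_set_set[of "sorted_list_of_set (extras \<pi>)"] finite_extras by simp
  finally have 2: "mset (map extra (sorted_list_of_set (extras \<pi>))) = mset (filter is_extra \<pi>)"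
    by (simp only: mset_map)
  have "sort (map plain (plains \<pi>) @ map extra (sorted_list_of_set (extras \<pi>))) = rev \<pi>"
  proof (rule properties_for_sort)
    have "mset (filter is_extra \<pi>) + mset (filter (Not \<circ> is_extra) \<pi>) = mset \<pi>"
      by (simp add: comp_def mset_filter)
    then show "mset (rev \<pi>) = mset (map plain (plains \<pi>) @ map extra (sorted_list_of_set (extras \<pi>)))"
      using 1 2 by (simp add: add.commute)
    show "sorted (rev \<pi>)" using s by (simp add: sorted_wrt_rev)
  qed
  then show ?thesis unfolding merge_def by simp
qed

lemma merge_in_overB_set_iff:
  assumes s: "sorted xs" and E: "finite E"
  shows "merge xs E \<in> over_set n \<longleftrightarrow>
    list_config xs \<and> (\<forall>m\<in>E. 1 \<le> m \<and> compat (ext xs) (K + length xs) m) \<and>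
    int (sum_list xs) + int \<eta> * (\<Sum>m\<in>E. int m) = int n"
proof (cases "\<forall>m\<in>E. 1 \<le> m")
  case False
  then have "0 \<in> E" by (auto simp: not_le)
  then have "Part 0 True \<in> set (merge xs E)" unfolding set_merge[OF E] extra_def by force
  then have "merge xs E \<notin> over_set n"
    unfolding overB_set_def overpartition_def by force
  then show ?thesis using False by blast
next
  case E1: True
  let ?p = "merge xs E" and ?n = "length xs"
  have srt: "sorted_wrt (\<ge>) ?p" unfolding merge_def by (simp add: sorted_wrt_rev)
  have pos: "(\<forall>w\<in>set ?p. 0 < magn w) \<longleftrightarrow> (\<forall>x\<in>set xs. 0 < x)"
    unfolding set_merge[OF E] using E1 \<eta>_gt_0 by (auto simp: ball_Un plain_def extra_def)
  have sum: "int (sum_list (map magn ?p)) = int (sum_list xs) + int \<eta> * (\<Sum>m\<in>E. int m)"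
  proof -
    have "sum_list (map magn ?p) = sum_mset (image_mset magn (mset ?p))" by (metis mset_map sum_mset_sum_list)
    also have "\<dots> = sum_list xs + sum_list (map (\<lambda>m. m * \<eta>) (sorted_list_of_set E))"
      unfolding mset_merge mset_map[symmetric] sum_mset_sum_list by (simp add: comp_def plain_def extra_def)
    also have "sum_list (map (\<lambda>m. m * \<eta>) (sorted_list_of_set E)) = (\<Sum>m\<in>E. m * \<eta>)"
      using E sum_list_distinct_conv_sum_set[of "sorted_list_of_set E" "\<lambda>m. m * \<eta>"] by simp
    finally show ?thesis by (simp add: sum_distrib_left mult.commute)
  qed
  have res: "(\<forall>w\<in>set ?p. [magn w = 0] (mod \<eta>) \<or> (\<exists>t\<in>{1..l}. [magn w = \<alpha> t] (mod \<eta>))) \<longleftrightarrow> (\<forall>x\<in>set xs. residue_ok x)"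
    unfolding set_merge[OF E] residue_ok_def by (auto simp: ball_Un plain_def extra_def cong_0_iff)
  have nov: "\<forall>w\<in>set ?p. \<not> overlined w \<longrightarrow> \<eta> dvd magn w"
    unfolding set_merge[OF E] by (auto simp: plain_def extra_def)
  have dist: "distinct (filter overlined ?p) \<longleftrightarrow>
      (\<forall>i. Suc i < ?n \<longrightarrow> \<not> \<eta> dvd xs ! i \<longrightarrow> xs ! i < xs ! Suc i)"
  proof -
    have "distinct (filter overlined ?p) \<longleftrightarrow> distinct (filter overlined (map plain xs @ map extra (sorted_list_of_set E)))"
      by (rule mset_eq_imp_distinct_iff) (simp only: mset_filter mset_merge)
    also have "filter overlined (map plain xs @ map extra (sorted_list_of_set E)) =
        map plain (filter (\<lambda>x. \<not> \<eta> dvd x) xs) @ map extra (sorted_list_of_set E)"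
      by (simp add: filter_map comp_def plain_def extra_def)
    also have "distinct \<dots> \<longleftrightarrow> distinct (filter (\<lambda>x. \<not> \<eta> dvd x) xs)"
    proof -
      have "inj_on plain S" for S by (rule inj_onI) (auto simp: plain_def)
      moreover have "plain x \<noteq> extra m" for x m by (metis not_is_extra_plain is_extra_extra)
      then have "set (map plain (filter (\<lambda>x. \<not> \<eta> dvd x) xs)) \<inter> set (map extra (sorted_list_of_set E)) = {}" by auto
      ultimately show ?thesis using inj_extra by (simp add: distinct_map)
    qed
    also have "\<dots> \<longleftrightarrow> (\<forall>i. Suc i < ?n \<longrightarrow> \<not> \<eta> dvd xs ! i \<longrightarrow> xs ! i < xs ! Suc i)"
      unfolding distinct_filter_iff_count sorted_count_le_1_iff[OF s, of "\<lambda>x. \<eta> dvd x", symmetric]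
      by (meson not_le)
    finally show ?thesis .
  qed
  have small: "int (card {i. i < length ?p \<and> ?p ! i \<le> Part \<eta> False}) \<le> int (Suc c) - 1 \<longleftrightarrow>
      (\<forall>i<?n. c \<le> i \<longrightarrow> \<eta> < xs ! i)"
  proof -
    have "card {i. i < length ?p \<and> ?p ! i \<le> Part \<eta> False} = length (filter (\<lambda>w. w \<le> Part \<eta> False) ?p)"
      by (simp add: length_filter_conv_card)
    also have "\<dots> = length (filter ((\<lambda>w. w \<le> Part \<eta> False) \<circ> plain) xs) + card {m\<in>E. extra m \<le> Part \<eta> False}"
      by (rule length_filter_merge[OF E])
    \<comment> \<open>The smallest mark is the overlined \<open>\<eta>\<close>, which exceeds the
      plain \<open>\<eta>\<close>; so marks are not counted in (4).\<close>
    also have "{m\<in>E. extra m \<le> Part \<eta> False} = {}"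
      using E1 \<eta>_gt_0 by (auto simp: extra_def less_eq_opart_def)
    also have "(\<lambda>w. w \<le> Part \<eta> False) \<circ> plain = (\<lambda>x. x \<le> \<eta>)"
      by (auto simp: plain_def less_eq_opart_def fun_eq_iff)
    finally have "card {i. i < length ?p \<and> ?p ! i \<le> Part \<eta> False} = card {i. i < ?n \<and> xs ! i \<le> \<eta>}"
      by (simp add: length_filter_conv_card)
    then show ?thesis using sorted_card_le_iff[OF s, of \<eta> c] by simp
  qed
  let ?spacing = "\<forall>i. i + K < length ?p \<longrightarrow>
      (if overlined (?p ! i) then ?p ! i \<ge> shift (?p ! (i + K)) \<eta> else ?p ! i > shift (?p ! (i + K)) \<eta>)"
  have s1: "\<forall>i. Suc i < ?n \<longrightarrow> xs ! i \<le> xs ! Suc i" using s by (simp add: sorted_iff_nth_Suc)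
  \<comment> \<open>For \<open>j = 1\<close> condition (5) is a congruence modulo 1 and
    disappears.\<close>
  have "?p \<in> over_set n \<longleftrightarrow>
      ((\<forall>w\<in>set ?p. 0 < magn w) \<and> distinct (filter overlined ?p) \<and> sum_list (map magn ?p) = n) \<and>
      (\<forall>w\<in>set ?p. [magn w = 0] (mod \<eta>) \<or> (\<exists>t\<in>{1..l}. [magn w = \<alpha> t] (mod \<eta>))) \<and> ?spacing \<and>
      int (card {i. i < length ?p \<and> ?p ! i \<le> Part \<eta> False}) \<le> int (Suc c) - 1"
    unfolding overB_set_def overpartition_def using srt nov by auto
  also have "sum_list (map magn ?p) = n \<longleftrightarrow> int (sum_list xs) + int \<eta> * (\<Sum>m\<in>E. int m) = int n"
    unfolding sum[symmetric] by simp
  also have "?spacing \<longleftrightarrow> (\<forall>i. i + K < ?n \<longrightarrow> far (int (xs ! i)) (int (xs ! (i + K)))) \<and>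
      ((\<forall>a\<in>set xs. window xs a + card {m\<in>E. int m = cl (int a)} \<le> K) \<and> (\<forall>m\<in>E. block xs m + 1 \<le> K))"
    unfolding merge_spacing_iff[OF E] list_far_iff[OF s] by (meson le_add1 le_trans)
  finally have "?p \<in> over_set n \<longleftrightarrow> list_config xs \<and>
      ((\<forall>a\<in>set xs. window xs a + card {m\<in>E. int m = cl (int a)} \<le> K) \<and> (\<forall>m\<in>E. block xs m + 1 \<le> K)) \<and>
      int (sum_list xs) + int \<eta> * (\<Sum>m\<in>E. int m) = int n"
    unfolding pos dist res small list_config_def using s1 by blast
  also have "\<dots> \<longleftrightarrow> list_config xs \<and> (\<forall>m\<in>E. 1 \<le> m \<and> compat (ext xs) (K + length xs) m) \<and>
      int (sum_list xs) + int \<eta> * (\<Sum>m\<in>E. int m) = int n"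
    using compat_imp_windows[of xs, OF _ E] windows_imp_compat[of xs, OF _ E E1] E1 by blast
  finally show ?thesis .
qed

lemma bij_betw_merge:
  assumes "n < f"
  shows "bij_betw (\<lambda>(xs, E). merge xs E) (list_states f n) (over_set n)"
proof (rule bij_betw_byWitness[where f' = "\<lambda>\<pi>. (plains \<pi>, extras \<pi>)"])
  have L: "(xs, E) \<in> list_states f n \<longleftrightarrow> finite E \<and> list_config xs \<and>
      (\<forall>m\<in>E. 1 \<le> m \<and> compat (ext xs) (K + length xs) m) \<and>
      int (sum_list xs) + int \<eta> * (\<Sum>m\<in>E. int m) = int n" for xs E
    unfolding list_states_large[OF assms] config_ext_iff by auto
  show "\<forall>u\<in>list_states f n. (\<lambda>\<pi>. (plains \<pi>, extras \<pi>)) (case u of (xs, E) \<Rightarrow> merge xs E) = u"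
    using L list_config_sorted plains_merge extras_merge by auto
  show "(\<lambda>(xs, E). merge xs E) ` list_states f n \<subseteq> over_set n"
    using L list_config_sorted merge_in_overB_set_iff by auto
  have mp: "merge (plains \<pi>) (extras \<pi>) = \<pi>" if "\<pi> \<in> over_set n" for \<pi>
    by (rule merge_plains_extras) (use that in \<open>auto simp: overB_set_def overpartition_def\<close>)
  then show "\<forall>\<pi>\<in>over_set n. (case (plains \<pi>, extras \<pi>) of (xs, E) \<Rightarrow> merge xs E) = \<pi>"
    by simp
  have "sorted (plains \<pi>)" for \<pi> unfolding plains_def by simp
  then have "(plains \<pi>, extras \<pi>) \<in> list_states f n" if "\<pi> \<in> over_set n" for \<pi>
    unfolding L using merge_in_overB_set_iff[of "plains \<pi>" "extras \<pi>" n] mp[OF that] that finite_extras by simp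
  then show "(\<lambda>\<pi>. (plains \<pi>, extras \<pi>)) ` over_set n \<subseteq> list_states f n" by blast
qed

lemma card_overB_set: "n < f \<Longrightarrow> overB 1 l \<alpha> \<eta> (Suc K) (Suc c) n = card (list_states f n)"
  unfolding overB_def using bij_betw_same_card[OF bij_betw_merge[of n f]] by simp

section \<open>Finiteness and generating functions\<close>

lemma finite_overB_set: "finite (overB_set j l \<alpha> \<eta> k r n)"
proof (rule finite_subset)
  show "overB_set j l \<alpha> \<eta> k r n \<subseteq> {\<pi>. set \<pi> \<subseteq> (\<lambda>(a, b). Part a b) ` ({..n} \<times> UNIV) \<and> length \<pi> \<le> n}"
  proof
    fix \<pi> assume "\<pi> \<in> overB_set j l \<alpha> \<eta> k r n"
    then have p: "\<forall>x\<in>set \<pi>. 0 < magn x" "sum_list (map magn \<pi>) = n" unfolding overB_set_def overpartition_def by auto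
    have "length \<pi> \<le> sum_list (map magn \<pi>)" using p(1) by (induction \<pi>) auto
    moreover have "w \<in> (\<lambda>(a, b). Part a b) ` ({..n} \<times> UNIV)" if "w \<in> set \<pi>" for w
    proof -
      have "magn w \<le> n" using member_le_sum_list[of "magn w" "map magn \<pi>"] that p(2) by auto
      then show ?thesis by (intro image_eqI[of _ _ "(magn w, overlined w)"]) auto
    qed
    ultimately show "\<pi> \<in> {\<pi>. set \<pi> \<subseteq> (\<lambda>(a, b). Part a b) ` ({..n} \<times> UNIV) \<and> length \<pi> \<le> n}" using p(2) by auto
  qed
qed (rule finite_lists_length_le, simp)

text \<open>The families grow with \<open>f\<close>, and for large \<open>f\<close> they are in
  bijection with the finite set of overpartitions.\<close>

lemma finite_list_states: "finite (list_states f n)"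
proof -
  have "finite (list_states (max f (Suc n)) n)"
    using bij_betw_finite[OF bij_betw_merge[of n "max f (Suc n)"]] finite_overB_set by auto
  then show ?thesis using finite_subset[OF list_states_mono] by (meson max.cobounded1)
qed

lemma list_states_fps_Suc:
  assumes "1 \<le> f"
  shows "Abs_fps (\<lambda>n. int (card (list_states (Suc f) n))) =
    Abs_fps (\<lambda>n. int (card (list_states f n))) * (1 + fps_X ^ (\<eta> * f))"
proof (rule fps_ext)
  fix n
  have "\<eta> * f \<le> n \<longleftrightarrow> int \<eta> * int f \<le> int n" by (simp flip: of_nat_mult)
  moreover have "nat (int n - int \<eta> * int f) = n - \<eta> * f" by (simp add: nat_diff_distrib' flip: of_nat_mult)
  ultimately show "fps_nth (Abs_fps (\<lambda>n. int (card (list_states (Suc f) n)))) n =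
      fps_nth (Abs_fps (\<lambda>n. int (card (list_states f n))) * (1 + fps_X ^ (\<eta> * f))) n"
    using card_list_states_Suc[OF assms finite_list_states finite_list_states, of n]
    by (auto simp: distrib_left fps_X_power_mult_right_nth simp del: of_nat_mult)
qed

lemma list_states_fps:
  "Abs_fps (\<lambda>n. int (card (list_states (Suc m) n))) =
    Abs_fps (\<lambda>n. int (bressoudB 0 l \<alpha> \<eta> (Suc K) (Suc c) n)) * (\<Prod>i<m. 1 + fps_X ^ (\<eta> * Suc i))"
proof (induction m)
  case 0
  then show ?case by (simp add: card_bressoudB_set)
next
  case (Suc m)
  then show ?case using list_states_fps_Suc[of "Suc m"] by (simp add: mult.assoc)
qed

end

text \<open>The factor with index \<open>i\<close> differs from 1 only in degree
  \<open>\<eta> * Suc i\<close>, which exceeds \<open>n\<close> as soon as \<open>i\<close> is at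
  least \<open>n\<close>.\<close>

lemma qpoch_inf_nth:
  fixes \<eta> n m :: nat
  assumes "0 < \<eta>" "n \<le> m"
  shows "fps_nth (qpoch_inf (- (fps_X ^ \<eta>)) (fps_X ^ \<eta>)) n = fps_nth (\<Prod>i<m. 1 + fps_X ^ (\<eta> * Suc i)) n"
proof -
  define G :: "nat \<Rightarrow> int fps" where "G m = (\<Prod>i<m. 1 + fps_X ^ (\<eta> * Suc i))" for m
  define Q where "Q = Abs_fps (\<lambda>n. fps_nth (G n) n)"
  have stable: "n \<le> m \<Longrightarrow> fps_nth (G m) n = fps_nth (G n) n" for n m
  proof (induction m rule: dec_induct)
    case (step m)
    have "Suc m \<le> \<eta> * Suc m" using assms(1) by (cases \<eta>) auto
    then have "n < \<eta> * Suc m" by (rule order.strict_trans2[rotated]) (use step in simp)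
    then show ?case using step unfolding G_def by (simp add: distrib_left fps_X_power_mult_right_nth)
  qed simp
  have lim: "(\<lambda>m. \<Prod>i\<le>m. 1 - (- (fps_X ^ \<eta>)) * (fps_X ^ \<eta>) ^ (i + 0) :: int fps) \<longlonglongrightarrow> Q"
    unfolding tendsto_fps_iff
  proof
    fix n
    have "(\<Prod>i\<le>m. 1 - (- (fps_X ^ \<eta>)) * (fps_X ^ \<eta>) ^ (i + 0) :: int fps) = G (Suc m)" for m
      unfolding G_def lessThan_Suc_atMost by (simp add: power_add power_mult)
    moreover have "fps_nth (G (Suc m)) n = fps_nth Q n" if "n \<le> m" for m
      using stable[OF le_SucI[OF that]] unfolding Q_def by simp
    then have "\<forall>\<^sub>F m in sequentially. fps_nth (G (Suc m)) n = fps_nth Q n"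
      by (rule eventually_sequentiallyI)
    ultimately show "\<forall>\<^sub>F m in sequentially. fps_nth (\<Prod>i\<le>m. 1 - (- (fps_X ^ \<eta>)) * (fps_X ^ \<eta>) ^ (i + 0)) n = fps_nth Q n"
      by simp
  qed
  \<comment> \<open>\<open>raw_has_prod\<close> asks for a nonzero limit; the constant coefficient,
    taken from the empty product \<open>G 0\<close>, provides it.\<close>
  have "fps_nth Q 0 = 1" unfolding Q_def G_def by simp
  then have "Q \<noteq> 0" by auto
  then have "(\<lambda>i. 1 - (- (fps_X ^ \<eta>)) * (fps_X ^ \<eta>) ^ i :: int fps) has_prod Q"
    using lim unfolding has_prod_def raw_has_prod_def by blast
  then have "qpoch_inf (- (fps_X ^ \<eta>)) (fps_X ^ \<eta>) = Q"
    unfolding qpoch_inf_def by (rule has_prod_unique[symmetric])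
  then show ?thesis using stable[OF assms(2)] unfolding Q_def G_def by (simp only: fps_nth_Abs_fps)
qed

theorem theorem1p13:
  fixes l \<eta> k r :: nat and \<alpha> :: "nat \<Rightarrow> nat"
  assumes "0 < \<eta>"
    and "\<forall>i\<in>{1..l}. 0 < \<alpha> i \<and> \<alpha> i < \<eta>"
    and "strict_mono_on {1..l} \<alpha>"
    and "\<forall>i\<in>{1..l}. \<alpha> i = \<eta> - \<alpha> (l + 1 - i)"
    and "k \<ge> r" and "r \<ge> l" and "k > l"
    and "\<not> (k = 1 \<and> r = 1)"
  shows "Abs_fps (\<lambda>n. int (overB 1 l \<alpha> \<eta> k r n)) =
    qpoch_inf (- (fps_X ^ \<eta>)) (fps_X ^ \<eta>) * Abs_fps (\<lambda>n. int (bressoudB 0 l \<alpha> \<eta> k r n))"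
proof (cases "r = 0")
  case True
  \<comment> \<open>For \<open>r = 0\<close> condition (4) demands a cardinality of at most
    \<open>- 1\<close>, so both sides are zero.\<close>
  have "overB_set 1 l \<alpha> \<eta> k r n = {}" "bressoudB_set 0 l \<alpha> \<eta> k r n = {}" for n
    unfolding overB_set_def bressoudB_set_def True by auto
  then show ?thesis unfolding overB_def bressoudB_def by (simp add: fps_zero_def[symmetric])
next
  case False
  \<comment> \<open>Positivity of \<open>k - 1\<close>: as \<open>1 \<le> r \<le> k\<close>, the
    value \<open>k = 1\<close> would force \<open>r = 1\<close>, the excluded case.\<close>
  then have kr: "k = Suc (k - 1)" "r = Suc (r - 1)" "0 < k - 1" using assms by auto
  interpret bressoud_params "k - 1" "r - 1" \<eta> l \<alpha>
    by unfold_locales (use assms kr in auto)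
  show ?thesis
  proof (rule fps_ext)
    fix n
    let ?B = "Abs_fps (\<lambda>n. int (bressoudB 0 l \<alpha> \<eta> k r n))"
    have "int (overB 1 l \<alpha> \<eta> k r n) = fps_nth (Abs_fps (\<lambda>n. int (card (list_states (Suc n) n)))) n"
      using card_overB_set[of n "Suc n"] kr by simp
    also have "\<dots> = fps_nth (?B * (\<Prod>i<n. 1 + fps_X ^ (\<eta> * Suc i))) n"
      using arg_cong[OF list_states_fps[of n], of "\<lambda>F. fps_nth F n"] kr by simp
    \<comment> \<open>The coefficient of degree \<open>n\<close> involves the product only in
      degrees \<open>n - i\<close>, where \<open>n\<close> factors suffice.\<close>
    also have "\<dots> = fps_nth (?B * qpoch_inf (- (fps_X ^ \<eta>)) (fps_X ^ \<eta>)) n"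
      unfolding fps_mult_nth qpoch_inf_nth[OF assms(1) diff_le_self] ..
    finally show "fps_nth (Abs_fps (\<lambda>n. int (overB 1 l \<alpha> \<eta> k r n))) n =
        fps_nth (qpoch_inf (- (fps_X ^ \<eta>)) (fps_X ^ \<eta>) * ?B) n"
      by (simp add: mult.commute)
  qed
qed

end
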